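(* Let $\varepsilon>0$ and assume $n\in\Omega(\varepsilon^{-4})$ is sufficiently large. For $r\in\Omega(n^{1/3})$, there exists an algorithm that, for the problem of maximizing a monotone submodular function $f$ under a matroid constraint $\mathcal{I}(\mathcal{M})$ with rank $r$ given only the noisy value oracle $\tilde f$ (and a membership oracle for $\mathcal{I}(\mathcal{M})$), returns a $\left(\frac12\left(1-\frac1e\right)-O(\varepsilon)\right)$-approximation with probability $1-O\left(\frac1{n^2}\right)$, using $O(n^6\varepsilon^{-1})$ queries to $\tilde f$. Moreover, if $\mathcal{M}$ is strongly base-orderable, the approximation ratio can be improved to $1-\frac1e-O(\varepsilon)$.
   Context: $N$ is a ground set with $|N|=n$. $f:2^N\to\mathbb{R}_{\ge0}$ is monotone, submodular, $f(\varnothing)=0$. A matroid $\mathcal{M}=(N,\mathcal{I}(\mathcal{M}))$: $\varnothing$ is independent, subsets of independent sets are independent, and if $|I_1|<|I_2|$ are independent there is $e\in I_2\setminus I_1$ with $I_1\cup\{e\}$ independent; rank is the maximum size of an independent set, and maximal independent sets are bases. It is assumed all singletons are independent. $\mathcal{M}$ is strongly base-orderable if for any two bases $B_1,B_2$ there is a bijection $\sigma:B_1\to B_2$ such that for every $X\subseteq B_1$, both $(B_1\setminus X)\cup\sigma(X)$ and $(B_2\setminus\sigma(X))\cup X$ are bases. A noise distribution $\mathcal{D}$ has a generalized exponential tail if for $x$ beyond some $x_0$ its density is $e^{-\sum_ic_ix^{\gamma_i}}$ with $\gamma_0\ge\gamma_1\ge\cdots$, $\gamma_0\ge1$, $c_0>0$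 (for bounded support: an atom at the supremum or density continuous and nonzero there); $\mathbb{E}[\mathcal{D}]=1$. The noisy oracle satisfies $\tilde f(S)=\xi_Sf(S)$ with $\xi_S$ i.i.d. from $\mathcal{D}$ (one draw per set). A $\beta$-approximation is an $S\in\mathcal{I}(\mathcal{M})$ with $f(S)\ge\beta\max_{T\in\mathcal{I}(\mathcal{M})}f(T)$. *)

theory Defs
  imports "HOL-Probability.Probability"
begin

subsection \<open>Set functions and matroids\<close>

definition submodular_on :: "'a set \<Rightarrow> ('a set \<Rightarrow> real) \<Rightarrow> bool" where
  "submodular_on N f \<longleftrightarrow>
     (\<forall>A\<subseteq>N. \<forall>B\<subseteq>N. f (A \<union> B) + f (A \<inter> B) \<le> f A + f B)"

definition matroid :: "'a set \<Rightarrow> 'a set set \<Rightarrow> bool" where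
  "matroid N \<I> \<longleftrightarrow>
     finite N \<and> \<I> \<subseteq> Pow N \<and> {} \<in> \<I> \<and>
     (\<forall>B\<in>\<I>. \<forall>A\<subseteq>B. A \<in> \<I>) \<and>
     (\<forall>I\<^sub>1\<in>\<I>. \<forall>I\<^sub>2\<in>\<I>. card I\<^sub>1 < card I\<^sub>2 \<longrightarrow> (\<exists>e\<in>I\<^sub>2 - I\<^sub>1. insert e I\<^sub>1 \<in> \<I>))"

definition matroid_rank :: "'a set set \<Rightarrow> nat" where
  "matroid_rank \<I> = Max (card ` \<I>)"

definition bases :: "'a set set \<Rightarrow> 'a set set" where
  "bases \<I> = {B \<in> \<I>. \<forall>A\<in>\<I>. B \<subseteq> A \<longrightarrow> A = B}"

definition strongly_base_orderable :: "'a set set \<Rightarrow> bool" where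
  "strongly_base_orderable \<I> \<longleftrightarrow>
     (\<forall>B\<^sub>1\<in>bases \<I>. \<forall>B\<^sub>2\<in>bases \<I>. \<exists>\<sigma>. bij_betw \<sigma> B\<^sub>1 B\<^sub>2 \<and>
        (\<forall>X\<subseteq>B\<^sub>1. (B\<^sub>1 - X) \<union> \<sigma> ` X \<in> bases \<I> \<and> (B\<^sub>2 - \<sigma> ` X) \<union> X \<in> bases \<I>))"

definition approx_solutions :: "'a set set \<Rightarrow> ('a set \<Rightarrow> real) \<Rightarrow> real \<Rightarrow> 'a set set" where
  "approx_solutions \<I> f \<beta> = {S \<in> \<I>. f S \<ge> \<beta> * Max (f ` \<I>)}"

subsection \<open>Noise distributions\<close>

definition has_density_on :: "real measure \<Rightarrow> (real \<Rightarrow> real) \<Rightarrow> real set \<Rightarrow> bool" where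
  "has_density_on D \<rho> X \<longleftrightarrow>
     \<rho> \<in> borel_measurable borel \<and> (\<forall>x\<in>X. 0 \<le> \<rho> x) \<and>
     (\<forall>A\<in>sets borel. A \<subseteq> X \<longrightarrow>
        emeasure D A = (\<integral>\<^sup>+x. ennreal (\<rho> x) * indicator A x \<partial>lborel))"

definition measure_support :: "real measure \<Rightarrow> real set" where
  "measure_support D = {x. \<forall>U. open U \<longrightarrow> x \<in> U \<longrightarrow> 0 < emeasure D U}"

text \<open>
  The exponent may be a finite sum (take the remaining \<open>c i\<close> to be \<open>0\<close>) or a convergent
  series. In the case of bounded support, the density is only needed near the supremum \<open>s\<close>
  of the support; it vanishes above \<open>s\<close>, so continuity at \<open>s\<close> is from the left.
\<close>

definition generalized_exponential_tail :: "real measure \<Rightarrow> bool" where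
  "generalized_exponential_tail D \<longleftrightarrow>
     (\<exists>x\<^sub>0\<ge>0. \<exists>(c :: nat \<Rightarrow> real) (\<gamma> :: nat \<Rightarrow> real).
        antimono \<gamma> \<and> \<gamma> 0 \<ge> 1 \<and> c 0 > 0 \<and>
        (\<forall>x>x\<^sub>0. summable (\<lambda>i. c i * x powr \<gamma> i)) \<and>
        has_density_on D (\<lambda>x. exp (- (\<Sum>i. c i * x powr \<gamma> i))) {x\<^sub>0<..}) \<or>
     (bounded (measure_support D) \<and>
      (let s = Sup (measure_support D) in
         measure D {s} > 0 \<or>
         (\<exists>\<delta>>0. \<exists>\<rho>. has_density_on D \<rho> {s - \<delta><..s} \<and>
            continuous (at_left s) \<rho> \<and> \<rho> s \<noteq> 0)))"

definition noise_distribution :: "real measure \<Rightarrow> bool" where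
  "noise_distribution D \<longleftrightarrow>
     prob_space D \<and> sets D = sets borel \<and> generalized_exponential_tail D \<and>
     integrable D (\<lambda>x. x) \<and> (\<integral>x. x \<partial>D) = 1"

text \<open>
  One independent draw from \<open>D\<close> per subset of the ground set. A sample \<open>\<xi>\<close> is drawn once and
  stays fixed, so repeating a query yields no new information.
\<close>

definition noise_space :: "'a set \<Rightarrow> real measure \<Rightarrow> ('a set \<Rightarrow> real) measure" where
  "noise_space N D = (\<Pi>\<^sub>M S\<in>Pow N. D)"

definition noisy_oracle :: "'a set \<Rightarrow> ('a set \<Rightarrow> real) \<Rightarrow> ('a set \<Rightarrow> real) \<Rightarrow> 'a set \<Rightarrow> real" where
  "noisy_oracle N f \<xi> S = (if S \<subseteq> N then \<xi> S * f S else 0)"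

subsection \<open>Algorithms with a value oracle and a membership oracle\<close>

text \<open>
  An algorithm is a (possibly randomized) adaptive decision tree: it may query the value
  oracle or the membership oracle, or draw a discrete random number, and continues depending on
  the answer. Every path of the tree is finite.
\<close>

datatype 'a oracle_alg =
    Output "'a set"
  | Value_Query "'a set" "real \<Rightarrow> 'a oracle_alg"
  | Member_Query "'a set" "bool \<Rightarrow> 'a oracle_alg"
  | Random_Draw "nat pmf" "nat \<Rightarrow> 'a oracle_alg"

text \<open>Joint distribution of the returned set and the number of value queries.\<close>

primrec run :: "'a oracle_alg \<Rightarrow> ('a set \<Rightarrow> real) \<Rightarrow> ('a set \<Rightarrow> bool) \<Rightarrow> ('a set \<times> nat) pmf" where
  "run (Output S) val mem = return_pmf (S, 0)"
| "run (Value_Query S k) val mem = map_pmf (apsnd Suc) (run (k (val S)) val mem)"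
| "run (Member_Query S k) val mem = run (k (mem S)) val mem"
| "run (Random_Draw p k) val mem = bind_pmf p (\<lambda>i. run (k i) val mem)"

definition uses_at_most_queries ::
  "'a oracle_alg \<Rightarrow> 'a set \<Rightarrow> 'a set set \<Rightarrow> ('a set \<Rightarrow> real) \<Rightarrow> real measure \<Rightarrow> real \<Rightarrow> bool" where
  "uses_at_most_queries P N \<I> f D b \<longleftrightarrow>
     (\<forall>\<xi>\<in>space (noise_space N D).
        \<forall>(S, q)\<in>set_pmf (run P (noisy_oracle N f \<xi>) (\<lambda>S. S \<in> \<I>)). real q \<le> b)"

text \<open>
  The probability is over both the noise and the draws of the algorithm. If the inner probability
  is not measurable in \<open>\<xi>\<close>, the integral is \<open>0\<close>, so a positive lower bound on
  \<open>success_prob\<close> includes measurability.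
\<close>

definition success_prob ::
  "'a oracle_alg \<Rightarrow> 'a set \<Rightarrow> 'a set set \<Rightarrow> ('a set \<Rightarrow> real) \<Rightarrow> real measure \<Rightarrow> real \<Rightarrow> real" where
  "success_prob P N \<I> f D \<beta> =
     (\<integral>\<xi>. measure_pmf.prob (run P (noisy_oracle N f \<xi>) (\<lambda>S. S \<in> \<I>))
            {(S, q). S \<in> approx_solutions \<I> f \<beta>} \<partial>noise_space N D)"

end

theory Submission
  imports Defs "HOL-Real_Asymp.Real_Asymp"
begin

text \<open>
  For a set \<open>A\<close> let \<open>A(p)\<close> contain each element of \<open>A\<close> independently with probability \<open>p\<close>, and let
  \<open>W\<^sub>A(e)\<close> be the expected marginal \<open>f (B + e) - f B\<close>, where \<open>B\<close> is distributed as \<open>(A - e)(p)\<close> for a random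
  level \<open>p\<close> with density proportional to \<open>e\<^sup>p\<close> (discretised). Swapping \<open>b \<in> A\<close> for \<open>c \<notin> A\<close> raises the
  potential \<open>\<integral> e\<^sup>p / p \<cdot> E f(A(p)) dp\<close> by at least \<open>W\<^sub>A(c) - W\<^sub>A(b)\<close>. Summing over an
  exchange bijection between \<open>A\<close> and an optimal base, concavity of \<open>p \<mapsto> E f(A(p))\<close> and a telescoping
  sum show that a base without improving swaps is a \<open>1 - 1/e\<close> approximation.

  The random sets \<open>B\<close> also average out the noise. For a fixed noise sample the mean of the
  noisy values of \<open>B\<close> is a weighted sum of independent terms. Each weight is at most
  \<open>(1 - \<epsilon>/3)\<^sup>r\<^sup>-\<^sup>1\<close>, which is exponentially small in a power of \<open>n\<close> because \<open>r \<ge> \<kappa> n\<^sup>1\<^sup>/\<^sup>3\<close> and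
  \<open>\<epsilon> \<ge> n\<^sup>-\<^sup>1\<^sup>/\<^sup>4\<close>. Hence, by Hoeffding's inequality for the noise truncated at \<open>n\<^sup>1\<^sup>/\<^sup>8\<close>, the means
  are simultaneously accurate for all bases, although there may be exponentially many, and the
  adaptivity of the search is harmless. Given such a noise sample, \<open>n\<^sup>3\<close> draws per element
  estimate \<open>W\<^sub>A\<close> well enough.
\<close>

subsection \<open>Random subsets\<close>

text \<open>Three obstacles shape the argument. The oracle never refreshes an answer, so one set can
  never be denoised. The union bound over all pairs of a pool and an element has up to 2^n * n
  terms, so each pool needs a failure probability of order exp (- n^2); this forces the levels p to
  stay a step h away from 0 and from 1, since a level close to either would put too much weight on a
  single set. Hoeffding's inequality needs bounded noise, but clipping at T replaces the mean 1 by
  an unknown number, \<open>noise_mean\<close>. That number multiplies all gains alike and lies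
  between 1/2 and the mean of |x|, so swaps can still be compared, at the price of a constant factor
  in thresholds and step counts. The algorithm itself does not know T: clipping is a device of the
  analysis, and on a typical noise sample the random draws are very unlikely to meet a value above T
  at all. The rank condition enters through r * h, which grows at least like n^(1/3) / n^(1/4) and
  hence makes (1 - h)^(r - 1) smaller than any power of 1/n.\<close>

definition sub_exp :: "real \<Rightarrow> 'a set \<Rightarrow> ('a set \<Rightarrow> real) \<Rightarrow> real" where
  "sub_exp p A g = (\<Sum>B\<in>Pow A. p ^ card B * (1 - p) ^ card (A - B) * g B)"

lemma sub_exp_empty [simp]: "sub_exp p {} g = g {}"
  by (simp add: sub_exp_def)

text \<open>Conditioning on the coin of \<open>a\<close>: the subsets of \<open>insert a A\<close>
  are split by whether they contain \<open>a\<close>. The two monotonicity inductions below consume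
  one coin at a time through this recursion, so they must keep the averaged function
  arbitrary.\<close>

lemma sub_exp_insert:
  assumes "finite A" "a \<notin> A"
  shows "sub_exp p (insert a A) g = sub_exp p A (\<lambda>B. (1 - p) * g B + p * g (insert a B))"
proof -
  have inj: "inj_on (insert a) (Pow A)"
    using assms(2) by (auto simp: inj_on_def)
  have disj: "Pow A \<inter> insert a ` Pow A = {}"
    using assms(2) by auto
  have fin: "finite (Pow A)" using assms(1) by simp
  have 1: "p ^ card B * (1 - p) ^ card (insert a A - B) * g B
      = p ^ card B * (1 - p) ^ card (A - B) * ((1 - p) * g B)" if "B \<in> Pow A" for B
  proof -
    have "insert a A - B = insert a (A - B)" using that assms(2) by auto
    then show ?thesis using assms by (simp add: algebra_simps)
  qed
  have 2: "p ^ card (insert a B) * (1 - p) ^ card (insert a A - insert a B) * g (insert a B)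
      = p ^ card B * (1 - p) ^ card (A - B) * (p * g (insert a B))" if "B \<in> Pow A" for B
  proof -
    have "insert a A - insert a B = A - B" "a \<notin> B" "finite B"
      using that assms by (auto intro: finite_subset)
    then show ?thesis by (simp add: algebra_simps)
  qed
  have "sub_exp p (insert a A) g
      = (\<Sum>B\<in>Pow A. p ^ card B * (1 - p) ^ card (insert a A - B) * g B)
        + (\<Sum>B\<in>Pow A. p ^ card (insert a B) * (1 - p) ^ card (insert a A - insert a B) * g (insert a B))"
    unfolding sub_exp_def Pow_insert
    by (subst sum.union_disjoint[OF fin _ disj]) (use fin in \<open>auto simp: sum.reindex[OF inj]\<close>)
  also have "\<dots> = (\<Sum>B\<in>Pow A. p ^ card B * (1 - p) ^ card (A - B) * ((1 - p) * g B))
        + (\<Sum>B\<in>Pow A. p ^ card B * (1 - p) ^ card (A - B) * (p * g (insert a B)))"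
    using 1 2 by (intro arg_cong2[of _ _ _ _ "(+)"] sum.cong) auto
  finally show ?thesis by (simp add: sub_exp_def distrib_left sum.distrib)
qed

lemma sub_exp_add: "sub_exp p A (\<lambda>B. g B + g' B) = sub_exp p A g + sub_exp p A g'"
  by (simp add: sub_exp_def distrib_left sum.distrib)

lemma sub_exp_diff: "sub_exp p A (\<lambda>B. g B - g' B) = sub_exp p A g - sub_exp p A g'"
  by (simp add: sub_exp_def right_diff_distrib sum_subtractf)

lemma sub_exp_cmult: "sub_exp p A (\<lambda>B. c * g B) = c * sub_exp p A g"
  by (simp add: sub_exp_def sum_distrib_left mult_ac)

lemma sub_exp_sum: "sub_exp p A (\<lambda>B. \<Sum>i\<in>I. g i B) = (\<Sum>i\<in>I. sub_exp p A (g i))"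
  unfolding sub_exp_def by (subst sum.swap) (simp add: sum_distrib_left)

lemma sub_exp_const:
  assumes "finite A" shows "sub_exp p A (\<lambda>_. c) = c"
  using assms
proof (induction A rule: finite_induct)
  case (insert a A)
  have "(1 - p) * c + p * c = c" by (simp add: algebra_simps)
  then show ?case using insert by (simp add: sub_exp_insert)
qed simp

lemma sub_exp_mono:
  assumes "0 \<le> p" "p \<le> 1" "\<And>B. B \<subseteq> A \<Longrightarrow> g B \<le> g' B"
  shows "sub_exp p A g \<le> sub_exp p A g'"
  unfolding sub_exp_def using assms by (intro sum_mono mult_left_mono) auto

text \<open>The coins change from \<open>p\<close> to \<open>q\<close> one at a time. Averaging over
  the coin of \<open>a\<close> preserves the hypothesis on \<open>m\<close> for the remaining
  elements, so the induction hypothesis applies to the averaged function.\<close>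

lemma sub_exp_antimono:
  assumes "finite A" "0 \<le> q" "q \<le> p" "p \<le> 1"
    and "\<And>B a. B \<subseteq> A \<Longrightarrow> a \<in> A \<Longrightarrow> m (insert a B) \<le> m B"
  shows "sub_exp p A m \<le> sub_exp q A m"
  using assms(1,5)
proof (induction A arbitrary: m rule: finite_induct)
  case (insert a A)
  have "sub_exp p (insert a A) m = sub_exp p A (\<lambda>B. (1 - p) * m B + p * m (insert a B))"
    using insert by (simp add: sub_exp_insert)
  also have "\<dots> \<le> sub_exp p A (\<lambda>B. (1 - q) * m B + q * m (insert a B))"
  proof (rule sub_exp_mono)
    fix B assume "B \<subseteq> A"
    then have "m (insert a B) \<le> m B" using insert.prems[of B a] by auto
    then have "0 \<le> (p - q) * (m B - m (insert a B))" using assms by simp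
    then show "(1 - p) * m B + p * m (insert a B) \<le> (1 - q) * m B + q * m (insert a B)"
      by (simp add: algebra_simps)
  qed (use assms in auto)
  also have "\<dots> \<le> sub_exp q A (\<lambda>B. (1 - q) * m B + q * m (insert a B))"
  proof (rule insert.IH)
    fix B x assume B: "B \<subseteq> A" "x \<in> A"
    have "m (insert x B) \<le> m B" using B insert.prems[of B x] by auto
    moreover have "m (insert x (insert a B)) \<le> m (insert a B)"
      using B insert.prems[of "insert a B" x] by auto
    ultimately show "(1 - q) * m (insert x B) + q * m (insert a (insert x B))
        \<le> (1 - q) * m B + q * m (insert a B)"
      using assms by (intro add_mono mult_left_mono) (auto simp: insert_commute)
  qed
  also have "\<dots> = sub_exp q (insert a A) m"
    using insert by (simp add: sub_exp_insert)
  finally show ?case .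
qed simp

lemma sub_exp_remove_ge:
  assumes "finite A" "0 \<le> p" "p \<le> 1"
    and "\<And>B. B \<subseteq> A - {b} \<Longrightarrow> m (insert b B) \<le> m B"
  shows "sub_exp p A m \<le> sub_exp p (A - {b}) m"
proof (cases "b \<in> A")
  case True
  have "sub_exp p (insert b (A - {b})) m
      = sub_exp p (A - {b}) (\<lambda>B. (1 - p) * m B + p * m (insert b B))"
    using assms by (intro sub_exp_insert) auto
  also have "\<dots> \<le> sub_exp p (A - {b}) m"
  proof (rule sub_exp_mono)
    fix B assume "B \<subseteq> A - {b}"
    then have "p * m (insert b B) \<le> p * m B" using assms by (intro mult_left_mono) auto
    then show "(1 - p) * m B + p * m (insert b B) \<le> m B" by (simp add: algebra_simps)
  qed (use assms in auto)
  finally show ?thesis using True by (simp add: insert_absorb)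
qed simp

text \<open>The expected value at density \<open>p\<close> is concave in \<open>p\<close>, and the sum on the left is its derivative.\<close>

lemma sub_exp_derivative_le:
  assumes "finite A" "0 \<le> q" "q \<le> p" "p \<le> 1"
    and "\<And>B a b. B \<subseteq> A \<Longrightarrow> a \<in> A \<Longrightarrow> b \<in> A \<Longrightarrow>
      f (insert a (insert b B)) - f (insert b B) \<le> f (insert a B) - f B"
  shows "(p - q) * (\<Sum>b\<in>A. sub_exp p (A - {b}) (\<lambda>B. f (insert b B) - f B))
    \<le> sub_exp p A f - sub_exp q A f"
  using assms(1,5)
proof (induction A arbitrary: f rule: finite_induct)
  case (insert a A)
  \<comment> \<open>Both densities are compared with the coin of \<open>a\<close> kept at the larger
    density \<open>p\<close>. On the \<open>q\<close> side this is off by (p - q) * sub_exp q A d,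
    and since the marginal \<open>d\<close> is antitone, that amount covers the term of
    \<open>a\<close> in the sum.\<close>
  define g where "g = (\<lambda>B. (1 - p) * f B + p * f (insert a B))"
  define d where "d = (\<lambda>B. f (insert a B) - f B)"
  have ab: "sub_exp p (insert a A - {b}) (\<lambda>B. f (insert b B) - f B)
      = sub_exp p (A - {b}) (\<lambda>B. g (insert b B) - g B)" if "b \<in> A" for b
  proof -
    have "insert a A - {b} = insert a (A - {b})" using that insert.hyps by auto
    then show ?thesis
      using insert.hyps by (simp add: sub_exp_insert g_def algebra_simps insert_commute)
  qed
  have aa: "insert a A - {a} = A" using insert.hyps by auto
  have S: "(\<Sum>b\<in>insert a A. sub_exp p (insert a A - {b}) (\<lambda>B. f (insert b B) - f B))
      = sub_exp p A d + (\<Sum>b\<in>A. sub_exp p (A - {b}) (\<lambda>B. g (insert b B) - g B))"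
    using insert.hyps ab aa by (simp add: d_def)
  have IH: "(p - q) * (\<Sum>b\<in>A. sub_exp p (A - {b}) (\<lambda>B. g (insert b B) - g B))
      \<le> sub_exp p A g - sub_exp q A g"
  proof (rule insert.IH)
    fix B x y assume B: "B \<subseteq> A" "x \<in> A" "y \<in> A"
    have "f (insert x (insert y B)) - f (insert y B) \<le> f (insert x B) - f B"
      using B by (intro insert.prems) auto
    then have "(1 - p) * (f (insert x (insert y B)) - f (insert y B))
        \<le> (1 - p) * (f (insert x B) - f B)"
      using assms by (intro mult_left_mono) auto
    moreover
    have "f (insert x (insert y (insert a B))) - f (insert y (insert a B))
        \<le> f (insert x (insert a B)) - f (insert a B)"
      using B by (intro insert.prems) auto
    then have "p * (f (insert x (insert y (insert a B))) - f (insert y (insert a B)))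
        \<le> p * (f (insert x (insert a B)) - f (insert a B))"
      using assms by (intro mult_left_mono) auto
    ultimately show "g (insert x (insert y B)) - g (insert y B) \<le> g (insert x B) - g B"
      by (simp add: g_def algebra_simps insert_commute)
  qed
  have anti: "sub_exp p A d \<le> sub_exp q A d"
  proof (rule sub_exp_antimono)
    fix B x assume B: "B \<subseteq> A" "x \<in> A"
    show "d (insert x B) \<le> d B"
      using insert.prems[of B a x] B unfolding d_def by auto
  qed (use insert assms in auto)
  have "g = (\<lambda>B. f B + p * d B)" by (auto simp: g_def d_def algebra_simps)
  then have gE: "sub_exp s A g = sub_exp s A f + p * sub_exp s A d" for s
    by (simp add: sub_exp_add sub_exp_cmult)
  have "(\<lambda>B. (1 - s) * f B + s * f (insert a B)) = (\<lambda>B. f B + s * d B)" for s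
    by (auto simp: d_def algebra_simps)
  then have fE: "sub_exp s (insert a A) f = sub_exp s A f + s * sub_exp s A d" for s
    using insert.hyps by (simp add: sub_exp_insert sub_exp_add sub_exp_cmult)
  have "(p - q) * sub_exp p A d \<le> (p - q) * sub_exp q A d"
    using anti assms by (intro mult_left_mono) auto
  then show ?case
    unfolding S fE using IH unfolding gE by (simp add: algebra_simps)
qed simp

subsection \<open>The non-oblivious potential\<close>

text \<open>With h = 1 / (l + 1) the l levels are h, 2h, ..., 1 - h. The margin at 1 and at 0 bounds
  the weight of every single set, and the margin at 0 bounds the divisor in
  \<open>potential\<close>.\<close>

definition step_size :: "nat \<Rightarrow> real" where
  "step_size l = 1 / (real l + 1)"

definition density_at :: "nat \<Rightarrow> nat \<Rightarrow> real" where
  "density_at l j = (real j + 1) * step_size l"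

text \<open>(1 + h)^j is the discrete counterpart of e^p that makes the sum in
  \<open>local_ratio_telescope\<close> collapse exactly, with no discretisation error to
  estimate.\<close>

definition level_weight :: "nat \<Rightarrow> nat \<Rightarrow> real" where
  "level_weight l j = (1 + step_size l) ^ j / (\<Sum>i<l. (1 + step_size l) ^ i)"

definition mix_exp :: "nat \<Rightarrow> 'a set \<Rightarrow> ('a set \<Rightarrow> real) \<Rightarrow> real" where
  "mix_exp l A g = (\<Sum>j<l. level_weight l j * sub_exp (density_at l j) A g)"

definition swap_weight :: "nat \<Rightarrow> ('a set \<Rightarrow> real) \<Rightarrow> 'a set \<Rightarrow> 'a \<Rightarrow> real" where
  "swap_weight l f A e = mix_exp l (A - {e}) (\<lambda>B. f (insert e B) - f B)"

text \<open>A swap changes the expectation at density p by p times a difference of marginals; the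
  divisor cancels this p.\<close>

definition potential :: "nat \<Rightarrow> ('a set \<Rightarrow> real) \<Rightarrow> 'a set \<Rightarrow> real" where
  "potential l f A =
     (\<Sum>j<l. level_weight l j / density_at l j * sub_exp (density_at l j) A f)"

definition local_ratio :: "nat \<Rightarrow> real" where
  "local_ratio l = 1 - 1 / (1 + step_size l) ^ l"

lemma step_size_pos: "0 < step_size l"
  by (simp add: step_size_def)

lemma level_weight_nonneg: "0 \<le> level_weight l j"
  unfolding level_weight_def using step_size_pos[of l] by (intro divide_nonneg_nonneg sum_nonneg) auto

lemma sum_level_weight: "0 < l \<Longrightarrow> (\<Sum>j<l. level_weight l j) = 1"
proof -
  assume "0 < l"
  then have "0 < (\<Sum>i<l. (1 + step_size l) ^ i)"
    using step_size_pos[of l] by (intro sum_pos) auto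
  then show ?thesis by (simp add: level_weight_def flip: sum_divide_distrib)
qed

lemma density_at_bounds:
  assumes "j < l"
  shows "step_size l \<le> density_at l j" "density_at l j \<le> 1 - step_size l"
    "0 \<le> density_at l j" "density_at l j \<le> 1" "0 < density_at l j"
proof -
  have "real j + 1 \<le> real l" using assms by linarith
  then have "(real j + 1) / (real l + 1) \<le> real l / (real l + 1)"
    by (intro divide_right_mono) auto
  also have "\<dots> = 1 - 1 / (real l + 1)" by (simp add: field_simps)
  finally show 2: "density_at l j \<le> 1 - step_size l" by (simp add: density_at_def step_size_def)
  show 1: "step_size l \<le> density_at l j" by (simp add: density_at_def step_size_def field_simps)
  show "0 \<le> density_at l j" "density_at l j \<le> 1" "0 < density_at l j"
    using 1 2 step_size_pos[of l] by linarith+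
qed

lemma mix_exp_diff: "mix_exp l A (\<lambda>B. g B - g' B) = mix_exp l A g - mix_exp l A g'"
  by (simp add: mix_exp_def sub_exp_diff right_diff_distrib sum_subtractf)

lemma mix_exp_const: "finite A \<Longrightarrow> 0 < l \<Longrightarrow> mix_exp l A (\<lambda>_. c) = c"
  by (simp add: mix_exp_def sub_exp_const sum_level_weight flip: sum_distrib_right)

text \<open>A discrete product rule for e^p \<phi>(p): with P j = \<phi>(j h), the term (1 + h)^j *
  (P (j+1) + (P (j+1) - P j) / h) equals ((1 + h)^(j+1) * P (j+1) - (1 + h)^j * P j) / h. The
  geometric normaliser ((1 + h)^l - 1) / h then produces \<open>local_ratio\<close>.\<close>

lemma local_ratio_telescope:
  fixes \<phi> :: "real \<Rightarrow> real"
  assumes "0 < l" "\<phi> 0 = 0"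
  defines "h \<equiv> step_size l"
  shows "(\<Sum>j<l. level_weight l j * (\<phi> (density_at l j) + (\<phi> (density_at l j) - \<phi> (density_at l j - h)) / h))
    = \<phi> (density_at l (l - 1)) / local_ratio l"
proof -
  have h: "0 < h" by (simp add: h_def step_size_pos)
  define Z where "Z = (\<Sum>i<l. (1 + h) ^ i)"
  have Zeq: "Z = ((1 + h) ^ l - 1) / h"
    unfolding Z_def using h by (simp add: geometric_sum)
  have "1 < (1 + h) ^ l" using h \<open>0 < l\<close> by (simp add: one_less_power)
  then have Zpos: "0 < Z" using h by (simp add: Zeq)
  define P where "P = (\<lambda>j. \<phi> (real j * h))"
  have tel: "(\<Sum>j<k. (1 + h) ^ j * (P (Suc j) + (P (Suc j) - P j) / h)) = (1 + h) ^ k / h * P k" for k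
  proof (induction k)
    case 0 then show ?case using assms by (simp add: P_def)
  next
    case (Suc k)
    then show ?case using h by (simp add: field_simps)
  qed
  have "density_at l j = real (Suc j) * h" "density_at l j - h = real j * h" for j
    by (simp_all add: density_at_def h_def algebra_simps)
  then have "(\<Sum>j<l. level_weight l j * (\<phi> (density_at l j) + (\<phi> (density_at l j) - \<phi> (density_at l j - h)) / h))
      = (\<Sum>j<l. (1 + h) ^ j * (P (Suc j) + (P (Suc j) - P j) / h)) / Z"
    by (simp add: level_weight_def P_def Z_def h_def sum_divide_distrib)
  also have "\<dots> = (1 + h) ^ l / h / Z * P l" by (simp add: tel)
  also have "(1 + h) ^ l / h / Z = 1 / local_ratio l"
    using h \<open>1 < (1 + h) ^ l\<close> unfolding Zeq local_ratio_def h_def[symmetric]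
    by (simp add: field_simps)
  also have "P l = \<phi> (density_at l (l - 1))"
    using assms by (simp add: P_def density_at_def h_def)
  finally show ?thesis by simp
qed

lemma local_ratio_pos: "0 < l \<Longrightarrow> 0 < local_ratio l"
  unfolding local_ratio_def using step_size_pos[of l] by (simp add: one_less_power)

lemma local_ratio_le_1: "local_ratio l \<le> 1"
  unfolding local_ratio_def using step_size_pos[of l] by simp

text \<open>Since l h = 1 - h, the bound ln (1 + h) >= h - h^2 gives l ln (1 + h) >= (1 - h)^2 >= 1
  - 2h, hence (1 + h)^(-l) <= exp (-1 + 2h). The last step to exp (-1) + 2h uses 2h <= 1, which
  holds because l >= 1, and e >= 2.\<close>

lemma local_ratio_ge: "0 < l \<Longrightarrow> 1 - 1 / exp 1 - 2 * step_size l \<le> local_ratio l"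
proof -
  assume l: "0 < l"
  define h where "h = step_size l"
  have h: "0 < h" "h \<le> 1" "real l * h = 1 - h"
    by (auto simp: h_def step_size_def field_simps)
  have "exp (-1 + 2 * h) * (1 + h) ^ l \<ge> 1"
  proof -
    have "h - h\<^sup>2 \<le> ln (1 + h)" using h by (intro ln_one_plus_pos_lower_bound) auto
    then have "real l * (h - h\<^sup>2) \<le> real l * ln (1 + h)" by (intro mult_left_mono) auto
    moreover have "real l * (h - h\<^sup>2) = (real l * h) * (1 - h)" by (simp add: power2_eq_square algebra_simps)
    moreover have "(1 - h) * (1 - h) \<ge> 1 - 2 * h" by (simp add: algebra_simps)
    ultimately have "1 - 2 * h \<le> real l * ln (1 + h)" using h by simp
    then have "exp (1 - 2 * h) \<le> exp (real l * ln (1 + h))" by simp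
    also have "\<dots> = (1 + h) ^ l" using h by (simp add: exp_of_nat_mult)
    finally have "exp (-1 + 2 * h) * exp (1 - 2 * h) \<le> exp (-1 + 2 * h) * (1 + h) ^ l" by simp
    then show ?thesis by (simp flip: exp_add)
  qed
  then have "1 / (1 + h) ^ l \<le> exp (-1 + 2 * h)"
    using h by (simp add: divide_le_eq)
  also have "\<dots> \<le> exp (-1) + 2 * h"
  proof -
    have h2: "2 * h \<le> 1" using l unfolding h_def step_size_def by (simp add: field_simps)
    have "exp (-1) * exp (2 * h) \<le> exp (-1) * (1 + 2 * h * (exp 1))"
    proof (rule mult_left_mono)
      have "exp (2 * h) \<le> 1 + 2 * h + (2 * h)\<^sup>2" using h2 h by (intro exp_bound) auto
      also have "\<dots> \<le> 1 + 2 * h + 2 * h" using h2 h by (simp add: power2_eq_square mult_left_le)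
      also have "\<dots> \<le> 1 + 2 * h * exp 1"
        using exp_ge_add_one_self[of 1] h by (simp add: mult_left_mono)
      finally show "exp (2 * h) \<le> 1 + 2 * h * exp 1" .
    qed simp
    moreover have "exp (-1) * (1 + 2 * h * (exp 1)) = exp (-1) + 2 * h"
      by (simp add: distrib_left exp_minus)
    ultimately show ?thesis by (metis exp_add)
  qed
  finally show ?thesis by (simp add: local_ratio_def h_def exp_minus field_simps)
qed

section \<open>Swap inequalities for a monotone submodular function\<close>

locale monotone_submodular =
  fixes N :: "'a set" and f :: "'a set \<Rightarrow> real"
  assumes finite_N: "finite N"
    and f_nonneg: "\<And>S. S \<subseteq> N \<Longrightarrow> 0 \<le> f S"
    and f_empty: "f {} = 0"
    and f_mono: "mono_on (Pow N) f"
    and f_submodular: "submodular_on N f"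
begin

lemma f_monoD: "A \<subseteq> B \<Longrightarrow> B \<subseteq> N \<Longrightarrow> f A \<le> f B"
  using f_mono by (auto simp: mono_on_def)

lemma marginal_nonneg: "B \<subseteq> N \<Longrightarrow> e \<in> N \<Longrightarrow> 0 \<le> f (insert e B) - f B"
  using f_monoD[of B "insert e B"] by auto

lemma marginal_antimono:
  assumes "A \<subseteq> B" "B \<subseteq> N" "e \<in> N"
  shows "f (insert e B) - f B \<le> f (insert e A) - f A"
proof (cases "e \<in> B")
  case True
  then show ?thesis using assms marginal_nonneg[of A e] by (auto simp: insert_absorb)
next
  case False
  have "f (insert e A \<union> B) + f (insert e A \<inter> B) \<le> f (insert e A) + f B"
    using assms f_submodular[unfolded submodular_on_def, rule_format, of "insert e A" B] by auto
  moreover have "insert e A \<union> B = insert e B" "insert e A \<inter> B = A" using False assms by auto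
  ultimately show ?thesis by simp
qed

lemma sum_marginals_ge:
  assumes "finite C" "C \<subseteq> N" "B \<subseteq> N"
  shows "f (C \<union> B) - f B \<le> (\<Sum>e\<in>C. f (insert e B) - f B)"
  using assms(1,2)
proof (induction C rule: finite_induct)
  case (insert x C)
  have "f (insert x (C \<union> B)) - f (C \<union> B) \<le> f (insert x B) - f B"
    using insert assms by (intro marginal_antimono) auto
  then show ?case using insert by simp
qed simp

text \<open>Marginals shrink when \<open>b\<close> may join the sample. This moves a marginal from
  the common pool \<open>A\<close> to the pool from which the swap weights are really
  sampled.\<close>

lemma swap_weight_le_level:
  assumes "A \<subseteq> N" "e \<in> N" "0 \<le> p" "p \<le> 1"
  shows "sub_exp p A (\<lambda>B. f (insert e B) - f B) \<le> sub_exp p (A - {b}) (\<lambda>B. f (insert e B) - f B)"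
proof (cases "b \<in> A")
  case True
  show ?thesis
  proof (rule sub_exp_remove_ge)
    fix B assume "B \<subseteq> A - {b}"
    then show "f (insert e (insert b B)) - f (insert b B) \<le> f (insert e B) - f B"
      using assms True by (intro marginal_antimono) auto
  qed (use assms finite_N finite_subset in auto)
qed simp

text \<open>At each level p the marginals of \<open>C\<close> sum to at least f C - \<phi> p, and
  those of \<open>A\<close> to at most the backward slope of the concave \<phi>. The level weights
  turn these bounds into the telescoping sum. The bijection only pairs the terms at the end, so that
  each difference can be the gain of one swap.\<close>

lemma local_gain_sum:
  assumes A: "A \<subseteq> N" and C: "C \<subseteq> N" and l: "0 < l" and \<pi>: "bij_betw \<pi> A C"
  shows "f C - f A / local_ratio l \<le> (\<Sum>b\<in>A. swap_weight l f A (\<pi> b) - swap_weight l f A b)"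
proof -
  have finA: "finite A" and finC: "finite C" using A C finite_N finite_subset by auto
  define \<phi> where "\<phi> = (\<lambda>p. sub_exp p A f)"
  define h where "h = step_size l"
  have h: "0 < h" by (simp add: h_def step_size_pos)
  have \<phi>0: "\<phi> 0 = 0"
  proof -
    have "0 ^ card B * (1 - 0) ^ card (A - B) * f B = 0" if "B \<in> Pow A" for B
      using that finA finite_subset[of B A] by (cases "B = {}") (auto simp: f_empty)
    then show ?thesis unfolding \<phi>_def sub_exp_def by (intro sum.neutral) auto
  qed
  have level: "f C - \<phi> p - (\<phi> p - \<phi> (p - h)) / h
     \<le> (\<Sum>c\<in>C. sub_exp p (A - {c}) (\<lambda>B. f (insert c B) - f B))
       - (\<Sum>b\<in>A. sub_exp p (A - {b}) (\<lambda>B. f (insert b B) - f B))"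
    if p: "h \<le> p" "p \<le> 1" for p
  proof -
    have "(p - (p - h)) * (\<Sum>b\<in>A. sub_exp p (A - {b}) (\<lambda>B. f (insert b B) - f B))
      \<le> sub_exp p A f - sub_exp (p - h) A f"
    proof (rule sub_exp_derivative_le)
      fix B a b assume "B \<subseteq> A" "a \<in> A" "b \<in> A"
      then show "f (insert a (insert b B)) - f (insert b B) \<le> f (insert a B) - f B"
        using A by (intro marginal_antimono) auto
    qed (use p h finA in auto)
    then have 1: "(\<Sum>b\<in>A. sub_exp p (A - {b}) (\<lambda>B. f (insert b B) - f B)) \<le> (\<phi> p - \<phi> (p - h)) / h"
      using h by (simp add: \<phi>_def field_simps)
    have "f C - \<phi> p = sub_exp p A (\<lambda>B. f C - f B)"
      using finA by (simp add: \<phi>_def sub_exp_diff sub_exp_const)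
    also have "\<dots> \<le> sub_exp p A (\<lambda>B. \<Sum>c\<in>C. f (insert c B) - f B)"
    proof (rule sub_exp_mono)
      fix B assume B: "B \<subseteq> A"
      have "f C \<le> f (C \<union> B)" using A B C by (intro f_monoD) auto
      then show "f C - f B \<le> (\<Sum>c\<in>C. f (insert c B) - f B)"
        using sum_marginals_ge[of C B] subset_trans[OF B A] C finC by auto
    qed (use p h in auto)
    also have "\<dots> \<le> (\<Sum>c\<in>C. sub_exp p (A - {c}) (\<lambda>B. f (insert c B) - f B))"
      unfolding sub_exp_sum using A C p h by (intro sum_mono swap_weight_le_level) auto
    finally show ?thesis using 1 by simp
  qed
  \<comment> \<open>The top level is 1 - h rather than 1, so \<phi> there is not f A; monotonicity
    still gives the direction that is needed.\<close>
  have "f A \<ge> \<phi> (density_at l (l - 1))"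
  proof -
    have "\<phi> (density_at l (l - 1)) \<le> sub_exp (density_at l (l - 1)) A (\<lambda>_. f A)"
      unfolding \<phi>_def using density_at_bounds[of "l - 1" l] l A
      by (intro sub_exp_mono f_monoD) auto
    then show ?thesis using finA by (simp add: sub_exp_const)
  qed
  then have "f C - f A / local_ratio l \<le> f C - \<phi> (density_at l (l - 1)) / local_ratio l"
    using local_ratio_pos[OF l] by (simp add: divide_right_mono)
  also have "\<dots> = (\<Sum>j<l. level_weight l j * (f C - \<phi> (density_at l j) -
       (\<phi> (density_at l j) - \<phi> (density_at l j - h)) / h))"
  proof -
    have "(\<Sum>j<l. level_weight l j * (f C - \<phi> (density_at l j) -
         (\<phi> (density_at l j) - \<phi> (density_at l j - h)) / h))
       = (\<Sum>j<l. level_weight l j * f C - level_weight l j * (\<phi> (density_at l j) +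
         (\<phi> (density_at l j) - \<phi> (density_at l j - h)) / h))"
      by (intro sum.cong refl) (simp add: right_diff_distrib distrib_left)
    also have "\<dots> = (\<Sum>j<l. level_weight l j) * f C - \<phi> (density_at l (l - 1)) / local_ratio l"
      unfolding h_def local_ratio_telescope[of l \<phi>, OF l \<phi>0, symmetric] sum_subtractf sum_distrib_right ..
    finally show ?thesis by (simp add: sum_level_weight[OF l])
  qed
  also have "\<dots> \<le> (\<Sum>j<l. level_weight l j * (
       (\<Sum>c\<in>C. sub_exp (density_at l j) (A - {c}) (\<lambda>B. f (insert c B) - f B))
       - (\<Sum>b\<in>A. sub_exp (density_at l j) (A - {b}) (\<lambda>B. f (insert b B) - f B))))"
    using density_at_bounds level_weight_nonneg unfolding h_def[symmetric]
    by (intro sum_mono mult_left_mono level) (auto simp: h_def)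
  also have "\<dots> = (\<Sum>c\<in>C. swap_weight l f A c) - (\<Sum>b\<in>A. swap_weight l f A b)"
    unfolding swap_weight_def mix_exp_def right_diff_distrib sum_subtractf sum_distrib_left
    by (rule arg_cong2[of _ _ _ _ "(-)"]; rule sum.swap)
  also have "(\<Sum>c\<in>C. swap_weight l f A c) = (\<Sum>b\<in>A. swap_weight l f A (\<pi> b))"
    using sum.reindex_bij_betw[OF \<pi>, of "swap_weight l f A"] by simp
  finally show ?thesis by (simp add: sum_subtractf)
qed

text \<open>\<open>A\<close> and the swapped set share A - b, so at each level the change divided by
  p is exactly a difference of two marginals over A - b. The weight of c is sampled from all of
  \<open>A\<close>, as c lies outside, and can only grow when b leaves the pool.\<close>

lemma potential_swap:
  assumes A: "A \<subseteq> N" and b: "b \<in> A" and c: "c \<in> N" "c \<notin> A"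
  shows "swap_weight l f A c - swap_weight l f A b
    \<le> potential l f (insert c (A - {b})) - potential l f A"
proof -
  have finA: "finite (A - {b})" using A finite_N finite_subset by auto
  have level: "sub_exp p (A - {c}) (\<lambda>B. f (insert c B) - f B) - sub_exp p (A - {b}) (\<lambda>B. f (insert b B) - f B)
     \<le> (sub_exp p (insert c (A - {b})) f - sub_exp p A f) / p" if p: "0 < p" "p \<le> 1" for p
  proof -
    have "sub_exp p (insert x (A - {b})) f
        = sub_exp p (A - {b}) f + p * sub_exp p (A - {b}) (\<lambda>B. f (insert x B) - f B)"
      if "x \<notin> A - {b}" for x
    proof -
      have "(\<lambda>B. (1 - p) * f B + p * f (insert x B)) = (\<lambda>B. f B + p * (f (insert x B) - f B))"
        by (auto simp: algebra_simps)
      then show ?thesis using finA that by (simp add: sub_exp_insert sub_exp_add sub_exp_cmult)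
    qed
    from this[of c] this[of b] have "(sub_exp p (insert c (A - {b})) f - sub_exp p A f) / p
       = sub_exp p (A - {b}) (\<lambda>B. f (insert c B) - f B) - sub_exp p (A - {b}) (\<lambda>B. f (insert b B) - f B)"
      using p b c by (simp add: insert_absorb field_simps)
    moreover have "sub_exp p A (\<lambda>B. f (insert c B) - f B) \<le> sub_exp p (A - {b}) (\<lambda>B. f (insert c B) - f B)"
      using A c p by (intro swap_weight_le_level) auto
    ultimately show ?thesis using c by simp
  qed
  have "swap_weight l f A c - swap_weight l f A b = (\<Sum>j<l. level_weight l j *
     (sub_exp (density_at l j) (A - {c}) (\<lambda>B. f (insert c B) - f B)
      - sub_exp (density_at l j) (A - {b}) (\<lambda>B. f (insert b B) - f B)))"
    by (simp add: swap_weight_def mix_exp_def right_diff_distrib sum_subtractf)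
  also have "\<dots> \<le> (\<Sum>j<l. level_weight l j *
     ((sub_exp (density_at l j) (insert c (A - {b})) f - sub_exp (density_at l j) A f) / density_at l j))"
    using density_at_bounds level_weight_nonneg by (intro sum_mono mult_left_mono level) auto
  also have "\<dots> = potential l f (insert c (A - {b})) - potential l f A"
    by (simp add: potential_def diff_divide_distrib right_diff_distrib sum_subtractf)
  finally show ?thesis .
qed

text \<open>Limits the number of improving swaps. The factor 1/h comes from the smallest density
  h.\<close>

lemma potential_bounds:
  assumes A: "A \<subseteq> N" and l: "0 < l"
  shows "0 \<le> potential l f A" "potential l f A \<le> f A / step_size l"
proof -
  have finA: "finite A" using A finite_N finite_subset by auto
  have lev: "0 \<le> sub_exp p A f" "sub_exp p A f \<le> f A" if p: "0 \<le> p" "p \<le> 1" for p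
  proof -
    have "sub_exp p A (\<lambda>_. 0) \<le> sub_exp p A f"
      using p A f_nonneg by (intro sub_exp_mono) auto
    then show "0 \<le> sub_exp p A f" using finA by (simp add: sub_exp_const)
    have "sub_exp p A f \<le> sub_exp p A (\<lambda>_. f A)"
      using p A f_monoD by (intro sub_exp_mono) auto
    then show "sub_exp p A f \<le> f A" using finA by (simp add: sub_exp_const)
  qed
  show "0 \<le> potential l f A"
    unfolding potential_def using density_at_bounds level_weight_nonneg lev
    by (intro sum_nonneg mult_nonneg_nonneg divide_nonneg_nonneg) auto
  have "potential l f A \<le> (\<Sum>j<l. level_weight l j * (f A / step_size l))"
    unfolding potential_def
  proof (rule sum_mono)
    fix j assume "j \<in> {..<l}"
    then have j: "j < l" by simp
    have "sub_exp (density_at l j) A f / density_at l j \<le> f A / step_size l"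
      using density_at_bounds[OF j] lev[of "density_at l j"] step_size_pos[of l] by (intro frac_le) auto
    then have "level_weight l j * (sub_exp (density_at l j) A f / density_at l j)
        \<le> level_weight l j * (f A / step_size l)"
      by (intro mult_left_mono level_weight_nonneg)
    then show "level_weight l j / density_at l j * sub_exp (density_at l j) A f
        \<le> level_weight l j * (f A / step_size l)" by simp
  qed
  also have "\<dots> = f A / step_size l"
    by (simp only: sum_distrib_right[symmetric] sum_level_weight[OF l] mult_1)
  finally show "potential l f A \<le> f A / step_size l" .
qed

end

subsection \<open>Matroid exchange\<close>

lemma matroidD:
  assumes "matroid N \<I>"
  shows "finite N" "\<And>A. A \<in> \<I> \<Longrightarrow> A \<subseteq> N" "{} \<in> \<I>" "\<And>A B. B \<in> \<I> \<Longrightarrow> A \<subseteq> B \<Longrightarrow> A \<in> \<I>"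
    "\<And>A B. A \<in> \<I> \<Longrightarrow> B \<in> \<I> \<Longrightarrow> card A < card B \<Longrightarrow> \<exists>e\<in>B - A. insert e A \<in> \<I>"
    "\<And>A. A \<in> \<I> \<Longrightarrow> finite A" "finite \<I>"
proof -
  show N: "finite N" and sub: "\<And>A. A \<in> \<I> \<Longrightarrow> A \<subseteq> N" and "{} \<in> \<I>"
    and "\<And>A B. B \<in> \<I> \<Longrightarrow> A \<subseteq> B \<Longrightarrow> A \<in> \<I>"
    and "\<And>A B. A \<in> \<I> \<Longrightarrow> B \<in> \<I> \<Longrightarrow> card A < card B \<Longrightarrow> \<exists>e\<in>B - A. insert e A \<in> \<I>"
    using assms unfolding matroid_def by auto
  show "\<And>A. A \<in> \<I> \<Longrightarrow> finite A" using sub N finite_subset by blast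
  show "finite \<I>" using sub N by (intro finite_subset[of \<I> "Pow N"]) auto
qed

lemma matroid_card_le_rank: "matroid N \<I> \<Longrightarrow> A \<in> \<I> \<Longrightarrow> card A \<le> matroid_rank \<I>"
  unfolding matroid_rank_def using matroidD(7) by (intro Max_ge) auto

lemma matroid_augment:
  assumes M: "matroid N \<I>" and "A \<in> \<I>" "B \<in> \<I>" "card A \<le> card B"
  obtains A' where "A \<subseteq> A'" "A' \<subseteq> A \<union> B" "A' \<in> \<I>" "card A' = card B"
proof -
  have "\<exists>A'. A \<subseteq> A' \<and> A' \<subseteq> A \<union> B \<and> A' \<in> \<I> \<and> card A' = card B"
    using assms(2,4)
  proof (induction "card B - card A" arbitrary: A)
    case 0
    then show ?case by (intro exI[of _ A]) auto
  next
    case (Suc k)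
    then have "card A < card B" by linarith
    then obtain e where e: "e \<in> B - A" "insert e A \<in> \<I>"
      using matroidD(5)[OF M \<open>A \<in> \<I>\<close> \<open>B \<in> \<I>\<close>] by blast
    have c: "card (insert e A) = Suc (card A)" using e matroidD(6)[OF M \<open>A \<in> \<I>\<close>] by simp
    have "k = card B - card (insert e A)" "card (insert e A) \<le> card B"
      using c Suc.hyps(2) \<open>card A < card B\<close> by linarith+
    then obtain A' where "insert e A \<subseteq> A'" "A' \<subseteq> insert e A \<union> B" "A' \<in> \<I>" "card A' = card B"
      using Suc.hyps(1)[OF _ e(2)] by blast
    then show ?case using e by (intro exI[of _ A']) auto
  qed
  then show ?thesis using that by blast
qed

text \<open>A minimal K inside C with K + b dependent makes K + b the fundamental circuit of b over
  C, so every c in K may be traded for b. Some c in K - A must also complete A - b: otherwise A - b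
  would span K, and therefore b.\<close>

lemma matroid_symmetric_exchange:
  assumes M: "matroid N \<I>" and A: "A \<in> \<I>" "card A = matroid_rank \<I>"
    and C: "C \<in> \<I>" "card C = matroid_rank \<I>" and b: "b \<in> A - C"
  obtains c where "c \<in> C - A" "insert c (A - {b}) \<in> \<I>" "insert b (C - {c}) \<in> \<I>"
proof -
  note finA = matroidD(6)[OF M A(1)] and finC = matroidD(6)[OF M C(1)]
  define \<D> where "\<D> = {X. X \<subseteq> C \<and> insert b X \<notin> \<I>}"
  have "card (insert b C) = Suc (matroid_rank \<I>)" using b finC C by simp
  then have "insert b C \<notin> \<I>" using matroid_card_le_rank[OF M, of "insert b C"] by auto
  then have "C \<in> \<D>" by (simp add: \<D>_def)
  moreover have "finite \<D>" using finC by (auto simp: \<D>_def)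
  ultimately obtain K where K: "K \<in> \<D>" "\<And>X. X \<in> \<D> \<Longrightarrow> X \<subseteq> K \<Longrightarrow> X = K"
    using finite_has_minimal[of \<D>] by (metis empty_iff)
  have KC: "K \<subseteq> C" and Kb: "insert b K \<notin> \<I>" using K by (auto simp: \<D>_def)
  have exch: "insert b (C - {c}) \<in> \<I>" if c: "c \<in> K" for c
  proof -
    have "K - {c} \<notin> \<D>" using K(2)[of "K - {c}"] c by auto
    then have I: "insert b (K - {c}) \<in> \<I>" using KC by (auto simp: \<D>_def)
    obtain A' where A': "insert b (K - {c}) \<subseteq> A'" "A' \<subseteq> insert b (K - {c}) \<union> C" "A' \<in> \<I>" "card A' = card C"
      using matroid_augment[OF M I C(1)] matroid_card_le_rank[OF M I] C by metis
    have "c \<notin> A'" using A' matroidD(4)[OF M A'(3), of "insert b K"] Kb by auto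
    then have sub: "A' \<subseteq> insert b (C - {c})" using A' KC by auto
    have "card (insert b (C - {c})) = card C" using b c KC finC
      by (metis DiffD2 Diff_iff card_Suc_Diff1 card_insert_disjoint finite_Diff subsetD)
    then have "A' = insert b (C - {c})" using sub A'(4) finC by (intro card_subset_eq) auto
    then show ?thesis using A' by simp
  qed
  have "\<exists>c\<in>K - A. insert c (A - {b}) \<in> \<I>"
  proof (rule ccontr)
    assume no: "\<not> ?thesis"
    have Ab: "A - {b} \<in> \<I>" using matroidD(4)[OF M A(1)] by auto
    have cAb: "Suc (card (A - {b})) = card A" using b finA by (intro card_Suc_Diff1) auto
    \<comment> \<open>A - b is a largest independent subset of (A - b) with K. Extending K inside
      this union to the same size gives J, and augmenting J from A then either completes the circuit
      K + b or beats this maximum.\<close>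
    have maxi: "card J \<le> card (A - {b})" if "J \<in> \<I>" "J \<subseteq> (A - {b}) \<union> K" for J
    proof (rule ccontr)
      assume "\<not> ?thesis"
      then obtain e where "e \<in> J - (A - {b})" "insert e (A - {b}) \<in> \<I>"
        using matroidD(5)[OF M Ab \<open>J \<in> \<I>\<close>] by auto
      moreover then have "e \<in> K" "e \<noteq> b" using \<open>J \<subseteq> (A - {b}) \<union> K\<close> KC b by auto
      ultimately show False using no by auto
    qed
    have KI: "K \<in> \<I>" using KC matroidD(4)[OF M C(1)] by auto
    obtain J where J: "K \<subseteq> J" "J \<subseteq> K \<union> (A - {b})" "J \<in> \<I>" "card J = card (A - {b})"
      using matroid_augment[OF M KI Ab] maxi[OF KI] by auto
    then obtain e where e: "e \<in> A - J" "insert e J \<in> \<I>"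
      using matroidD(5)[OF M J(3) A(1)] cAb by auto
    show False
    proof (cases "e = b")
      case True
      then show False using e J(1) matroidD(4)[OF M e(2), of "insert b K"] Kb by auto
    next
      case False
      then have "card (insert e J) \<le> card (A - {b})" using e J by (intro maxi) auto
      then show False using e J matroidD(6)[OF M J(3)] by simp
    qed
  qed
  then show ?thesis using that exch KC by blast
qed

text \<open>Symmetric exchange replaces C by C - c + b, which is closer to A; the bijection for the
  new set is redirected at b to c. The clause that an image inside A is a fixed point both carries
  the induction and makes each pair an admissible swap.\<close>

lemma matroid_exchange_bijection:
  assumes M: "matroid N \<I>" and A: "A \<in> \<I>" "card A = matroid_rank \<I>"
    and C: "C \<in> \<I>" "card C = matroid_rank \<I>"
  shows "\<exists>\<pi>. bij_betw \<pi> A C \<and> (\<forall>b\<in>A. insert (\<pi> b) (A - {b}) \<in> \<I> \<and> (\<pi> b \<in> A \<longrightarrow> \<pi> b = b))"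
  using C
proof (induction "card (A - C)" arbitrary: C)
  case 0
  note finA = matroidD(6)[OF M A(1)] and finC = matroidD(6)[OF M 0(2)]
  have "A = C" using 0 finA finC A by (intro card_subset_eq) auto
  then show ?case using A by (intro exI[of _ id]) (auto simp: insert_absorb bij_betw_def)
next
  case (Suc k)
  note finA = matroidD(6)[OF M A(1)] and finC = matroidD(6)[OF M Suc.prems(1)]
  obtain b where b: "b \<in> A - C" using Suc.hyps(2) by (metis card.empty ex_in_conv nat.distinct(1))
  obtain c where c: "c \<in> C - A" "insert c (A - {b}) \<in> \<I>" "insert b (C - {c}) \<in> \<I>"
    using matroid_symmetric_exchange[OF M A Suc.prems b] by blast
  define C' where "C' = insert b (C - {c})"
  have cardC': "card C' = card C" using b c finC unfolding C'_def
    by (metis DiffD1 DiffD2 Diff_iff card_Suc_Diff1 card_insert_disjoint finite_Diff)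
  have "A - C' = (A - C) - {b}" using c by (auto simp: C'_def)
  then have "k = card (A - C')" using Suc.hyps(2) b finA by simp
  then obtain \<pi> where \<pi>: "bij_betw \<pi> A C'"
      "\<And>x. x \<in> A \<Longrightarrow> insert (\<pi> x) (A - {x}) \<in> \<I>" "\<And>x. x \<in> A \<Longrightarrow> \<pi> x \<in> A \<Longrightarrow> \<pi> x = x"
    using Suc.hyps(1)[of C'] c(3) cardC' Suc.prems unfolding C'_def by auto
  have "b \<in> C'" by (simp add: C'_def)
  \<comment> \<open>The fixed-point clause forces the preimage of b to be b, so only the value at b
    has to change.\<close>
  then obtain x where x: "x \<in> A" "\<pi> x = b" using \<pi>(1) by (auto simp: bij_betw_def)
  then have \<pi>b: "\<pi> b = b" using \<pi>(3)[of x] b by auto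
  have "bij_betw \<pi> (A - {b}) (C' - {b})"
    using \<pi>(1) \<pi>b b \<open>b \<in> C'\<close> by (intro bij_betw_DiffI) auto
  then have 1: "bij_betw (\<pi>(b := c)) (A - {b}) (C' - {b})"
    by (rule bij_betw_cong[THEN iffD1, rotated]) auto
  have "c \<notin> C' - {b}" using c b by (auto simp: C'_def)
  then have "bij_betw (\<pi>(b := c)) (insert b (A - {b})) (insert c (C' - {b}))"
    using notIn_Un_bij_betw[of b "A - {b}" "\<pi>(b := c)" "C' - {b}"] 1 by simp
  moreover have "insert b (A - {b}) = A" "insert c (C' - {b}) = C" using b c by (auto simp: C'_def)
  ultimately have "bij_betw (\<pi>(b := c)) A C" by simp
  then show ?case using \<pi> c by (intro exI[of _ "\<pi>(b := c)"]) auto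
qed

subsection \<open>Tail of the noise\<close>

lemma summation_by_parts:
  fixes u v :: "nat \<Rightarrow> real"
  shows "(\<Sum>i<l. u i * v i) = (\<Sum>i<l. u i) * v l + (\<Sum>i<l. (\<Sum>j<Suc i. u j) * (v i - v (Suc i)))"
  by (induction l) (simp_all add: algebra_simps)

lemma abel_bound:
  fixes u v :: "nat \<Rightarrow> real"
  assumes "antimono v" "\<And>i. 0 \<le> v i" "\<And>l. \<bar>\<Sum>i<l. u i\<bar> \<le> M"
  shows "\<bar>\<Sum>i<l. u i * v i\<bar> \<le> M * v 0"
proof -
  have "\<bar>\<Sum>i<l. u i * v i\<bar> \<le> \<bar>(\<Sum>i<l. u i) * v l\<bar> + (\<Sum>i<l. \<bar>(\<Sum>j<Suc i. u j) * (v i - v (Suc i))\<bar>)"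
    unfolding summation_by_parts[of u v l] by (intro order_trans[OF abs_triangle_ineq] add_left_mono sum_abs)
  also have "\<dots> \<le> M * v l + (\<Sum>i<l. M * (v i - v (Suc i)))"
  proof (intro add_mono sum_mono)
    show "\<bar>(\<Sum>i<l. u i) * v l\<bar> \<le> M * v l"
      using assms by (simp add: abs_mult mult_right_mono)
    fix i
    have "0 \<le> v i - v (Suc i)" using \<open>antimono v\<close> by (simp add: antimono_def)
    then show "\<bar>(\<Sum>j<Suc i. u j) * (v i - v (Suc i))\<bar> \<le> M * (v i - v (Suc i))"
      unfolding abs_mult using assms(3)[of "Suc i"] by (simp add: mult_right_mono del: sum.lessThan_Suc)
  qed
  also have "(\<Sum>i<l. M * (v i - v (Suc i))) = M * (v 0 - v l)"
    by (simp add: sum_distrib_left[symmetric] sum_lessThan_telescope')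
  finally show ?thesis by (simp add: algebra_simps)
qed

text \<open>Write x^\<gamma> = x1^\<gamma> * (x / x1)^\<gamma>. The second factor is nonincreasing
  in the index, and the partial sums of the series at x1 are bounded, so Abel summation applies; the
  series may converge only conditionally.\<close>

lemma power_series_tail_bound:
  fixes c \<gamma> :: "nat \<Rightarrow> real"
  assumes "antimono \<gamma>" and x1: "0 < x1"
    and summ: "\<And>x. x1 \<le> x \<Longrightarrow> summable (\<lambda>i. c i * x powr \<gamma> i)"
  obtains M where "0 < M" "\<And>x. x1 \<le> x \<Longrightarrow> \<bar>\<Sum>i. c (i + k) * x powr \<gamma> (i + k)\<bar> \<le> M * (x / x1) powr \<gamma> k"
proof -
  have "summable (\<lambda>i. c (i + k) * x1 powr \<gamma> (i + k))"
    using summ[of x1] by (intro summable_ignore_initial_segment[of "\<lambda>i. c i * x1 powr \<gamma> i"]) simp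
  then have "Bseq (\<lambda>l. \<Sum>i<l. c (i + k) * x1 powr \<gamma> (i + k))"
    using summable_LIMSEQ convergentI convergent_imp_Bseq by blast
  then obtain M where M: "0 < M" "\<And>l. \<bar>\<Sum>i<l. c (i + k) * x1 powr \<gamma> (i + k)\<bar> \<le> M"
    by (auto simp: Bseq_def)
  have "\<bar>\<Sum>i. c (i + k) * x powr \<gamma> (i + k)\<bar> \<le> M * (x / x1) powr \<gamma> k" if x: "x1 \<le> x" for x
  proof -
    define v where "v = (\<lambda>i. (x / x1) powr \<gamma> (i + k))"
    have v: "antimono v" "\<And>i. 0 \<le> v i"
      using assms(1) x x1 unfolding v_def antimono_def by (auto intro!: powr_mono)
    have eq: "c (i + k) * x powr \<gamma> (i + k) = (c (i + k) * x1 powr \<gamma> (i + k)) * v i" for i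
      using x x1 by (simp add: v_def powr_divide)
    have s: "summable (\<lambda>i. c (i + k) * x powr \<gamma> (i + k))"
      by (rule summable_ignore_initial_segment[OF summ[OF x]])
    have "\<bar>\<Sum>i<l. c (i + k) * x powr \<gamma> (i + k)\<bar> \<le> M * v 0" for l
      unfolding eq using M(2) v by (intro abel_bound)
    then have "\<bar>\<Sum>i. c (i + k) * x powr \<gamma> (i + k)\<bar> \<le> M * v 0"
      by (intro LIMSEQ_le_const2[OF tendsto_rabs[OF summable_LIMSEQ[OF s]]]) auto
    then show ?thesis by (simp add: v_def)
  qed
  then show ?thesis using that M by blast
qed

text \<open>
  The leading exponent with a nonzero total coefficient decides the growth. Several \<open>\<gamma> i\<close> may
  coincide, and their coefficients may cancel, so this need not be \<open>\<gamma> 0\<close>.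
\<close>

lemma power_series_dichotomy:
  fixes c \<gamma> :: "nat \<Rightarrow> real"
  assumes anti: "antimono \<gamma>" and x0: "0 \<le> x0"
    and summ: "\<And>x. x0 < x \<Longrightarrow> summable (\<lambda>i. c i * x powr \<gamma> i)"
  defines "s \<equiv> (\<lambda>x. \<Sum>i. c i * x powr \<gamma> i)"
  shows "(\<exists>K. eventually (\<lambda>x. s x \<le> K) at_top) \<or>
         (\<exists>C>0. \<exists>a>0. eventually (\<lambda>x. C * x powr a \<le> s x) at_top)"
proof -
  define x1 where "x1 = x0 + 1"
  have x1: "0 < x1" "1 \<le> x1" "\<And>x. x1 \<le> x \<Longrightarrow> x0 < x" using x0 by (auto simp: x1_def)
  have summ1: "\<And>x. x1 \<le> x \<Longrightarrow> summable (\<lambda>i. c i * x powr \<gamma> i)" using summ x1 by blast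
  \<comment> \<open>The accumulated coefficient up to index i. If it vanishes at each strict drop of
    the exponent before k, the earlier groups of equal exponents cancel and the partial sum is the
    single term of index k.\<close>
  define S where "S = (\<lambda>i. \<Sum>j<Suc i. c j)"
  have step: "\<gamma> (Suc i) \<le> \<gamma> i" for i using anti by (simp add: antimono_def)
  have partial: "(\<Sum>i<Suc k. c i * x powr \<gamma> i) = S k * x powr \<gamma> k"
    if "\<And>i. i < k \<Longrightarrow> \<gamma> (Suc i) < \<gamma> i \<Longrightarrow> S i = 0" for k x
  proof -
    have "S i * (x powr \<gamma> i - x powr \<gamma> (Suc i)) = 0" if "i < k" for i
      using that \<open>\<And>i. i < k \<Longrightarrow> \<gamma> (Suc i) < \<gamma> i \<Longrightarrow> S i = 0\<close>[of i] step[of i] by force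
    then have "(\<Sum>i<k. S i * (x powr \<gamma> i - x powr \<gamma> (Suc i))) = 0" by (intro sum.neutral) auto
    then have "(\<Sum>i<k. c i * x powr \<gamma> i) = (\<Sum>i<k. c i) * x powr \<gamma> k"
      unfolding summation_by_parts[of c] S_def by linarith
    then show ?thesis by (simp add: S_def algebra_simps)
  qed
  show ?thesis
  proof (cases "\<exists>i. \<gamma> (Suc i) < \<gamma> i \<and> S i \<noteq> 0")
    case True
    define k where "k = (LEAST i. \<gamma> (Suc i) < \<gamma> i \<and> S i \<noteq> 0)"
    have k: "\<gamma> (Suc k) < \<gamma> k" "S k \<noteq> 0" using LeastI_ex[OF True] by (auto simp: k_def)
    have kmin: "\<gamma> (Suc i) < \<gamma> i \<Longrightarrow> S i = 0" if "i < k" for i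
      using not_less_Least[of i "\<lambda>i. \<gamma> (Suc i) < \<gamma> i \<and> S i \<noteq> 0"] that by (auto simp: k_def)
    obtain M where M: "0 < M"
      "\<And>x. x1 \<le> x \<Longrightarrow> \<bar>\<Sum>i. c (i + Suc k) * x powr \<gamma> (i + Suc k)\<bar> \<le> M * (x / x1) powr \<gamma> (Suc k)"
      using power_series_tail_bound[OF anti x1(1) summ1] by blast
    define M' where "M' = M * x1 powr (- \<gamma> (Suc k))"
    have M': "0 < M'" using M x1 by (simp add: M'_def)
    have bnd: "\<bar>s x - S k * x powr \<gamma> k\<bar> \<le> M' * x powr \<gamma> (Suc k)" if x: "x1 \<le> x" for x
    proof -
      have "s x = (\<Sum>i. c (i + Suc k) * x powr \<gamma> (i + Suc k)) + S k * x powr \<gamma> k"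
        using suminf_split_initial_segment[OF summ1[OF x], of "Suc k"] partial[of k x] kmin
        unfolding s_def by (simp del: sum.lessThan_Suc)
      moreover have "M * (x / x1) powr \<gamma> (Suc k) = M' * x powr \<gamma> (Suc k)"
        using x x1 by (simp add: M'_def powr_divide powr_minus field_simps)
      ultimately show ?thesis using M(2)[OF x] by simp
    qed
    show ?thesis
    proof (cases "\<gamma> k \<le> 0")
      case True
      have "s x \<le> \<bar>S k\<bar> + M'" if x: "x1 \<le> x" for x
      proof -
        have "x powr \<gamma> k \<le> x powr 0" "x powr \<gamma> (Suc k) \<le> x powr 0"
          using x x1(2) True k(1) by (intro powr_mono; linarith)+
        then have "x powr \<gamma> k \<le> 1" "x powr \<gamma> (Suc k) \<le> 1" using x x1 by auto
        then have "\<bar>S k\<bar> * x powr \<gamma> k \<le> \<bar>S k\<bar>" "M' * x powr \<gamma> (Suc k) \<le> M'"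
          using M' by (auto intro!: mult_left_le)
        moreover have "S k * x powr \<gamma> k \<le> \<bar>S k\<bar> * x powr \<gamma> k" by (intro mult_right_mono) auto
        ultimately show ?thesis using bnd[OF x] by linarith
      qed
      then show ?thesis by (auto simp: eventually_at_top_linorder)
    next
      case False
      define g where "g = \<gamma> k" define g' where "g' = \<gamma> (Suc k)"
      define b where "b = \<bar>S k\<bar> / 2"
      have b: "0 < b" and gg: "g' < g" "0 < g" using k False by (auto simp: b_def g_def g'_def)
      have "eventually (\<lambda>x. M' * x powr g' \<le> b * x powr g) at_top"
        using M' b gg by real_asymp
      then have ev: "eventually (\<lambda>x. x1 \<le> x \<and> M' * x powr g' \<le> b * x powr g) at_top"
        using eventually_ge_at_top eventually_conj by blast
      show ?thesis
      proof (cases "0 < S k")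
        case True
        have "eventually (\<lambda>x. b * x powr g \<le> s x) at_top"
          using ev
        proof eventually_elim
          case (elim x)
          then have "\<bar>s x - S k * x powr g\<bar> \<le> b * x powr g" using bnd[of x] by (simp add: g_def g'_def)
          moreover have "S k * x powr g = b * x powr g + b * x powr g" using True by (simp add: b_def)
          ultimately show ?case by linarith
        qed
        then show ?thesis using b gg by blast
      next
        case False
        have "eventually (\<lambda>x. s x \<le> 0) at_top"
          using ev
        proof eventually_elim
          case (elim x)
          then have "\<bar>s x - S k * x powr g\<bar> \<le> b * x powr g" using bnd[of x] by (simp add: g_def g'_def)
          moreover have "S k * x powr g = - (b * x powr g + b * x powr g)" using False by (simp add: b_def)
          moreover have "0 \<le> b * x powr g" using b by simp
          ultimately show ?case by linarith
        qed
        then show ?thesis by blast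
      qed
    qed
  next
    case False
    then have zero: "\<And>i. \<gamma> (Suc i) < \<gamma> i \<Longrightarrow> S i = 0" by blast
    have lim: "(\<lambda>k. S k * x powr \<gamma> k) \<longlonglongrightarrow> s x" if "x1 \<le> x" for x
    proof -
      have "(\<lambda>k. \<Sum>i<Suc k. c i * x powr \<gamma> i) = (\<lambda>k. S k * x powr \<gamma> k)"
        using partial zero by blast
      then show ?thesis using summable_LIMSEQ[OF summ1[OF that], THEN LIMSEQ_Suc] by (simp add: s_def)
    qed
    show ?thesis
    \<comment> \<open>No group of equal exponents that ends has a nonzero total. With infinitely
      many drops the partial sums vanish infinitely often, which excludes a positive limit;
      otherwise the exponent is eventually a constant g and the series is exactly L * x^g.\<close>
    proof (cases "\<forall>k. \<exists>i\<ge>k. \<gamma> (Suc i) < \<gamma> i")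
      case True
      have "s x \<le> 0" if x: "x1 \<le> x" for x
      proof (rule ccontr)
        assume "\<not> s x \<le> 0"
        then have "eventually (\<lambda>k. 0 < S k * x powr \<gamma> k) sequentially"
          using order_tendstoD(1)[OF lim[OF x], of 0] by simp
        then obtain k where "\<And>i. k \<le> i \<Longrightarrow> 0 < S i * x powr \<gamma> i"
          by (auto simp: eventually_sequentially)
        moreover obtain i where "k \<le> i" "\<gamma> (Suc i) < \<gamma> i" using True by blast
        ultimately show False using zero[of i] by force
      qed
      then show ?thesis by (auto simp: eventually_at_top_linorder)
    next
      case False
      then obtain k where "\<And>i. k \<le> i \<Longrightarrow> \<not> \<gamma> (Suc i) < \<gamma> i" by blast
      then have cst: "\<gamma> (Suc i) = \<gamma> i" if "k \<le> i" for i using that step[of i] by force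
      define g where "g = \<gamma> k"
      have g: "\<gamma> i = g" if "k \<le> i" for i
        using that by (induction i rule: dec_induct) (auto simp: g_def cst)
      define L where "L = s x1 / x1 powr g"
      have lim': "(\<lambda>i. S (i + k) * x powr g) \<longlonglongrightarrow> s x" if "x1 \<le> x" for x
        using LIMSEQ_ignore_initial_segment[OF lim[OF that], of k] by (simp add: g)
      have "(\<lambda>i. S (i + k) * x1 powr g / x1 powr g) \<longlonglongrightarrow> L"
        unfolding L_def using x1 by (intro tendsto_divide lim') auto
      then have limS: "(\<lambda>i. S (i + k)) \<longlonglongrightarrow> L" using x1 by simp
      have sx: "s x = L * x powr g" if "x1 \<le> x" for x
        using LIMSEQ_unique[OF lim'[OF that] tendsto_mult[OF limS tendsto_const]] .
      consider "L \<le> 0" | "0 < L" "g \<le> 0" | "0 < L" "0 < g" by linarith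
      then show ?thesis
      proof cases
        case 1
        then have "s x \<le> 0" if "x1 \<le> x" for x using sx[OF that] by (simp add: mult_nonpos_nonneg)
        then show ?thesis by (auto simp: eventually_at_top_linorder)
      next
        case 2
        have "s x \<le> L" if x: "x1 \<le> x" for x
        proof -
          have "x powr g \<le> x powr 0" using 2 x x1 by (intro powr_mono) auto
          then show ?thesis using sx[OF x] 2 x x1 by (simp add: mult_left_le)
        qed
        then show ?thesis by (auto simp: eventually_at_top_linorder)
      next
        case 3
        then have "eventually (\<lambda>x. L * x powr g \<le> s x) at_top"
          using sx by (auto simp: eventually_at_top_linorder intro!: exI[of _ x1])
        then show ?thesis using 3 by blast
      qed
    qed
  qed
qed

text \<open>Points outside the support have null open neighbourhoods, and by Lindelof countably many
  of them cover the half-line.\<close>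

lemma measure_support_compl_null:
  assumes sets: "sets D = sets borel" and K: "measure_support D \<subseteq> {..K}"
  shows "emeasure D {K<..} = 0"
proof -
  define \<U> where "\<U> = {U. open U \<and> emeasure D U = 0}"
  obtain \<V> where \<V>: "\<V> \<subseteq> \<U>" "countable \<V>" "\<Union>\<V> = \<Union>\<U>"
    using Lindelof[of \<U>] by (auto simp: \<U>_def)
  have sub: "{K<..} \<subseteq> \<Union>\<U>"
  proof
    fix x assume "x \<in> {K<..}"
    then have "x \<notin> measure_support D" using K by auto
    then show "x \<in> \<Union>\<U>" by (auto simp: measure_support_def \<U>_def)
  qed
  have null: "(\<Union>V\<in>\<V>. V) \<in> null_sets D"
  proof (rule null_sets_UN'[OF \<V>(2)])
    fix V assume "V \<in> \<V>"
    then have "open V" "emeasure D V = 0" using \<V>(1) by (auto simp: \<U>_def)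
    then show "V \<in> null_sets D" by (intro null_setsI) (simp_all add: sets)
  qed
  show ?thesis
    by (rule emeasure_eq_0[OF null_setsD2[OF null] null_setsD1[OF null]]) (use sub \<V>(3) in simp)
qed

lemma has_real_derivative_inverse_power:
  assumes "0 < (y::real)"
  shows "((\<lambda>y. - (1 / y ^ Suc k)) has_real_derivative real (Suc k) / y ^ Suc (Suc k)) (at y)"
proof -
  have "(inverse has_real_derivative - (inverse y * inverse y)) (at y)"
    using assms by (auto intro!: derivative_eq_intros simp: power2_eq_square)
  from DERIV_minus[OF DERIV_power_Suc[OF this, of k]]
  show ?thesis using assms by (simp add: field_simps power_inverse)
qed

text \<open>A bounded exponent would contradict finite mass, so by the dichotomy it grows like a
  positive power and the density decays faster than any polynomial. The power 80 pays for a union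
  bound over all draws: with n = T^8 there are of order T^50 of them, and their total failure must
  stay below T^(-16).\<close>

lemma noise_tail_decay:
  assumes "noise_distribution D"
  shows "eventually (\<lambda>x. measure D {x<..} \<le> 1 / x ^ 80) at_top"
proof -
  interpret prob_space D using assms by (simp add: noise_distribution_def)
  have sets: "sets D = sets borel" using assms by (simp add: noise_distribution_def)
  have "generalized_exponential_tail D" using assms by (simp add: noise_distribution_def)
  then consider (series) x0 c \<gamma> where "0 \<le> x0" "antimono \<gamma>" "\<forall>x>x0. summable (\<lambda>i. c i * x powr \<gamma> i)"
      "has_density_on D (\<lambda>x. exp (- (\<Sum>i. c i * x powr \<gamma> i))) {x0<..}"
    | (bdd) "bounded (measure_support D)"
    unfolding generalized_exponential_tail_def by blast
  then show ?thesis
  proof cases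
    case series
    define s where "s = (\<lambda>x. \<Sum>i. c i * x powr \<gamma> i)"
    have dens: "emeasure D {x<..} = (\<integral>\<^sup>+y. ennreal (exp (- s y)) * indicator {x<..} y \<partial>lborel)"
      if "x0 \<le> x" for x
    proof -
      have "{x<..} \<in> sets borel" "{x<..} \<subseteq> {x0<..}" using that by auto
      then show ?thesis using series(4) unfolding has_density_on_def s_def by blast
    qed
    have "(\<exists>K. eventually (\<lambda>x. s x \<le> K) at_top) \<or>
         (\<exists>C>0. \<exists>a>0. eventually (\<lambda>x. C * x powr a \<le> s x) at_top)"
      unfolding s_def using series by (intro power_series_dichotomy) auto
    moreover have "\<not> eventually (\<lambda>x. s x \<le> K) at_top" for K
    proof
      assume "eventually (\<lambda>x. s x \<le> K) at_top"
      then obtain X where X: "\<And>x. X \<le> x \<Longrightarrow> s x \<le> K" by (auto simp: eventually_at_top_linorder)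
      define y where "y = max X x0"
      \<comment> \<open>A density of at least exp (- K) on an interval longer than exp K would have
        mass above 1.\<close>
      obtain n :: nat where n: "exp K < real n" using reals_Archimedean2 by blast
      have "(\<integral>\<^sup>+x. ennreal (exp (- K)) * indicator {y<..y + real n} x \<partial>lborel)
          \<le> (\<integral>\<^sup>+x. ennreal (exp (- s x)) * indicator {y<..} x \<partial>lborel)"
        using X by (intro nn_integral_mono) (auto simp: indicator_def y_def intro!: ennreal_leI)
      also have "\<dots> = emeasure D {y<..}" by (rule dens[symmetric]) (simp add: y_def)
      also have "\<dots> \<le> 1" by (rule emeasure_le_1)
      finally have "ennreal (exp (- K) * real n) \<le> ennreal 1"
        by (simp add: nn_integral_cmult_indicator ennreal_mult)
      then have "exp (- K) * real n \<le> 1" by (subst (asm) ennreal_le_iff) auto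
      then show False using n by (simp add: exp_minus field_simps)
    qed
    ultimately obtain C a where C: "0 < C" "0 < a" "eventually (\<lambda>x. C * x powr a \<le> s x) at_top" by blast
    have "eventually (\<lambda>x::real. exp (- (C * x powr a)) \<le> 80 / x ^ 81) at_top"
      using C(1,2) by real_asymp
    with C(3) have "eventually (\<lambda>x. exp (- s x) \<le> 80 / x ^ 81) at_top"
      by eventually_elim (metis exp_le_cancel_iff neg_le_iff_le order_trans)
    then obtain X where X: "\<And>x. X \<le> x \<Longrightarrow> exp (- s x) \<le> 80 / x ^ 81"
      by (auto simp: eventually_at_top_linorder)
    have "measure D {x<..} \<le> 1 / x ^ 80" if x: "max 1 (max X x0) \<le> x" for x
    proof -
      have "emeasure D {x<..} \<le> (\<integral>\<^sup>+y. ennreal (80 / y ^ 81) * indicator {x..} y \<partial>lborel)"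
      proof -
        have "x0 \<le> x" "X \<le> x" using x by auto
        then show ?thesis unfolding dens[OF \<open>x0 \<le> x\<close>]
        using X by (intro nn_integral_mono) (auto simp: indicator_def intro!: ennreal_leI)
      qed
      also have "\<dots> = ennreal (0 - (- (1 / x ^ 80)))"
      proof (rule nn_integral_FTC_atLeast)
        fix y assume "x \<le> y"
        then have "0 < y" using x by simp
        then show "((\<lambda>y. - (1 / y ^ 80)) has_real_derivative 80 / y ^ 81) (at y)"
          using has_real_derivative_inverse_power[of y 79] by simp
        show "0 \<le> 80 / y ^ 81" using \<open>0 < y\<close> by simp
      next
        show "((\<lambda>y::real. - (1 / y ^ 80)) \<longlongrightarrow> 0) at_top" by real_asymp
      qed simp
      finally show ?thesis using x by (simp add: emeasure_eq_measure)
    qed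
    then show ?thesis by (rule eventually_at_top_linorderI)
  next
    case bdd
    then obtain K where K: "\<And>x. x \<in> measure_support D \<Longrightarrow> \<bar>x\<bar> \<le> K" by (auto simp: bounded_iff)
    have "measure_support D \<subseteq> {..K}" using K by force
    then have null: "emeasure D {K<..} = 0" by (rule measure_support_compl_null[OF sets])
    have "measure D {x<..} \<le> 1 / x ^ 80" if "max K 1 \<le> x" for x
    proof -
      have "emeasure D {x<..} \<le> emeasure D {K<..}"
        using that sets by (intro emeasure_mono) auto
      then have "measure D {x<..} = 0" using null by (simp add: measure_def)
      then show ?thesis using that by simp
    qed
    then show ?thesis by (rule eventually_at_top_linorderI)
  qed
qed

definition clip :: "real \<Rightarrow> real \<Rightarrow> real" where
  "clip T x = min (max 0 x) T"

lemma clip_bounds: "0 \<le> T \<Longrightarrow> 0 \<le> clip T x" "clip T x \<le> T" "0 \<le> T \<Longrightarrow> \<bar>clip T x\<bar> \<le> T"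
  by (auto simp: clip_def)

lemma clip_measurable [measurable]: "clip T \<in> borel_measurable borel"
  unfolding clip_def by measurable

text \<open>The clipped mean converges to the mean of max 0 x, which is at least 1. These two bounds
  are the only information about the unknown factor on all estimated gains.\<close>

lemma clip_mean_bounds:
  assumes "noise_distribution D"
  shows "eventually (\<lambda>T. 1 / 2 \<le> (\<integral>x. clip T x \<partial>D)) at_top"
    and "0 \<le> T \<Longrightarrow> (\<integral>x. clip T x \<partial>D) \<le> (\<integral>x. \<bar>x\<bar> \<partial>D)"
proof -
  interpret prob_space D using assms by (simp add: noise_distribution_def)
  have sets [measurable_cong]: "sets D = sets borel" and int: "integrable D (\<lambda>x. x)" and one: "(\<integral>x. x \<partial>D) = 1"
    using assms by (auto simp: noise_distribution_def)
  have int': "integrable D (\<lambda>x. max 0 x)"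
    using integrable_max[of D "\<lambda>_. 0" "\<lambda>x. x"] int by simp
  have "((\<lambda>T. \<integral>x. clip T x \<partial>D) \<longlongrightarrow> (\<integral>x. max 0 x \<partial>D)) at_top"
  proof (rule integral_dominated_convergence_at_top[where w = "\<lambda>x. \<bar>x\<bar>"])
    show "AE x in D. ((\<lambda>T. clip T x) \<longlongrightarrow> max 0 x) at_top"
    proof (rule AE_I2)
      fix x :: real
      have "eventually (\<lambda>T. clip T x = max 0 x) at_top"
        using eventually_ge_at_top[of "max 0 x"] by eventually_elim (simp add: clip_def)
      then show "((\<lambda>T. clip T x) \<longlongrightarrow> max 0 x) at_top" by (rule tendsto_eventually)
    qed
    show "eventually (\<lambda>T. AE x in D. norm (clip T x) \<le> \<bar>x\<bar>) at_top"
      using eventually_ge_at_top[of 0] by eventually_elim (auto simp: clip_def)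
    show "integrable D (\<lambda>x. \<bar>x\<bar>)" using int by (rule integrable_abs)
  qed measurable
  moreover have "1 \<le> (\<integral>x. max 0 x \<partial>D)"
    using integral_mono[OF int int'] one by simp
  ultimately show "eventually (\<lambda>T. 1 / 2 \<le> (\<integral>x. clip T x \<partial>D)) at_top"
    by (auto dest!: order_tendstoD(1)[of _ _ at_top "1/2"] elim!: eventually_mono)
  assume "0 \<le> T"
  have "integrable D (clip T)"
    using clip_bounds(3)[OF \<open>0 \<le> T\<close>] by (intro integrable_const_bound[of _ T] AE_I2) (simp, measurable)
  then show "(\<integral>x. clip T x \<partial>D) \<le> (\<integral>x. \<bar>x\<bar> \<partial>D)"
    using integrable_abs[OF int] by (rule integral_mono) (use \<open>0 \<le> T\<close> in \<open>simp add: clip_def\<close>)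
qed

subsection \<open>The sampling distribution\<close>

definition mix_weight :: "nat \<Rightarrow> 'a set \<Rightarrow> 'a set \<Rightarrow> real" where
  "mix_weight l X B =
     (\<Sum>j<l. level_weight l j * (density_at l j ^ card B * (1 - density_at l j) ^ card (X - B)))"

definition sample_pmf :: "nat \<Rightarrow> 'a set \<Rightarrow> 'a set pmf" where
  "sample_pmf l X = embed_pmf (\<lambda>B. if B \<subseteq> X then mix_weight l X B else 0)"

lemma mix_exp_eq_sum: "mix_exp l X g = (\<Sum>B\<in>Pow X. mix_weight l X B * g B)"
  unfolding mix_exp_def sub_exp_def mix_weight_def sum_distrib_right sum_distrib_left
  by (subst sum.swap) (simp add: mult_ac)

lemma mix_weight_nonneg: "0 \<le> mix_weight l X B"
  unfolding mix_weight_def using density_at_bounds level_weight_nonneg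
  by (intro sum_nonneg mult_nonneg_nonneg) auto

text \<open>At every level each element of X contributes a factor p or 1 - p, and both are at most 1
  - h.\<close>

lemma mix_weight_le:
  assumes "finite X" "B \<subseteq> X" "0 < l"
  shows "mix_weight l X B \<le> (1 - step_size l) ^ card X"
proof -
  have "mix_weight l X B \<le> (\<Sum>j<l. level_weight l j * (1 - step_size l) ^ card X)"
    unfolding mix_weight_def
  proof (intro sum_mono mult_left_mono level_weight_nonneg)
    fix j assume "j \<in> {..<l}"
    then have j: "j < l" by simp
    note d = density_at_bounds[OF j]
    have "density_at l j ^ card B * (1 - density_at l j) ^ card (X - B)
        \<le> (1 - step_size l) ^ card B * (1 - step_size l) ^ card (X - B)"
      using d step_size_pos[of l] by (intro mult_mono power_mono) auto
    also have "\<dots> = (1 - step_size l) ^ card X"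
      using assms finite_subset[of B X]
      by (simp add: card_Diff_subset card_mono flip: power_add)
    finally show "density_at l j ^ card B * (1 - density_at l j) ^ card (X - B) \<le> (1 - step_size l) ^ card X" .
  qed
  also have "\<dots> = (1 - step_size l) ^ card X"
    by (simp only: sum_distrib_right[symmetric] sum_level_weight[OF \<open>0 < l\<close>] mult_1)
  finally show ?thesis .
qed

lemma sum_mix_weight: "finite X \<Longrightarrow> 0 < l \<Longrightarrow> (\<Sum>B\<in>Pow X. mix_weight l X B) = 1"
  using mix_exp_const[of X l 1] by (simp add: mix_exp_eq_sum)

text \<open>The weights sum to 1, so their squares sum to at most the largest weight. This is the
  variance proxy in Hoeffding's inequality.\<close>

lemma sum_mix_weight_square_le:
  assumes "finite X" "0 < l"
  shows "(\<Sum>B\<in>Pow X. (mix_weight l X B)\<^sup>2) \<le> (1 - step_size l) ^ card X"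
proof -
  have "(\<Sum>B\<in>Pow X. (mix_weight l X B)\<^sup>2) \<le> (\<Sum>B\<in>Pow X. mix_weight l X B * (1 - step_size l) ^ card X)"
    unfolding power2_eq_square using assms
    by (intro sum_mono mult_left_mono mix_weight_le mix_weight_nonneg) auto
  then show ?thesis using assms by (simp add: sum_mix_weight flip: sum_distrib_right)
qed

lemma pmf_sample_pmf:
  assumes "finite X" "0 < l"
  shows "pmf (sample_pmf l X) B = (if B \<subseteq> X then mix_weight l X B else 0)"
proof -
  have "(\<integral>\<^sup>+B. ennreal (if B \<subseteq> X then mix_weight l X B else 0) \<partial>count_space UNIV)
      = (\<Sum>B\<in>Pow X. ennreal (if B \<subseteq> X then mix_weight l X B else 0))"
    using assms by (intro nn_integral_count_space') (auto split: if_splits)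
  also have "\<dots> = (\<Sum>B\<in>Pow X. ennreal (mix_weight l X B))" by (intro sum.cong) auto
  also have "\<dots> = 1" using assms by (simp add: sum_ennreal mix_weight_nonneg sum_mix_weight)
  finally show ?thesis
    unfolding sample_pmf_def by (intro pmf_embed_pmf) (auto simp: mix_weight_nonneg)
qed

lemma set_sample_pmf: "finite X \<Longrightarrow> 0 < l \<Longrightarrow> set_pmf (sample_pmf l X) \<subseteq> Pow X"
  by (auto simp: set_pmf_eq pmf_sample_pmf split: if_splits)

lemma expectation_sample_pmf:
  fixes g :: "'a set \<Rightarrow> real"
  assumes "finite X" "0 < l"
  shows "measure_pmf.expectation (sample_pmf l X) g = mix_exp l X g"
proof -
  have "measure_pmf.expectation (sample_pmf l X) g = (\<Sum>B\<in>Pow X. g B * pmf (sample_pmf l X) B)"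
    using assms set_sample_pmf[OF assms] by (intro integral_measure_pmf_real) auto
  then show ?thesis using assms by (simp add: mix_exp_eq_sum pmf_sample_pmf mult.commute)
qed

subsection \<open>Concentration of weighted noise\<close>

lemma indep_vars_PiM_coordinates:
  assumes D: "\<And>i. i \<in> I \<Longrightarrow> prob_space (D i)"
  shows "prob_space.indep_vars (PiM I D) D (\<lambda>i \<xi>. \<xi> i) I"
proof (cases "I = {}")
  case True
  interpret prob_space "PiM I D" using D by (intro prob_space_PiM)
  show ?thesis unfolding indep_vars_def indep_sets_def using True by simp
next
  case False
  interpret P: prob_space "PiM I D" using D by (intro prob_space_PiM)
  have "distr (PiM I D) (PiM I D) (\<lambda>\<xi>. \<lambda>i\<in>I. \<xi> i) = distr (PiM I D) (PiM I D) (\<lambda>\<xi>. \<xi>)"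
    by (intro distr_cong) (auto simp: space_PiM PiE_restrict)
  also have "\<dots> = PiM I D" by (rule distr_id)
  also have "\<dots> = PiM I (\<lambda>i. distr (PiM I D) (D i) (\<lambda>\<xi>. \<xi> i))"
    using D by (intro PiM_cong) (auto simp: distr_PiM_component)
  finally show ?thesis
    using False by (subst P.indep_vars_iff_distr_eq_PiM') auto
qed

lemma weighted_noise_concentration_aux:
  fixes w :: "'a set \<Rightarrow> real" and \<psi> :: "real \<Rightarrow> real"
  assumes D: "prob_space D" "sets D = sets borel" and fin: "finite J"
    and cN: "J \<subseteq> Pow N"
    and \<psi>: "\<psi> \<in> borel_measurable borel" "\<And>x. 0 \<le> \<psi> x" "\<And>x. \<psi> x \<le> K"
    and w: "\<And>i. i \<in> J \<Longrightarrow> 0 \<le> w i" and V: "(\<Sum>i\<in>J. (K * w i)\<^sup>2) \<le> V" "0 < V" and t: "0 < t"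
  shows "measure (noise_space N D)
      {\<xi> \<in> space (noise_space N D). t \<le> \<bar>(\<Sum>i\<in>J. w i * \<psi> (\<xi> i)) - (\<integral>x. \<psi> x \<partial>D) * (\<Sum>i\<in>J. w i)\<bar>}
    \<le> 2 * exp (- 2 * t\<^sup>2 / V)"
proof -
  interpret D: prob_space D by fact
  let ?P = "noise_space N D"
  interpret P: prob_space ?P unfolding noise_space_def using D by (intro prob_space_PiM)
  note [measurable_cong] = D(2)
  have [measurable]: "\<psi> \<in> borel_measurable D" using \<psi>(1) by measurable
  have K: "0 \<le> K" using \<psi>(2,3) order_trans by blast
  have int\<psi>: "integrable D \<psi>"
    using \<psi> by (intro D.integrable_const_bound[of _ K]) auto
  have comp: "distr ?P D (\<lambda>\<xi>. \<xi> i) = D" if "i \<in> J" for i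
    unfolding noise_space_def using D cN that by (subst distr_PiM_component) auto
  have meas: "(\<lambda>\<xi>. \<xi> i) \<in> measurable ?P D" if "i \<in> J" for i
    unfolding noise_space_def using cN that by (intro measurable_component_singleton) auto
  have ex: "P.expectation (\<lambda>\<xi>. w i * \<psi> (\<xi> i)) = w i * (\<integral>x. \<psi> x \<partial>D)" if "i \<in> J" for i
  proof -
    have "(\<integral>x. \<psi> x \<partial>D) = P.expectation (\<lambda>\<xi>. \<psi> (\<xi> i))"
      by (subst comp[OF that, symmetric]) (rule integral_distr[OF meas[OF that]], measurable)
    then show ?thesis by simp
  qed
  have ind: "P.indep_vars (\<lambda>_. borel) (\<lambda>i \<xi>. w i * \<psi> (\<xi> i)) J"
  proof -
    have "P.indep_vars (\<lambda>_. D) (\<lambda>i \<xi>. \<xi> i) J"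
      using P.indep_vars_subset[OF indep_vars_PiM_coordinates[of "Pow N" "\<lambda>_. D", folded noise_space_def] cN] D
      by simp
    then show ?thesis by (rule P.indep_vars_compose2) measurable
  qed
  interpret H: Hoeffding_ineq ?P J "\<lambda>i \<xi>. w i * \<psi> (\<xi> i)" "\<lambda>_. 0" "\<lambda>i. K * w i"
      "\<Sum>i\<in>J. P.expectation (\<lambda>\<xi>. w i * \<psi> (\<xi> i))"
  proof unfold_locales
    fix i assume "i \<in> J"
    then show "AE \<xi> in ?P. w i * \<psi> (\<xi> i) \<in> {0..K * w i}"
      using \<psi> w by (intro AE_I2) (auto intro!: mult_nonneg_nonneg simp: mult.commute[of K] mult_left_mono)
  qed (use fin ind in auto)
  have mu: "(\<Sum>i\<in>J. P.expectation (\<lambda>\<xi>. w i * \<psi> (\<xi> i))) = (\<integral>x. \<psi> x \<partial>D) * (\<Sum>i\<in>J. w i)"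
    unfolding sum_distrib_left by (intro sum.cong refl) (simp only: ex mult.commute)
  show ?thesis
  \<comment> \<open>Hoeffding's inequality is applied only to a positive sum of squared ranges. If
    the sum is zero, all terms and means vanish and the event is empty.\<close>
  proof (cases "(\<Sum>i\<in>J. (K * w i)\<^sup>2) = 0")
    case False
    then have pos: "0 < (\<Sum>i\<in>J. (K * w i)\<^sup>2)" using sum_nonneg[of J "\<lambda>i. (K * w i)\<^sup>2"] by force
    have "measure ?P {\<xi> \<in> space ?P. t \<le> \<bar>(\<Sum>i\<in>J. w i * \<psi> (\<xi> i)) - (\<integral>x. \<psi> x \<partial>D) * (\<Sum>i\<in>J. w i)\<bar>}
      \<le> 2 * exp (- 2 * t\<^sup>2 / (\<Sum>i\<in>J. (K * w i)\<^sup>2))"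
      using H.Hoeffding_ineq_abs_ge[of t] t pos unfolding mu by simp
    also have "\<dots> \<le> 2 * exp (- 2 * t\<^sup>2 / V)"
      using pos V by (simp add: divide_left_mono)
    finally show ?thesis .
  next
    case True
    then have z: "K * w i = 0" if "i \<in> J" for i
      using that fin by (subst (asm) sum_nonneg_eq_0_iff) auto
    have "w i * \<psi> x = 0" if "i \<in> J" for i x
      using z[OF that] \<psi>(2)[of x] \<psi>(3)[of x] by auto
    moreover have "(\<integral>x. \<psi> x \<partial>D) * w i = 0" if "i \<in> J" for i
    proof (cases "w i = 0")
      case False
      then have "\<psi> = (\<lambda>_. 0)" using z[OF that] \<psi>(2,3) by (metis antisym ext mult_eq_0_iff)
      then show ?thesis by simp
    qed simp
    ultimately have "(\<Sum>i\<in>J. w i * \<psi> (\<xi> i)) = 0" "(\<Sum>i\<in>J. (\<integral>x. \<psi> x \<partial>D) * w i) = 0" for \<xi>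
      by (auto intro!: sum.neutral)
    then have "{\<xi> \<in> space ?P. t \<le> \<bar>(\<Sum>i\<in>J. w i * \<psi> (\<xi> i)) - (\<integral>x. \<psi> x \<partial>D) * (\<Sum>i\<in>J. w i)\<bar>} = {}"
      using t by (simp add: sum_distrib_left)
    then show ?thesis by (simp only: measure_empty) simp
  qed
qed

text \<open>Weights are attached to samples B, but the noise is read at \<open>c B\<close>.
  Injectivity ensures that different samples read different, hence independent, noise
  variables.\<close>

lemma weighted_noise_concentration:
  fixes w :: "'b \<Rightarrow> real" and \<psi> :: "real \<Rightarrow> real"
  assumes D: "prob_space D" "sets D = sets borel" and fin: "finite J"
    and inj: "inj_on c J" and cN: "c ` J \<subseteq> Pow N"
    and \<psi>: "\<psi> \<in> borel_measurable borel" "\<And>x. 0 \<le> \<psi> x" "\<And>x. \<psi> x \<le> K"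
    and w: "\<And>i. i \<in> J \<Longrightarrow> 0 \<le> w i" and V: "(\<Sum>i\<in>J. (K * w i)\<^sup>2) \<le> V" "0 < V" and t: "0 < t"
  shows "measure (noise_space N D)
      {\<xi> \<in> space (noise_space N D). t \<le> \<bar>(\<Sum>i\<in>J. w i * \<psi> (\<xi> (c i))) - (\<integral>x. \<psi> x \<partial>D) * (\<Sum>i\<in>J. w i)\<bar>}
    \<le> 2 * exp (- 2 * t\<^sup>2 / V)"
proof -
  define w' where "w' = (\<lambda>S. w (the_inv_into J c S))"
  have w': "w' (c i) = w i" if "i \<in> J" for i
    using that inj by (simp add: w'_def the_inv_into_f_f)
  have sums: "(\<Sum>S\<in>c ` J. g S (w' S)) = (\<Sum>i\<in>J. g (c i) (w i))" for g :: "'a set \<Rightarrow> real \<Rightarrow> real"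
    using w' by (simp add: sum.reindex[OF inj])
  have "(\<Sum>S\<in>c ` J. (K * w' S)\<^sup>2) \<le> V" using V sums[of "\<lambda>_ y. (K * y)\<^sup>2"] by simp
  moreover have "\<And>S. S \<in> c ` J \<Longrightarrow> 0 \<le> w' S" using w w' by auto
  ultimately have "measure (noise_space N D)
      {\<xi> \<in> space (noise_space N D). t \<le> \<bar>(\<Sum>S\<in>c ` J. w' S * \<psi> (\<xi> S)) - (\<integral>x. \<psi> x \<partial>D) * (\<Sum>S\<in>c ` J. w' S)\<bar>}
    \<le> 2 * exp (- 2 * t\<^sup>2 / V)"
    using assms by (intro weighted_noise_concentration_aux[where K = K]) auto
  moreover have "(\<Sum>S\<in>c ` J. w' S * \<psi> (\<xi> S)) = (\<Sum>i\<in>J. w i * \<psi> (\<xi> (c i)))" for \<xi>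
    by (rule sums[of "\<lambda>S y. y * \<psi> (\<xi> S)"])
  moreover have "(\<Sum>S\<in>c ` J. w' S) = (\<Sum>i\<in>J. w i)" by (rule sums[of "\<lambda>S y. y"])
  ultimately show ?thesis by simp
qed

text \<open>T is the clipping level, M a positive scale for values of f, l the number of levels, and
  k a lower bound on the size of the sampling pools. T, M and k belong to the analysis; the search
  never sees them.\<close>

locale noisy_instance = monotone_submodular N f
  for N :: "'a set" and f :: "'a set \<Rightarrow> real" +
  fixes D :: "real measure" and T M :: real and l k :: nat
  assumes noise: "noise_distribution D" and T: "0 < T" and M: "0 < M" and l: "0 < l"
begin

definition noise_mean :: real where
  "noise_mean = (\<integral>x. clip T x \<partial>D)"

text \<open>Pools have the form X = A - e for a base A. The factor 2 accounts for adding e: f (A +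
  e) is at most f A + f {e}.\<close>

definition sample_site :: "'a set \<Rightarrow> 'a \<Rightarrow> bool" where
  "sample_site X e \<longleftrightarrow> X \<subseteq> N \<and> e \<in> N - X \<and> k \<le> card X \<and> f (insert e X) \<le> 2 * M"

text \<open>A property of the noise alone, with the sampling randomness already averaged out. Hence
  it can be fixed for all sites before the search starts. The second part limits how often a draw
  meets noise that clipping would alter.\<close>

definition typical_at :: "real \<Rightarrow> real \<Rightarrow> 'a set \<Rightarrow> ('a set \<Rightarrow> 'a set) \<Rightarrow> ('a set \<Rightarrow> real) \<Rightarrow> bool" where
  "typical_at \<delta> \<theta> X c \<xi> \<longleftrightarrow>
     \<bar>mix_exp l X (\<lambda>B. clip T (\<xi> (c B)) * f (c B)) - noise_mean * mix_exp l X (\<lambda>B. f (c B))\<bar> < \<delta> \<and>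
     mix_exp l X (\<lambda>B. indicator {T<..} (\<xi> (c B))) < measure D {T<..} + \<theta>"

definition typical_noise :: "real \<Rightarrow> real \<Rightarrow> ('a set \<Rightarrow> real) \<Rightarrow> bool" where
  "typical_noise \<delta> \<theta> \<xi> \<longleftrightarrow>
     (\<forall>X e. sample_site X e \<longrightarrow> typical_at \<delta> \<theta> X (insert e) \<xi> \<and> typical_at \<delta> \<theta> X (\<lambda>B. B) \<xi>)"

lemma noise_facts: "prob_space D" "sets D = sets borel"
  using noise by (auto simp: noise_distribution_def)

lemma prob_space_noise: "prob_space (noise_space N D)"
  unfolding noise_space_def using noise_facts by (intro prob_space_PiM)

lemma noise_coordinate_measurable:
  assumes "S \<subseteq> N" shows "(\<lambda>\<xi>. \<xi> S) \<in> borel_measurable (noise_space N D)"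
proof -
  have "(\<lambda>\<xi>. \<xi> S) \<in> measurable (noise_space N D) D"
    unfolding noise_space_def using assms by (intro measurable_component_singleton) auto
  then show ?thesis using measurable_cong_sets[OF refl noise_facts(2)] by blast
qed

lemma typical_at_sets:
  assumes "X \<subseteq> N" "\<And>B. B \<subseteq> X \<Longrightarrow> c B \<subseteq> N"
  shows "{\<xi> \<in> space (noise_space N D). typical_at \<delta> \<theta> X c \<xi>} \<in> sets (noise_space N D)"
proof -
  have "(\<lambda>\<xi>. mix_exp l X (\<lambda>B. clip T (\<xi> (c B)) * f (c B))) \<in> borel_measurable (noise_space N D)"
    unfolding mix_exp_eq_sum using assms
    by (intro borel_measurable_sum borel_measurable_times borel_measurable_const
        measurable_compose[OF noise_coordinate_measurable clip_measurable]) auto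
  moreover have "(\<lambda>\<xi>. mix_exp l X (\<lambda>B. indicator {T<..} (\<xi> (c B)))) \<in> borel_measurable (noise_space N D)"
    unfolding mix_exp_eq_sum using assms
    by (intro borel_measurable_sum borel_measurable_times borel_measurable_const
        measurable_compose[OF noise_coordinate_measurable borel_measurable_indicator]) auto
  ultimately show ?thesis unfolding typical_at_def by measurable
qed

text \<open>Two applications of Hoeffding's inequality. Clipped noise has range T and f is at most 2
  M, giving the proxy 4 T^2 M^2 (1 - h)^k with h the step size; the indicator of large noise has
  range 1 and proxy (1 - h)^k.\<close>

lemma prob_not_typical_at:
  assumes X: "X \<subseteq> N" "k \<le> card X" and c: "\<And>B. B \<subseteq> X \<Longrightarrow> c B \<subseteq> N" "inj_on c (Pow X)"
    and fc: "\<And>B. B \<subseteq> X \<Longrightarrow> f (c B) \<le> 2 * M" and "0 < \<delta>" "0 < \<theta>"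
  shows "measure (noise_space N D) {\<xi> \<in> space (noise_space N D). \<not> typical_at \<delta> \<theta> X c \<xi>}
    \<le> 2 * exp (- \<delta>\<^sup>2 / (2 * T\<^sup>2 * M\<^sup>2 * (1 - step_size l) ^ k)) + 2 * exp (- 2 * \<theta>\<^sup>2 / (1 - step_size l) ^ k)"
proof -
  let ?P = "noise_space N D"
  interpret P: prob_space ?P by (rule prob_space_noise)
  interpret D: prob_space D by (rule noise_facts)
  have finX: "finite X" using X finite_N finite_subset by auto
  define \<sigma> where "\<sigma> = (1 - step_size l) ^ k"
  have h: "0 < step_size l" "step_size l < 1"
    using l by (auto simp: step_size_def)
  have \<sigma>: "0 < \<sigma>" using h by (simp add: \<sigma>_def)
  have sq: "(\<Sum>B\<in>Pow X. (mix_weight l X B)\<^sup>2) \<le> \<sigma>"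
  proof -
    have "(1 - step_size l) ^ card X \<le> \<sigma>" unfolding \<sigma>_def using h X by (intro power_decreasing) auto
    then show ?thesis using sum_mix_weight_square_le[OF finX l] by linarith
  qed
  define E1 where "E1 = {\<xi> \<in> space ?P. \<delta> \<le> \<bar>(\<Sum>B\<in>Pow X. mix_weight l X B * f (c B) * clip T (\<xi> (c B)))
      - (\<integral>x. clip T x \<partial>D) * (\<Sum>B\<in>Pow X. mix_weight l X B * f (c B))\<bar>}"
  define E2 where "E2 = {\<xi> \<in> space ?P. \<theta> \<le> \<bar>(\<Sum>B\<in>Pow X. mix_weight l X B * indicator {T<..} (\<xi> (c B)))
      - (\<integral>x. indicator {T<..} x \<partial>D) * (\<Sum>B\<in>Pow X. mix_weight l X B)\<bar>}"
  have 1: "measure ?P E1 \<le> 2 * exp (- 2 * \<delta>\<^sup>2 / (4 * T\<^sup>2 * M\<^sup>2 * \<sigma>))"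
    unfolding E1_def
  proof (rule weighted_noise_concentration[where K = T])
    have "(\<Sum>B\<in>Pow X. (T * (mix_weight l X B * f (c B)))\<^sup>2) \<le> (\<Sum>B\<in>Pow X. (T * 2 * M)\<^sup>2 * (mix_weight l X B)\<^sup>2)"
    proof (rule sum_mono)
      fix B assume B: "B \<in> Pow X"
      have "T * (mix_weight l X B * f (c B)) \<le> T * 2 * M * mix_weight l X B"
      proof -
        have "(T * mix_weight l X B) * f (c B) \<le> (T * mix_weight l X B) * (2 * M)"
          using B fc[of B] T mix_weight_nonneg[of l X B] by (intro mult_left_mono) auto
        then show ?thesis by (simp add: mult_ac)
      qed
      moreover have "0 \<le> T * (mix_weight l X B * f (c B))"
        using B T mix_weight_nonneg[of l X B] f_nonneg[of "c B"] c by auto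
      ultimately show "(T * (mix_weight l X B * f (c B)))\<^sup>2 \<le> (T * 2 * M)\<^sup>2 * (mix_weight l X B)\<^sup>2"
        by (simp only: power_mult_distrib[symmetric] power_mono)
    qed
    also have "\<dots> \<le> (T * 2 * M)\<^sup>2 * \<sigma>"
      unfolding sum_distrib_left[symmetric] using sq by (intro mult_left_mono) auto
    finally show "(\<Sum>B\<in>Pow X. (T * (mix_weight l X B * f (c B)))\<^sup>2) \<le> 4 * T\<^sup>2 * M\<^sup>2 * \<sigma>"
      by (simp add: power_mult_distrib mult_ac)
  qed (use noise_facts finX c T M \<sigma> assms mix_weight_nonneg f_nonneg clip_bounds in \<open>auto simp: less_imp_le intro!: mult_nonneg_nonneg\<close>)
  have 2: "measure ?P E2 \<le> 2 * exp (- 2 * \<theta>\<^sup>2 / \<sigma>)"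
    unfolding E2_def
    by (rule weighted_noise_concentration[where K = 1])
      (use noise_facts finX c \<sigma> sq assms mix_weight_nonneg in \<open>auto simp: indicator_def\<close>)
  have meas: "E1 \<in> sets ?P" "E2 \<in> sets ?P"
  proof -
    have [measurable]: "(\<lambda>\<xi>. \<Sum>B\<in>Pow X. mix_weight l X B * f (c B) * clip T (\<xi> (c B))) \<in> borel_measurable ?P"
      using c by (intro borel_measurable_sum borel_measurable_times borel_measurable_const
        measurable_compose[OF noise_coordinate_measurable clip_measurable]) auto
    show "E1 \<in> sets ?P" unfolding E1_def by measurable
    have [measurable]: "(\<lambda>\<xi>. \<Sum>B\<in>Pow X. mix_weight l X B * indicator {T<..} (\<xi> (c B))) \<in> borel_measurable ?P"
      using c by (intro borel_measurable_sum borel_measurable_times borel_measurable_const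
        measurable_compose[OF noise_coordinate_measurable borel_measurable_indicator]) auto
    show "E2 \<in> sets ?P" unfolding E2_def by measurable
  qed
  have "(\<integral>x. indicator {T<..} x \<partial>D) = measure D {T<..}"
    using noise_facts by (simp add: D.prob_space)
  then have "{\<xi> \<in> space ?P. \<not> typical_at \<delta> \<theta> X c \<xi>} \<subseteq> E1 \<union> E2"
    unfolding typical_at_def E1_def E2_def mix_exp_eq_sum noise_mean_def sum_mix_weight[OF finX l]
    by (auto simp: mult_ac)
  then have "measure ?P {\<xi> \<in> space ?P. \<not> typical_at \<delta> \<theta> X c \<xi>} \<le> measure ?P (E1 \<union> E2)"
    using meas by (intro P.finite_measure_mono) auto
  also have "\<dots> \<le> measure ?P E1 + measure ?P E2" using meas by (intro measure_Un_le) auto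
  finally show ?thesis using 1 2 unfolding \<sigma>_def by (simp add: mult_ac)
qed

lemma typical_noise_iff:
  "typical_noise \<delta> \<theta> \<xi> \<longleftrightarrow>
    (\<forall>(X, e)\<in>{(X, e). sample_site X e}. typical_at \<delta> \<theta> X (insert e) \<xi> \<and> typical_at \<delta> \<theta> X (\<lambda>B. B) \<xi>)"
  by (auto simp: typical_noise_def)

lemma sample_site_finite: "{(X, e). sample_site X e} \<subseteq> Pow N \<times> N" "finite {(X, e). sample_site X e}"
proof -
  show "{(X, e). sample_site X e} \<subseteq> Pow N \<times> N" by (auto simp: sample_site_def)
  then show "finite {(X, e). sample_site X e}" using finite_N by (auto intro: finite_subset)
qed

lemma sample_site_sets:
  assumes "sample_site X e"
  shows "{\<xi> \<in> space (noise_space N D). typical_at \<delta> \<theta> X (insert e) \<xi>} \<in> sets (noise_space N D)"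
    "{\<xi> \<in> space (noise_space N D). typical_at \<delta> \<theta> X (\<lambda>B. B) \<xi>} \<in> sets (noise_space N D)"
  using assms by (auto intro!: typical_at_sets simp: sample_site_def)

lemma typical_noise_sets:
  "{\<xi> \<in> space (noise_space N D). typical_noise \<delta> \<theta> \<xi>} \<in> sets (noise_space N D)"
  unfolding typical_noise_iff using sample_site_sets sample_site_finite
  by (intro sets.sets_Collect_finite_All) (auto intro!: sets.sets_Collect_conj)

lemma prob_typical_noise:
  assumes "0 < \<delta>" "0 < \<theta>"
  shows "1 - 2 ^ card N * card N * (4 * exp (- \<delta>\<^sup>2 / (2 * T\<^sup>2 * M\<^sup>2 * (1 - step_size l) ^ k))
        + 4 * exp (- 2 * \<theta>\<^sup>2 / (1 - step_size l) ^ k))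
    \<le> measure (noise_space N D) {\<xi> \<in> space (noise_space N D). typical_noise \<delta> \<theta> \<xi>}"
proof -
  let ?P = "noise_space N D"
  interpret P: prob_space ?P by (rule prob_space_noise)
  define b where "b = 2 * exp (- \<delta>\<^sup>2 / (2 * T\<^sup>2 * M\<^sup>2 * (1 - step_size l) ^ k)) + 2 * exp (- 2 * \<theta>\<^sup>2 / (1 - step_size l) ^ k)"
  define S where "S = {(X, e). sample_site X e}"
  define bad where "bad = (\<lambda>(X, e). {\<xi> \<in> space ?P. \<not> typical_at \<delta> \<theta> X (insert e) \<xi>} \<union>
     {\<xi> \<in> space ?P. \<not> typical_at \<delta> \<theta> X (\<lambda>B. B) \<xi>})"
  have neg: "{\<xi> \<in> space ?P. \<not> Q \<xi>} = space ?P - {\<xi> \<in> space ?P. Q \<xi>}" for Q by auto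
  have bad: "bad s \<in> sets ?P \<and> measure ?P (bad s) \<le> 2 * b" if "s \<in> S" for s
  proof -
    obtain X e where s: "s = (X, e)" "sample_site X e" using \<open>s \<in> S\<close> unfolding S_def by auto
    note m = sample_site_sets[OF s(2), of \<delta> \<theta>]
    have st: "X \<subseteq> N" "e \<in> N" "e \<notin> X" "k \<le> card X" "f (insert e X) \<le> 2 * M"
      using s(2) by (auto simp: sample_site_def)
    have le: "f (insert e B) \<le> 2 * M" "f B \<le> 2 * M" if "B \<subseteq> X" for B
      using that st f_monoD[of "insert e B" "insert e X"] f_monoD[of B "insert e X"] subset_insertI2[of B X e] by auto
    have inj: "inj_on (insert e) (Pow X)" using st by (auto simp: inj_on_def)
    have m': "{\<xi> \<in> space ?P. \<not> typical_at \<delta> \<theta> X (insert e) \<xi>} \<in> sets ?P"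
      "{\<xi> \<in> space ?P. \<not> typical_at \<delta> \<theta> X (\<lambda>B. B) \<xi>} \<in> sets ?P"
      unfolding neg using m by auto
    have "measure ?P (bad s) \<le> measure ?P {\<xi> \<in> space ?P. \<not> typical_at \<delta> \<theta> X (insert e) \<xi>}
       + measure ?P {\<xi> \<in> space ?P. \<not> typical_at \<delta> \<theta> X (\<lambda>B. B) \<xi>}"
      unfolding bad_def s(1) using m' by (simp add: measure_Un_le)
    also have "\<dots> \<le> b + b"
      unfolding b_def using st le inj assms
      by (intro add_mono prob_not_typical_at) auto
    finally show ?thesis using m' unfolding bad_def s(1) by auto
  qed
  have "{\<xi> \<in> space ?P. \<not> typical_noise \<delta> \<theta> \<xi>} = (\<Union>s\<in>S. bad s)"
    unfolding typical_noise_iff bad_def S_def by auto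
  then have "measure ?P {\<xi> \<in> space ?P. \<not> typical_noise \<delta> \<theta> \<xi>} \<le> (\<Sum>s\<in>S. measure ?P (bad s))"
    using bad sample_site_finite unfolding S_def by (auto intro!: measure_UNION_le)
  also have "\<dots> \<le> (\<Sum>s\<in>S. 2 * b)" using bad by (intro sum_mono) auto
  also have "\<dots> \<le> 2 ^ card N * card N * (2 * b)"
  proof -
    have "card S \<le> card (Pow N \<times> N)" unfolding S_def
      using sample_site_finite finite_N by (intro card_mono) auto
    then have "card S \<le> 2 ^ card N * card N" using finite_N by (simp add: card_cartesian_product card_Pow)
    then have "real (card S) \<le> real (2 ^ card N * card N)" by (rule of_nat_mono)
    then show ?thesis unfolding sum_constant by (intro mult_right_mono) (auto simp: b_def)
  qed
  finally have "measure ?P {\<xi> \<in> space ?P. \<not> typical_noise \<delta> \<theta> \<xi>} \<le> 2 ^ card N * card N * (2 * b)" .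
  then show ?thesis
    unfolding neg using typical_noise_sets[of \<delta> \<theta>] by (simp add: P.prob_compl b_def algebra_simps)
qed

end

subsection \<open>The algorithm\<close>

definition samples :: "nat \<Rightarrow> nat \<Rightarrow> 'a set \<Rightarrow> 'a set \<Rightarrow> ('a \<times> nat \<Rightarrow> 'a set) pmf" where
  "samples l m N A = Pi_pmf (N \<times> {..<m}) {} (\<lambda>(e, i). sample_pmf l (A - {e}))"

text \<open>The default 0 outside \<open>N\<close> makes the estimate measurable in the noise for
  every e, as the lemmas on the best swap require.\<close>

definition estimate ::
  "'a set \<Rightarrow> nat \<Rightarrow> ('a set \<Rightarrow> real) \<Rightarrow> ('a \<times> nat \<Rightarrow> 'a set) \<Rightarrow> 'a \<Rightarrow> real" where
  "estimate N m v R e = (if e \<in> N then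
     (\<Sum>i<m. max 0 (v (insert e (R (e, i)))) - max 0 (v (R (e, i)))) / real m else 0)"

text \<open>Trivial swaps (b, b) keep this set nonempty for a nonempty independent A, so the best
  gain is never negative. A swap onto another element of A is excluded because it would shrink the
  base.\<close>

definition swaps :: "'a set set \<Rightarrow> 'a set \<Rightarrow> ('a \<times> 'a) set" where
  "swaps \<I> A = {(b, c). b \<in> A \<and> insert c (A - {b}) \<in> \<I> \<and> (c \<in> A \<longrightarrow> c = b)}"

definition swap_gain :: "('a \<Rightarrow> real) \<Rightarrow> 'a \<times> 'a \<Rightarrow> real" where
  "swap_gain w = (\<lambda>(b, c). w c - w b)"

definition best_gain :: "'a set set \<Rightarrow> 'a set \<Rightarrow> ('a \<Rightarrow> real) \<Rightarrow> real" where
  "best_gain \<I> A w = Max (swap_gain w ` swaps \<I> A)"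

text \<open>The full set of maximisers is kept, and \<open>swap_along\<close> chooses from it. The
  next base thus depends on the real-valued estimates only through one of finitely many sets, which
  is what makes the arbitrary choice measurable.\<close>

definition best_swaps :: "'a set set \<Rightarrow> 'a set \<Rightarrow> ('a \<Rightarrow> real) \<Rightarrow> ('a \<times> 'a) set" where
  "best_swaps \<I> A w = {s \<in> swaps \<I> A. \<forall>s'\<in>swaps \<I> A. swap_gain w s' \<le> swap_gain w s}"

definition swap_along :: "'a set \<Rightarrow> ('a \<times> 'a) set \<Rightarrow> 'a set" where
  "swap_along A Q = (let s = (SOME s. s \<in> Q) in insert (snd s) (A - {fst s}))"

text \<open>\<open>Random_Draw\<close> yields only natural numbers, so the countable support of p is
  enumerated and decoded again.\<close>

definition draw :: "'b pmf \<Rightarrow> ('b \<Rightarrow> 'a oracle_alg) \<Rightarrow> 'a oracle_alg" where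
  "draw p k = Random_Draw (map_pmf (to_nat_on (set_pmf p)) p) (\<lambda>i. k (from_nat_into (set_pmf p) i))"

primrec ask :: "'a set list \<Rightarrow> ('a set \<Rightarrow> real) \<Rightarrow> (('a set \<Rightarrow> real) \<Rightarrow> 'a oracle_alg) \<Rightarrow> 'a oracle_alg" where
  "ask [] g k = k g"
| "ask (S # Ss) g k = Value_Query S (\<lambda>v. ask Ss (g(S := v)) k)"

text \<open>\<open>run\<close> counts value queries only. Learning all of \<I> by membership queries
  lets the remaining search be written with \<I> as a known set.\<close>

primrec learn_members :: "'a set list \<Rightarrow> 'a set set \<Rightarrow> ('a set set \<Rightarrow> 'a oracle_alg) \<Rightarrow> 'a oracle_alg" where
  "learn_members [] \<I> k = k \<I>"
| "learn_members (S # Ss) \<I> k = Member_Query S (\<lambda>b. learn_members Ss (if b then insert S \<I> else \<I>) k)"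

definition elements :: "'b set \<Rightarrow> 'b list" where
  "elements X = (SOME xs. set xs = X \<and> distinct xs)"

definition query_sets :: "'a set \<Rightarrow> nat \<Rightarrow> ('a \<times> nat \<Rightarrow> 'a set) \<Rightarrow> 'a set list" where
  "query_sets N m R = (let ps = List.product (elements N) [0..<m] in
     map (\<lambda>(e, i). insert e (R (e, i))) ps @ map R ps)"

text \<open>
  \<open>A\<close> is the current base, \<open>A'\<close> the base with the smallest estimated best gain \<open>g\<close> so far.
  Returning the latter avoids a stopping threshold, which would depend on the unknown scales
  of \<open>f\<close> and of the noise.
\<close>

primrec local_search :: "'a set \<Rightarrow> nat \<Rightarrow> nat \<Rightarrow> 'a set set \<Rightarrow> nat \<Rightarrow> 'a set \<Rightarrow> 'a set \<Rightarrow> ereal \<Rightarrow> 'a oracle_alg" where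
  "local_search N l m \<I> 0 A A' g = Output A'"
| "local_search N l m \<I> (Suc t) A A' g = draw (samples l m N A) (\<lambda>R.
     ask (query_sets N m R) (\<lambda>_. 0) (\<lambda>v. let w = estimate N m v R; A1 = swap_along A (best_swaps \<I> A w) in
       if ereal (best_gain \<I> A w) < g
       then local_search N l m \<I> t A1 A (ereal (best_gain \<I> A w))
       else local_search N l m \<I> t A1 A' g))"

text \<open>For \<epsilon> >= 1 the target ratio is not positive and the empty set suffices.
  Otherwise a round makes 2 n * n^3 queries and there are n^2 * l rounds, so 2 n^6 l in total. An
  improving round raises the potential by order \<epsilon> OPT / n and the potential is O(OPT /
  \<epsilon>), so O(n / \<epsilon>^2) rounds are needed, fewer than n^2 / \<epsilon> for large
  n.\<close>

definition noisy_local_search :: "'a set \<Rightarrow> real \<Rightarrow> 'a oracle_alg" where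
  "noisy_local_search N \<epsilon> = (if 1 \<le> \<epsilon> then Output {} else
     learn_members (elements (Pow N)) {} (\<lambda>\<I>.
       let A = (SOME A. A \<in> \<I> \<and> card A = matroid_rank \<I>) in
       local_search N (nat \<lceil>1 / \<epsilon>\<rceil>) (card N ^ 3) \<I> (card N ^ 2 * nat \<lceil>1 / \<epsilon>\<rceil>) A A \<infinity>))"

section \<open>Semantics and query count of the search program\<close>

lemma run_draw: "run (draw p k) val mem = bind_pmf p (\<lambda>x. run (k x) val mem)"
  unfolding draw_def by (auto simp: bind_map_pmf countable_set_pmf intro!: bind_pmf_cong)

lemma run_ask:
  "run (ask Ss g k) val mem
    = map_pmf (apsnd ((+) (length Ss))) (run (k (\<lambda>S. if S \<in> set Ss then val S else g S)) val mem)"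
proof (induction Ss arbitrary: g)
  case Nil
  have "apsnd (\<lambda>q. q) = (id :: 'a set \<times> nat \<Rightarrow> _)" by (auto simp: fun_eq_iff)
  then show ?case by (simp add: pmf.map_id)
next
  case (Cons S Ss)
  have "(\<lambda>S'. if S' \<in> set Ss then val S' else (g(S := val S)) S')
      = (\<lambda>S'. if S' \<in> set (S # Ss) then val S' else g S')" by auto
  moreover have "apsnd Suc \<circ> apsnd ((+) (length Ss)) = (apsnd ((+) (length (S # Ss))) :: 'a set \<times> nat \<Rightarrow> _)"
    by (auto simp: fun_eq_iff)
  ultimately show ?case by (simp only: ask.simps run.simps Cons pmf.map_comp)
qed

lemma run_learn_members:
  "run (learn_members Ss \<I> k) val mem = run (k (\<I> \<union> {S \<in> set Ss. mem S})) val mem"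
proof (induction Ss arbitrary: \<I>)
  case (Cons S Ss)
  have "(if mem S then insert S \<I> else \<I>) \<union> {S \<in> set Ss. mem S} = \<I> \<union> {S' \<in> set (S # Ss). mem S'}"
    by auto
  then show ?case by (simp add: Cons)
qed simp

lemma elements: "finite X \<Longrightarrow> set (elements X) = X \<and> distinct (elements X)"
  unfolding elements_def
  by (rule someI_ex[of "\<lambda>xs. set xs = X \<and> distinct xs", OF finite_distinct_list])

lemma length_elements: "finite X \<Longrightarrow> length (elements X) = card X"
  using elements[of X] distinct_card[of "elements X"] by simp

lemma length_query_sets: "finite N \<Longrightarrow> length (query_sets N m R) = 2 * card N * m"
  by (simp add: query_sets_def Let_def length_elements)

lemma estimate_query_sets:
  assumes "finite N"
  shows "estimate N m (\<lambda>S. if S \<in> set (query_sets N m R) then v S else g S) R = estimate N m v R"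
proof
  fix e
  have "insert e (R (e, i)) \<in> set (query_sets N m R)" "R (e, i) \<in> set (query_sets N m R)"
    if "e \<in> N" "i < m" for i
    using that elements[OF assms] by (auto simp: query_sets_def Let_def)
  then show "estimate N m (\<lambda>S. if S \<in> set (query_sets N m R) then v S else g S) R e = estimate N m v R e"
    unfolding estimate_def by (auto intro!: sum.cong arg_cong2[of _ _ _ _ "(/)"])
qed

lemma run_local_search_Suc:
  assumes "finite N"
  shows "run (local_search N l m \<I> (Suc t) A A' g) val mem = bind_pmf (samples l m N A) (\<lambda>R.
     map_pmf (apsnd ((+) (2 * card N * m))) (run
       (let w = estimate N m val R; \<gamma> = best_gain \<I> A w in
         local_search N l m \<I> t (swap_along A (best_swaps \<I> A w)) (if ereal \<gamma> < g then A else A') (if ereal \<gamma> < g then ereal \<gamma> else g))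
       val mem))"
  unfolding local_search.simps run_draw run_ask Let_def
    estimate_query_sets[OF assms] length_query_sets[OF assms]
  by (intro bind_pmf_cong refl arg_cong[of _ _ "map_pmf _"]) simp

lemma query_count_local_search:
  assumes "finite N"
  shows "(S, q) \<in> set_pmf (run (local_search N l m \<I> t A A' g) val mem) \<Longrightarrow> q = 2 * card N * m * t"
proof (induction t arbitrary: A A' g S q)
  case (Suc t)
  obtain R q' where R: "(S, q') \<in> set_pmf (run
       (let w = estimate N m val R; \<gamma> = best_gain \<I> A w in
         local_search N l m \<I> t (swap_along A (best_swaps \<I> A w)) (if ereal \<gamma> < g then A else A') (if ereal \<gamma> < g then ereal \<gamma> else g))
       val mem)" "q = 2 * card N * m + q'"
    using Suc.prems[unfolded run_local_search_Suc[OF assms]] by (auto simp del: local_search.simps)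
  show ?case using Suc.IH[OF R(1)[unfolded Let_def]] R(2) by simp
qed simp

lemma set_samples:
  assumes "finite N" "A \<subseteq> N" "0 < l" "R \<in> set_pmf (samples l m N A)" "e \<in> N" "i < m"
  shows "R (e, i) \<subseteq> A - {e}"
proof -
  have "R (e, i) \<in> set_pmf (sample_pmf l (A - {e}))"
    using assms(1,4-6) unfolding samples_def
    by (subst (asm) set_Pi_pmf) (auto simp: PiE_dflt_def)
  then show ?thesis using set_sample_pmf[of "A - {e}" l] assms finite_subset[of A N] by auto
qed

lemma finite_set_samples:
  assumes "finite N" "A \<subseteq> N" "0 < l"
  shows "finite (set_pmf (samples l m N A))"
proof -
  have "finite (set_pmf (sample_pmf l (A - {e})))" for e
    using set_sample_pmf[of "A - {e}" l] assms finite_subset[of A N]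
    by (auto intro!: finite_subset[of _ "Pow (A - {e})"])
  then show ?thesis unfolding samples_def using assms
    by (subst set_Pi_pmf) (auto intro!: finite_PiE_dflt)
qed

text \<open>As a finite sum, the probability over the draws inherits measurability in the noise term
  by term.\<close>

lemma measure_bind_pmf_finite:
  assumes "finite (set_pmf p)"
  shows "measure_pmf.prob (bind_pmf p F) E = (\<Sum>x\<in>set_pmf p. pmf p x * measure_pmf.prob (F x) E)"
proof -
  have "ennreal (measure_pmf.prob (bind_pmf p F) E) = (\<integral>\<^sup>+x. emeasure (F x) E \<partial>p)"
    by (simp flip: measure_pmf.emeasure_eq_measure)
  also have "\<dots> = (\<Sum>x\<in>set_pmf p. ennreal (pmf p x * measure_pmf.prob (F x) E))"
    by (simp add: nn_integral_measure_pmf_finite[OF assms] measure_pmf.emeasure_eq_measure ennreal_mult' mult.commute)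
  also have "\<dots> = ennreal (\<Sum>x\<in>set_pmf p. pmf p x * measure_pmf.prob (F x) E)"
    by (intro sum_ennreal) auto
  finally show ?thesis by (subst (asm) ennreal_inj) (auto intro!: sum_nonneg)
qed

lemma finite_swaps:
  assumes "finite A" "finite \<I>" "\<And>S. S \<in> \<I> \<Longrightarrow> finite S"
  shows "finite (swaps \<I> A)"
proof -
  have "swaps \<I> A \<subseteq> A \<times> \<Union>\<I>" by (auto simp: swaps_def)
  then show ?thesis using assms by (auto intro: finite_subset)
qed

section \<open>Accuracy of the estimates for a fixed noise sample\<close>

context noisy_instance
begin

lemma noisy_oracle_eq_clip:
  assumes "S \<subseteq> N" "\<xi> S \<le> T"
  shows "max 0 (noisy_oracle N f \<xi> S) = clip T (\<xi> S) * f S"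
proof -
  have "max 0 (\<xi> S * f S) = max 0 (\<xi> S) * f S"
    using f_nonneg[OF assms(1)] by (auto simp: max_def mult_nonneg_nonneg mult_nonpos_nonneg
        zero_le_mult_iff order_antisym)
  then show ?thesis using assms T by (simp add: noisy_oracle_def clip_def)
qed

text \<open>Here only the draws are random. The error t is the deviation of the m draws from their
  mean, and 2 \<delta> that of the two clipped means from their values under averaged noise. Each
  draw reads two sets, hence 2 m chances of meeting noise above T. Terms range over an interval of
  length 4 T M, which gives the 8 in the exponent.\<close>

lemma estimate_accuracy:
  assumes A: "A \<subseteq> N" and e: "e \<in> N" and site: "sample_site (A - {e}) e" and m: "0 < m"
    and tn: "typical_noise \<delta> \<theta> \<xi>" and t: "0 < t"
  shows "measure_pmf.prob (samples l m N A)
      {R. t + 2 * \<delta> < \<bar>estimate N m (noisy_oracle N f \<xi>) R e - noise_mean * swap_weight l f A e\<bar>}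
    \<le> 2 * real m * (measure D {T<..} + \<theta>) + 2 * exp (- real m * t\<^sup>2 / (8 * T\<^sup>2 * M\<^sup>2))"
proof -
  define X where "X = A - {e}"
  have X: "X \<subseteq> N" "e \<notin> X" "finite X" "f (insert e X) \<le> 2 * M"
    using A finite_N finite_subset site by (auto simp: X_def sample_site_def)
  define u where "u = (\<lambda>S. clip T (\<xi> S) * f S)"
  define Y where "Y = (\<lambda>B. u (insert e B) - u B)"
  let ?p = "samples l m N A"
  define I where "I = {e} \<times> {..<m}"
  have I: "finite I" "I \<subseteq> N \<times> {..<m}" "card I = m" using e by (auto simp: I_def card_cartesian_product)
  have comp: "map_pmf (\<lambda>R. R (e, i)) ?p = sample_pmf l X" if "i < m" for i
    unfolding samples_def using that e finite_N by (subst Pi_pmf_component) (auto simp: X_def)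
  have sub: "R (e, i) \<subseteq> X" if "R \<in> set_pmf ?p" "i < m" for R i
    using set_samples[OF finite_N A l that(1) e that(2)] by (simp add: X_def)
  have u_bounds: "0 \<le> u S" "u S \<le> T * (2 * M)" if "S \<subseteq> insert e X" for S
  proof -
    have SN: "S \<subseteq> N" using that X e by auto
    have "f S \<le> 2 * M" using f_monoD[of S "insert e X"] that X e by auto
    then show "u S \<le> T * (2 * M)" unfolding u_def
      using clip_bounds[of T "\<xi> S"] f_nonneg[OF SN] T by (intro mult_mono) auto
    show "0 \<le> u S" unfolding u_def using clip_bounds[of T "\<xi> S"] f_nonneg[OF SN] T by auto
  qed
  have Y_bounds: "Y B \<in> {- (2 * T * M)..2 * T * M}" if "B \<subseteq> X" for B
  proof -
    have "insert e B \<subseteq> insert e X" "B \<subseteq> insert e X" using that by auto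
    from u_bounds[OF this(1)] u_bounds[OF this(2)] show ?thesis
      unfolding Y_def by (simp add: mult_ac)
  qed
  have ind: "prob_space.indep_vars ?p (\<lambda>_. borel) (\<lambda>x R. Y (R x)) I"
  proof -
    have "prob_space.indep_vars ?p (\<lambda>_. count_space UNIV) (\<lambda>x R. R x) I"
      unfolding samples_def using finite_N
      by (intro prob_space.indep_vars_subset[OF prob_space_measure_pmf indep_vars_Pi_pmf I(2)]) auto
    then show ?thesis by (rule prob_space.indep_vars_compose2[OF prob_space_measure_pmf]) auto
  qed
  interpret H: Hoeffding_ineq "measure_pmf ?p" I "\<lambda>x R. Y (R x)" "\<lambda>_. - (2 * T * M)" "\<lambda>_. 2 * T * M"
      "\<Sum>x\<in>I. measure_pmf.expectation ?p (\<lambda>R. Y (R x))"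
  proof unfold_locales
    fix x assume "x \<in> I"
    then show "AE R in measure_pmf ?p. Y (R x) \<in> {- (2 * T * M)..2 * T * M}"
      using sub Y_bounds by (auto simp: AE_measure_pmf_iff I_def)
  qed (use I ind in auto)
  have ex: "measure_pmf.expectation ?p (\<lambda>R. Y (R (e, i))) = mix_exp l X Y" if "i < m" for i
    using expectation_sample_pmf[OF X(3) l, of Y] by (simp flip: comp[OF that])
  have sumI: "(\<Sum>x\<in>I. g x) = (\<Sum>i<m. g (e, i))" for g :: "'a \<times> nat \<Rightarrow> real"
    using sum.cartesian_product[of "\<lambda>a b. g (a, b)" "{..<m}" "{e}"] by (simp add: I_def)
  define E1 where "E1 = {R. real m * t \<le> \<bar>(\<Sum>i<m. Y (R (e, i))) - real m * mix_exp l X Y\<bar>}"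
  \<comment> \<open>Outside E2 the observed values agree with the clipped ones; on E2 nothing is
    claimed.\<close>
  define E2 where "E2 = (\<lambda>i::nat. {R. T < \<xi> (insert e (R (e, i)))} \<union> {R. T < \<xi> (R (e, i))})"
  have E1: "measure_pmf.prob ?p E1 \<le> 2 * exp (- real m * t\<^sup>2 / (8 * T\<^sup>2 * M\<^sup>2))"
  proof -
    have V: "(\<Sum>x\<in>I. (2 * T * M - - (2 * T * M))\<^sup>2) = real m * (16 * T\<^sup>2 * M\<^sup>2)"
      by (simp add: I power_mult_distrib power2_eq_square)
    have "(\<Sum>x\<in>I. measure_pmf.expectation ?p (\<lambda>R. Y (R x))) = real m * mix_exp l X Y"
      unfolding sumI using ex by simp
    then have "measure_pmf.prob ?p E1 \<le> 2 * exp (- 2 * (real m * t)\<^sup>2 / (real m * (16 * T\<^sup>2 * M\<^sup>2)))"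
      using H.Hoeffding_ineq_abs_ge[of "real m * t"] m t T M unfolding V E1_def sumI by simp
    also have "- 2 * (real m * t)\<^sup>2 / (real m * (16 * T\<^sup>2 * M\<^sup>2)) = - real m * t\<^sup>2 / (8 * T\<^sup>2 * M\<^sup>2)"
      using m by (simp add: power_mult_distrib power2_eq_square mult_ac)
    finally show ?thesis .
  qed
  have tn': "typical_at \<delta> \<theta> X (insert e) \<xi>" "typical_at \<delta> \<theta> X (\<lambda>B. B) \<xi>"
    using tn site by (auto simp: typical_noise_def X_def)
  have hit: "measure_pmf.prob ?p {R. T < \<xi> (c (R (e, i)))} \<le> measure D {T<..} + \<theta>"
    if "i < m" "typical_at \<delta> \<theta> X c \<xi>" for i c
  proof -
    have "measure_pmf.prob ?p {R. T < \<xi> (c (R (e, i)))} = measure_pmf.prob (sample_pmf l X) {B. T < \<xi> (c B)}"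
      unfolding comp[OF that(1), symmetric] by (simp add: vimage_def)
    also have "\<dots> = measure_pmf.expectation (sample_pmf l X) (indicator {B. T < \<xi> (c B)})" by simp
    also have "\<dots> = mix_exp l X (indicator {B. T < \<xi> (c B)})" by (rule expectation_sample_pmf[OF X(3) l])
    also have "indicator {B. T < \<xi> (c B)} = (\<lambda>B. indicator {T<..} (\<xi> (c B)) :: real)"
      by (auto simp: indicator_def)
    finally show ?thesis using that(2) unfolding typical_at_def by simp
  qed
  have E2: "measure_pmf.prob ?p (E2 i) \<le> 2 * (measure D {T<..} + \<theta>)" if "i < m" for i
  proof -
    have "measure_pmf.prob ?p (E2 i) \<le> measure_pmf.prob ?p {R. T < \<xi> (insert e (R (e, i)))}
       + measure_pmf.prob ?p {R. T < \<xi> (R (e, i))}"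
      unfolding E2_def by (intro measure_Un_le) auto
    then show ?thesis using hit[OF that tn'(1)] hit[OF that tn'(2)] by simp
  qed
  have meanY: "\<bar>mix_exp l X Y - noise_mean * swap_weight l f A e\<bar> < 2 * \<delta>"
  proof -
    have "mix_exp l X Y = mix_exp l X (\<lambda>B. u (insert e B)) - mix_exp l X u"
      unfolding Y_def by (rule mix_exp_diff)
    moreover have "swap_weight l f A e = mix_exp l X (\<lambda>B. f (insert e B)) - mix_exp l X f"
      unfolding swap_weight_def X_def[symmetric] by (rule mix_exp_diff)
    ultimately show ?thesis
      using tn' unfolding typical_at_def u_def by (simp add: right_diff_distrib abs_if split: if_splits)
  qed
  have "measure_pmf.prob ?p {R. t + 2 * \<delta> < \<bar>estimate N m (noisy_oracle N f \<xi>) R e - noise_mean * swap_weight l f A e\<bar>}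
    \<le> measure_pmf.prob ?p (E1 \<union> (\<Union>i<m. E2 i))"
  proof (rule measure_pmf.finite_measure_mono_AE)
    show "AE R in measure_pmf ?p. R \<in> {R. t + 2 * \<delta> < \<bar>estimate N m (noisy_oracle N f \<xi>) R e
        - noise_mean * swap_weight l f A e\<bar>} \<longrightarrow> R \<in> E1 \<union> (\<Union>i<m. E2 i)"
      unfolding AE_measure_pmf_iff
    proof (intro ballI impI, rule ccontr)
      fix R assume R: "R \<in> set_pmf ?p"
        and far: "R \<in> {R. t + 2 * \<delta> < \<bar>estimate N m (noisy_oracle N f \<xi>) R e - noise_mean * swap_weight l f A e\<bar>}"
        and nE: "R \<notin> E1 \<union> (\<Union>i<m. E2 i)"
      have "max 0 (noisy_oracle N f \<xi> (insert e (R (e, i)))) - max 0 (noisy_oracle N f \<xi> (R (e, i))) = Y (R (e, i))"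
        if i: "i < m" for i
      proof -
        have "\<xi> (insert e (R (e, i))) \<le> T" "\<xi> (R (e, i)) \<le> T" using nE i by (auto simp: E2_def not_less)
        moreover have "R (e, i) \<subseteq> N" using sub[OF R i] X by auto
        ultimately show ?thesis using e by (simp add: noisy_oracle_eq_clip Y_def u_def)
      qed
      then have "estimate N m (noisy_oracle N f \<xi>) R e = (\<Sum>i<m. Y (R (e, i))) / real m"
        using e by (simp add: estimate_def)
      moreover have "\<bar>(\<Sum>i<m. Y (R (e, i))) / real m - mix_exp l X Y\<bar> < t"
      proof -
        have "\<bar>(\<Sum>i<m. Y (R (e, i))) - real m * mix_exp l X Y\<bar> < real m * t" using nE by (auto simp: E1_def)
        moreover have "(\<Sum>i<m. Y (R (e, i))) / real m - mix_exp l X Y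
            = ((\<Sum>i<m. Y (R (e, i))) - real m * mix_exp l X Y) / real m" using m by (simp add: field_simps)
        ultimately show ?thesis using m by (simp add: abs_divide pos_divide_less_eq mult.commute)
      qed
      ultimately show False using meanY far by auto
    qed
  qed auto
  also have "\<dots> \<le> measure_pmf.prob ?p E1 + measure_pmf.prob ?p (\<Union>i<m. E2 i)"
    by (intro measure_Un_le) auto
  also have "measure_pmf.prob ?p (\<Union>i<m. E2 i) \<le> (\<Sum>i<m. measure_pmf.prob ?p (E2 i))"
    by (intro measure_UNION_le) auto
  also have "(\<Sum>i<m. measure_pmf.prob ?p (E2 i)) \<le> (\<Sum>i<m. 2 * (measure D {T<..} + \<theta>))"
    using E2 by (intro sum_mono) auto
  also have "\<dots> = 2 * real m * (measure D {T<..} + \<theta>)" by (simp add: algebra_simps)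
  finally show ?thesis using E1 by linarith
qed

lemma estimates_accurate:
  assumes A: "A \<subseteq> N" and site: "\<And>e. e \<in> N \<Longrightarrow> sample_site (A - {e}) e" and m: "0 < m"
    and tn: "typical_noise \<delta> \<theta> \<xi>" and t: "0 < t"
  shows "measure_pmf.prob (samples l m N A)
      {R. \<exists>e\<in>N. t + 2 * \<delta> < \<bar>estimate N m (noisy_oracle N f \<xi>) R e - noise_mean * swap_weight l f A e\<bar>}
    \<le> real (card N) * (2 * real m * (measure D {T<..} + \<theta>) + 2 * exp (- real m * t\<^sup>2 / (8 * T\<^sup>2 * M\<^sup>2)))"
proof -
  let ?E = "\<lambda>e. {R. t + 2 * \<delta> < \<bar>estimate N m (noisy_oracle N f \<xi>) R e - noise_mean * swap_weight l f A e\<bar>}"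
  have "{R. \<exists>e\<in>N. t + 2 * \<delta> < \<bar>estimate N m (noisy_oracle N f \<xi>) R e - noise_mean * swap_weight l f A e\<bar>}
      = (\<Union>e\<in>N. ?E e)" by auto
  then have "measure_pmf.prob (samples l m N A)
      {R. \<exists>e\<in>N. t + 2 * \<delta> < \<bar>estimate N m (noisy_oracle N f \<xi>) R e - noise_mean * swap_weight l f A e\<bar>}
    \<le> (\<Sum>e\<in>N. measure_pmf.prob (samples l m N A) (?E e))"
    using finite_N by (simp only:) (intro measure_UNION_le, auto)
  also have "\<dots> \<le> (\<Sum>e\<in>N. 2 * real m * (measure D {T<..} + \<theta>) + 2 * exp (- real m * t\<^sup>2 / (8 * T\<^sup>2 * M\<^sup>2)))"
    using assms by (intro sum_mono estimate_accuracy) auto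
  finally show ?thesis by simp
qed

end

subsection \<open>Measurability of the success probability\<close>

lemma swaps_refl: "A \<in> \<I> \<Longrightarrow> b \<in> A \<Longrightarrow> (b, b) \<in> swaps \<I> A"
  by (simp add: swaps_def insert_absorb)

lemma best_swaps_nonempty:
  assumes "finite (swaps \<I> A)" "swaps \<I> A \<noteq> {}"
  shows "best_swaps \<I> A w \<noteq> {}"
proof -
  obtain s where "s \<in> swaps \<I> A" "swap_gain w s = Max (swap_gain w ` swaps \<I> A)"
    using assms Max_in[of "swap_gain w ` swaps \<I> A"] by (metis (no_types, lifting) finite_imageI image_iff image_is_empty)
  then have "s \<in> best_swaps \<I> A w" using assms by (auto simp: best_swaps_def)
  then show ?thesis by auto
qed

lemma swap_along_mem:
  assumes "B \<noteq> {}" "B \<subseteq> swaps \<I> A"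
  shows "\<exists>b c. (b, c) \<in> B \<and> swap_along A B = insert c (A - {b})" "swap_along A B \<in> \<I>" "swap_along A B \<noteq> {}"
proof -
  define s where "s = (SOME s. s \<in> B)"
  have s: "s \<in> B" unfolding s_def using assms some_in_eq[of B] by auto
  then show "\<exists>b c. (b, c) \<in> B \<and> swap_along A B = insert c (A - {b})"
    unfolding swap_along_def s_def[symmetric] Let_def
    by (intro exI[of _ "fst s"] exI[of _ "snd s"]) simp
  show "swap_along A B \<in> \<I>" "swap_along A B \<noteq> {}"
    using s assms(2) unfolding swap_along_def s_def[symmetric] swaps_def Let_def by auto
qed

text \<open>There are finitely many possible values, each cut out by finitely many comparisons of
  gains. Excluding the empty set from the target guarantees that the chosen swap leads to an
  independent set.\<close>

lemma best_swaps_measurable: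
  assumes fin: "finite (swaps \<I> A)" "swaps \<I> A \<noteq> {}" and w: "\<And>e. (\<lambda>x. w x e) \<in> borel_measurable Q"
  shows "(\<lambda>x. best_swaps \<I> A (w x)) \<in> measurable Q (count_space (Pow (swaps \<I> A) - {{}}))"
proof -
  have [measurable]: "(\<lambda>x. swap_gain (w x) s) \<in> borel_measurable Q" for s
    unfolding swap_gain_def using w by (cases s) auto
  have "(\<lambda>x. best_swaps \<I> A (w x)) -` {B} \<inter> space Q \<in> sets Q" if B: "B \<subseteq> swaps \<I> A" for B
  proof -
    have "(\<lambda>x. best_swaps \<I> A (w x)) -` {B} \<inter> space Q = {x \<in> space Q. \<forall>s\<in>swaps \<I> A.
        (s \<in> B) = (\<forall>s'\<in>swaps \<I> A. swap_gain (w x) s' \<le> swap_gain (w x) s)}"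
      using B unfolding best_swaps_def by auto
    also have "\<dots> \<in> sets Q"
    proof (rule sets.sets_Collect_finite_All[OF _ fin(1)])
      fix s
      have "{x \<in> space Q. \<forall>s'\<in>swaps \<I> A. swap_gain (w x) s' \<le> swap_gain (w x) s} \<in> sets Q"
        by (rule sets.sets_Collect_finite_All[OF _ fin(1)]) measurable
      then show "{x \<in> space Q. (s \<in> B) = (\<forall>s'\<in>swaps \<I> A. swap_gain (w x) s' \<le> swap_gain (w x) s)} \<in> sets Q"
        by (cases "s \<in> B") (simp_all only: simp_thms sets.sets_Collect_neg)
    qed
    finally show ?thesis .
  qed
  then show ?thesis
    using fin best_swaps_nonempty[OF fin] by (subst measurable_count_space_eq2) (auto simp: best_swaps_def)
qed

lemma best_gain_measurable:
  assumes fin: "finite (swaps \<I> A)" and w: "\<And>e. (\<lambda>x. w x e) \<in> borel_measurable Q"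
  shows "(\<lambda>x. best_gain \<I> A (w x)) \<in> borel_measurable Q"
proof -
  have "(\<lambda>x. swap_gain (w x) s) \<in> borel_measurable Q" for s
    unfolding swap_gain_def using w by (cases s) auto
  then show ?thesis unfolding best_gain_def using fin by (intro borel_measurable_Max) auto
qed

context noisy_instance
begin

lemma estimate_measurable:
  assumes "\<And>i. i < m \<Longrightarrow> e \<in> N \<Longrightarrow> R (e, i) \<subseteq> N"
  shows "(\<lambda>\<xi>. estimate N m (noisy_oracle N f \<xi>) R e) \<in> borel_measurable (noise_space N D)"
proof (cases "e \<in> N")
  case True
  have "(\<lambda>\<xi>. noisy_oracle N f \<xi> S) \<in> borel_measurable (noise_space N D)" if "S \<subseteq> N" for S
    using noise_coordinate_measurable[OF that] that by (simp add: noisy_oracle_def)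
  then show ?thesis using True assms unfolding estimate_def
    by (auto intro!: borel_measurable_divide borel_measurable_sum borel_measurable_diff borel_measurable_max)
next
  case False
  then show ?thesis by (simp add: estimate_def)
qed

text \<open>Without it the integral in \<open>success_prob\<close> could take its default value 0.
  The recorded gain depends on the noise, so the induction lets g be any measurable function, while
  the base stays fixed.\<close>

lemma local_search_measurable:
  assumes I: "\<And>S. S \<in> \<I> \<Longrightarrow> S \<subseteq> N" and "A \<in> \<I>" "A \<noteq> {}" "g \<in> borel_measurable (noise_space N D)"
  shows "(\<lambda>\<xi>. measure_pmf.prob (run (local_search N l m \<I> t A A' (g \<xi>)) (noisy_oracle N f \<xi>) mem) E)
    \<in> borel_measurable (noise_space N D)"
  using assms(2-4)
proof (induction t arbitrary: A A' g E)
  case (Suc t)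
  let ?Q = "noise_space N D"
  define w where "w = (\<lambda>R \<xi>. estimate N m (noisy_oracle N f \<xi>) R)"
  have AN: "A \<subseteq> N" by (rule I[OF Suc.prems(1)])
  have finI: "finite \<I>" using I finite_N by (intro finite_subset[of \<I> "Pow N"]) auto
  have finS: "finite (swaps \<I> A)"
    using AN finI I finite_N by (intro finite_swaps) (auto intro: finite_subset)
  obtain b where "b \<in> A" using Suc.prems(2) by auto
  then have neS: "swaps \<I> A \<noteq> {}" using swaps_refl[OF Suc.prems(1)] by auto
  have meas: "(\<lambda>\<xi>. measure_pmf.prob (run
       (local_search N l m \<I> t (swap_along A (best_swaps \<I> A (w R \<xi>)))
         (if ereal (best_gain \<I> A (w R \<xi>)) < g \<xi> then A else A')
         (if ereal (best_gain \<I> A (w R \<xi>)) < g \<xi> then ereal (best_gain \<I> A (w R \<xi>)) else g \<xi>))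
       (noisy_oracle N f \<xi>) mem) E') \<in> borel_measurable ?Q"
    (is "?F \<in> _") if R: "R \<in> set_pmf (samples l m N A)" for R E'
  proof -
    have wm: "(\<lambda>\<xi>. w R \<xi> e) \<in> borel_measurable ?Q" for e
      unfolding w_def using set_samples[OF finite_N AN l R] AN
      by (intro estimate_measurable) blast
    have [measurable]: "(\<lambda>\<xi>. best_gain \<I> A (w R \<xi>)) \<in> borel_measurable ?Q"
      by (rule best_gain_measurable[OF finS wm])
    have [measurable]: "g \<in> borel_measurable ?Q" by (rule Suc.prems)
    have step: "(\<lambda>\<xi>. measure_pmf.prob (run
       (local_search N l m \<I> t (swap_along A (best_swaps \<I> A (w R \<xi>))) A'' (g' \<xi>))
       (noisy_oracle N f \<xi>) mem) E') \<in> borel_measurable ?Q"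
      if g': "g' \<in> borel_measurable ?Q" for A'' g'
    \<comment> \<open>Fixing the set B of best swaps makes the next base a constant, which is the
      form that the induction hypothesis covers.\<close>
    proof (rule measurable_compose_countable'[OF _ best_swaps_measurable[OF finS neS wm]])
      fix B assume B: "B \<in> Pow (swaps \<I> A) - {{}}"
      show "(\<lambda>\<xi>. measure_pmf.prob (run (local_search N l m \<I> t (swap_along A B) A'' (g' \<xi>))
          (noisy_oracle N f \<xi>) mem) E') \<in> borel_measurable ?Q"
        using B swap_along_mem[of B \<I> A] g' by (intro Suc.IH) auto
    qed (use finS in \<open>auto intro: countable_finite\<close>)
    have "?F = (\<lambda>\<xi>. if ereal (best_gain \<I> A (w R \<xi>)) < g \<xi>
        then measure_pmf.prob (run (local_search N l m \<I> t (swap_along A (best_swaps \<I> A (w R \<xi>))) A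
          (ereal (best_gain \<I> A (w R \<xi>)))) (noisy_oracle N f \<xi>) mem) E'
        else measure_pmf.prob (run (local_search N l m \<I> t (swap_along A (best_swaps \<I> A (w R \<xi>))) A'
          (g \<xi>)) (noisy_oracle N f \<xi>) mem) E')"
      by auto
    also have "\<dots> \<in> borel_measurable ?Q"
      by (intro measurable_If step) measurable
    finally show ?thesis .
  qed
  have "(\<lambda>\<xi>. \<Sum>R\<in>set_pmf (samples l m N A). pmf (samples l m N A) R * measure_pmf.prob (run
       (local_search N l m \<I> t (swap_along A (best_swaps \<I> A (w R \<xi>)))
         (if ereal (best_gain \<I> A (w R \<xi>)) < g \<xi> then A else A')
         (if ereal (best_gain \<I> A (w R \<xi>)) < g \<xi> then ereal (best_gain \<I> A (w R \<xi>)) else g \<xi>))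
       (noisy_oracle N f \<xi>) mem) (apsnd ((+) (2 * card N * m)) -` E)) \<in> borel_measurable ?Q"
    by (intro borel_measurable_sum borel_measurable_times borel_measurable_const meas)
  then show ?case
    unfolding run_local_search_Suc[OF finite_N] Let_def w_def measure_map_pmf
      measure_bind_pmf_finite[OF finite_set_samples[OF finite_N AN l]] .
qed simp

end

subsection \<open>Analysis of the local search\<close>

context noisy_instance
begin

definition accurate :: "'a set \<Rightarrow> real \<Rightarrow> ('a \<Rightarrow> real) \<Rightarrow> bool" where
  "accurate A \<tau> w \<longleftrightarrow> (\<forall>e\<in>N. \<bar>w e - noise_mean * swap_weight l f A e\<bar> \<le> \<tau>)"

lemma finite_matroid_swaps: "matroid N \<I> \<Longrightarrow> A \<in> \<I> \<Longrightarrow> finite (swaps \<I> A)"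
  by (intro finite_swaps) (simp_all add: matroidD(6,7))

lemma swap_accurate:
  assumes "accurate A \<tau> w" "b \<in> N" "c \<in> N"
  shows "\<bar>(w c - w b) - noise_mean * (swap_weight l f A c - swap_weight l f A b)\<bar> \<le> 2 * \<tau>"
proof -
  have "\<bar>w b - noise_mean * swap_weight l f A b\<bar> \<le> \<tau>" "\<bar>w c - noise_mean * swap_weight l f A c\<bar> \<le> \<tau>"
    using assms by (auto simp: accurate_def)
  then show ?thesis unfolding right_diff_distrib by linarith
qed

text \<open>Every pair of the exchange bijection is an admissible swap, so its estimated gain is at
  most \<gamma> and its true gain, after division by a mean of at least 1/2, at most 2 (\<gamma> + 2
  \<tau>). \<open>local_gain_sum\<close> adds these up.\<close>

lemma small_gain_imp_near_optimal:
  assumes mat: "matroid N \<I>" and A: "A \<in> \<I>" "card A = matroid_rank \<I>"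
    and C: "C \<in> \<I>" "card C = matroid_rank \<I>" and acc: "accurate A \<tau> w"
    and gain: "best_gain \<I> A w \<le> \<gamma>" and pos: "0 \<le> \<gamma>" "0 \<le> \<tau>" and mean: "1 / 2 \<le> noise_mean"
  shows "local_ratio l * (f C - 2 * real (card A) * (\<gamma> + 2 * \<tau>)) \<le> f A"
proof -
  have AN: "A \<subseteq> N" and CN: "C \<subseteq> N" using matroidD(2)[OF mat] A C by auto
  obtain \<pi> where \<pi>: "bij_betw \<pi> A C"
    "\<And>b. b \<in> A \<Longrightarrow> insert (\<pi> b) (A - {b}) \<in> \<I>" "\<And>b. b \<in> A \<Longrightarrow> \<pi> b \<in> A \<Longrightarrow> \<pi> b = b"
    using matroid_exchange_bijection[OF mat A C] by blast
  have step: "swap_weight l f A (\<pi> b) - swap_weight l f A b \<le> 2 * (\<gamma> + 2 * \<tau>)" if b: "b \<in> A" for b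
  proof -
    define d where "d = swap_weight l f A (\<pi> b) - swap_weight l f A b"
    have "(b, \<pi> b) \<in> swaps \<I> A" using \<pi> b by (auto simp: swaps_def)
    then have "swap_gain w (b, \<pi> b) \<le> best_gain \<I> A w"
      unfolding best_gain_def using finite_matroid_swaps[OF mat A(1)] by (intro Max_ge) auto
    then have "w (\<pi> b) - w b \<le> \<gamma>" using gain by (simp add: swap_gain_def)
    moreover have "\<pi> b \<in> N" "b \<in> N" using \<pi>(1) b AN CN by (auto simp: bij_betw_def)
    ultimately have up: "noise_mean * d \<le> \<gamma> + 2 * \<tau>"
      using swap_accurate[OF acc, of b "\<pi> b"] by (simp add: d_def)
    show ?thesis
    proof (cases "0 \<le> d")
      case True
      then have "1 / 2 * d \<le> noise_mean * d" using mean by (intro mult_right_mono) auto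
      then show ?thesis using up by (simp add: d_def)
    qed (use pos in \<open>simp add: d_def\<close>)
  qed
  have "f C - f A / local_ratio l \<le> (\<Sum>b\<in>A. swap_weight l f A (\<pi> b) - swap_weight l f A b)"
    by (rule local_gain_sum[OF AN CN l \<pi>(1)])
  also have "\<dots> \<le> (\<Sum>b\<in>A. 2 * (\<gamma> + 2 * \<tau>))" using step by (intro sum_mono) auto
  finally have "f C - f A / local_ratio l \<le> 2 * real (card A) * (\<gamma> + 2 * \<tau>)" by (simp add: mult_ac)
  then have "f C - 2 * real (card A) * (\<gamma> + 2 * \<tau>) \<le> f A / local_ratio l" by linarith
  then show ?thesis using local_ratio_pos[OF l] by (simp only: pos_le_divide_eq mult.commute)
qed

text \<open>An estimated gain exceeds the scaled true gain by at most 2 \<tau>, one \<tau> for each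
  endpoint. The upper bound \<mu> on the scale turns what remains into a guaranteed rise of the
  potential.\<close>

lemma local_search_step:
  fixes w :: "'a \<Rightarrow> real"
  assumes mat: "matroid N \<I>" and A: "A \<in> \<I>" "card A = matroid_rank \<I>" "A \<noteq> {}"
  defines "A1 \<equiv> swap_along A (best_swaps \<I> A w)"
  shows "A1 \<in> \<I>" "card A1 = matroid_rank \<I>" "A1 \<noteq> {}"
    and "\<lbrakk>accurate A \<tau> w; \<gamma> < best_gain \<I> A w; 0 \<le> \<gamma>; 2 * \<tau> \<le> \<gamma>; 0 < noise_mean; noise_mean \<le> \<mu>\<rbrakk>
      \<Longrightarrow> potential l f A + (\<gamma> - 2 * \<tau>) / \<mu> \<le> potential l f A1"
proof -
  have fin: "finite (swaps \<I> A)" by (rule finite_matroid_swaps[OF mat A(1)])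
  have ne: "swaps \<I> A \<noteq> {}" using swaps_refl[OF A(1)] A(3) by auto
  have sub: "best_swaps \<I> A w \<subseteq> swaps \<I> A" by (auto simp: best_swaps_def)
  note sw = swap_along_mem[OF best_swaps_nonempty[OF fin ne] sub]
  show "A1 \<in> \<I>" "A1 \<noteq> {}" using sw unfolding A1_def by auto
  obtain b c where bc: "(b, c) \<in> best_swaps \<I> A w" "A1 = insert c (A - {b})"
    using sw(1) unfolding A1_def by blast
  then have b: "b \<in> A" and c: "c \<in> A \<longrightarrow> c = b" using sub by (auto simp: swaps_def)
  have AN: "A \<subseteq> N" using matroidD(2)[OF mat A(1)] .
  have cN: "c \<in> N" using matroidD(2)[OF mat \<open>A1 \<in> \<I>\<close>] bc by auto
  have finA: "finite A" using matroidD(6)[OF mat A(1)] .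
  show "card A1 = matroid_rank \<I>"
  proof (cases "c = b")
    case True
    then show ?thesis using bc b A by (simp add: insert_absorb)
  next
    case False
    then have "c \<notin> A - {b}" using c by auto
    then have "card A1 = Suc (card (A - {b}))" using bc(2) finA by simp
    then show ?thesis using card_Suc_Diff1[OF finA b] A(2) by simp
  qed
  assume acc: "accurate A \<tau> w" and gain: "\<gamma> < best_gain \<I> A w" and pos: "0 \<le> \<gamma>" "2 * \<tau> \<le> \<gamma>"
    and mean: "0 < noise_mean" "noise_mean \<le> \<mu>"
  have "best_gain \<I> A w \<le> swap_gain w (b, c)"
    unfolding best_gain_def using fin ne bc(1) by (subst Max_le_iff) (auto simp: best_swaps_def)
  then have g: "\<gamma> < w c - w b" using gain by (simp add: swap_gain_def)
  \<comment> \<open>Inside A only the trivial swap is admissible, and its gain 0 does not exceed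
    \<gamma>.\<close>
  then have "c \<notin> A" using c pos by auto
  define d where "d = swap_weight l f A c - swap_weight l f A b"
  have "\<gamma> - 2 * \<tau> \<le> noise_mean * d"
    using swap_accurate[OF acc, of b c] g b AN cN by (auto simp: d_def abs_le_iff)
  then have "(\<gamma> - 2 * \<tau>) / noise_mean \<le> d" using mean by (simp add: field_simps)
  moreover have "(\<gamma> - 2 * \<tau>) / \<mu> \<le> (\<gamma> - 2 * \<tau>) / noise_mean"
    using mean pos by (intro divide_left_mono) auto
  moreover have "d \<le> potential l f A1 - potential l f A"
    unfolding d_def bc(2) by (rule potential_swap[OF AN b cN \<open>c \<notin> A\<close>])
  ultimately show "potential l f A + (\<gamma> - 2 * \<tau>) / \<mu> \<le> potential l f A1" by simp
qed

text \<open>Here t counts the remaining rounds. Invariant: either the recorded gain is at most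
  \<gamma>, and then the recorded base is good enough, or each of the K - t completed rounds raised
  the potential by a fixed amount. After K rounds the second case would exceed the bound on the
  potential. Each round loses at most q in probability.\<close>

lemma local_search_success:
  fixes val :: "'a set \<Rightarrow> real"
  assumes mat: "matroid N \<I>" and rank: "0 < matroid_rank \<I>"
    and C: "C \<in> \<I>" "card C = matroid_rank \<I>" and opt: "\<And>A. A \<in> \<I> \<Longrightarrow> f A \<le> M"
    and acc: "\<And>A. A \<in> \<I> \<Longrightarrow> card A = matroid_rank \<I> \<Longrightarrow>
      measure_pmf.prob (samples l m N A) {R. \<not> accurate A \<tau> (estimate N m val R)} \<le> q"
    and pos: "0 \<le> \<gamma>" "0 \<le> \<tau>" "2 * \<tau> \<le> \<gamma>" and mean: "1 / 2 \<le> noise_mean" "noise_mean \<le> \<mu>"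
    and iters: "M / step_size l < real K * ((\<gamma> - 2 * \<tau>) / \<mu>)"
    and b_def: "b = local_ratio l * (f C - 2 * real (matroid_rank \<I>) * (\<gamma> + 2 * \<tau>))"
  shows "\<lbrakk>t \<le> K; A \<in> \<I>; card A = matroid_rank \<I>; A' \<in> \<I>; g \<le> ereal \<gamma> \<longrightarrow> b \<le> f A';
      g \<le> ereal \<gamma> \<or> real (K - t) * ((\<gamma> - 2 * \<tau>) / \<mu>) \<le> potential l f A\<rbrakk>
    \<Longrightarrow> 1 - real t * q \<le> measure_pmf.prob (run (local_search N l m \<I> t A A' g) val mem) {(S, n). S \<in> \<I> \<and> b \<le> f S}"
proof (induction t arbitrary: A A' g)
  case 0
  have "f A \<le> M" "A \<subseteq> N" using opt 0 matroidD(2)[OF mat] by auto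
  then have "potential l f A \<le> M / step_size l"
    using potential_bounds(2)[of A l] l step_size_pos[of l] by (smt (verit) divide_right_mono)
  then have "g \<le> ereal \<gamma>" using 0 iters by auto
  then show ?case using 0 by simp
next
  case (Suc t)
  let ?p = "samples l m N A" and ?E = "{(S, n). S \<in> \<I> \<and> b \<le> f S}"
  define w where "w = estimate N m val"
  define F where "F = (\<lambda>R. map_pmf (apsnd ((+) (2 * card N * m))) (run
     (local_search N l m \<I> t (swap_along A (best_swaps \<I> A (w R)))
       (if ereal (best_gain \<I> A (w R)) < g then A else A')
       (if ereal (best_gain \<I> A (w R)) < g then ereal (best_gain \<I> A (w R)) else g)) val mem))"
  have AN: "A \<subseteq> N" using Suc.prems matroidD(2)[OF mat] by auto
  have ne: "A \<noteq> {}" using Suc.prems(3) rank by auto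
  have fin: "finite (set_pmf ?p)" by (rule finite_set_samples[OF finite_N AN l])
  have good: "1 - real t * q \<le> measure_pmf.prob (F R) ?E" if R: "accurate A \<tau> (w R)" for R
  proof -
    define A1 where "A1 = swap_along A (best_swaps \<I> A (w R))"
    define \<gamma>1 where "\<gamma>1 = best_gain \<I> A (w R)"
    define g1 where "g1 = (if ereal \<gamma>1 < g then ereal \<gamma>1 else g)"
    define A2 where "A2 = (if ereal \<gamma>1 < g then A else A')"
    note st = local_search_step[OF mat Suc.prems(2,3) ne, where w = "w R", folded A1_def]
    have "(apsnd ((+) (2 * card N * m)) :: 'a set \<times> nat \<Rightarrow> _) -` ?E = ?E" by auto
    then have "measure_pmf.prob (F R) ?E
        = measure_pmf.prob (run (local_search N l m \<I> t A1 A2 g1) val mem) ?E"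
      unfolding F_def A1_def A2_def g1_def \<gamma>1_def by simp
    moreover have "1 - real t * q \<le> measure_pmf.prob (run (local_search N l m \<I> t A1 A2 g1) val mem) ?E"
    proof (rule Suc.IH)
      show "t \<le> K" "A1 \<in> \<I>" "card A1 = matroid_rank \<I>" "A2 \<in> \<I>"
        using Suc.prems st by (auto simp: A2_def)
      have near: "b \<le> f A" if "\<gamma>1 \<le> \<gamma>"
        using small_gain_imp_near_optimal[OF mat Suc.prems(2,3) C R, of \<gamma>] that pos mean
        unfolding b_def \<gamma>1_def Suc.prems(3) by simp
      show "g1 \<le> ereal \<gamma> \<longrightarrow> b \<le> f A2"
        using near Suc.prems(5) by (auto simp: g1_def A2_def)
      show "g1 \<le> ereal \<gamma> \<or> real (K - t) * ((\<gamma> - 2 * \<tau>) / \<mu>) \<le> potential l f A1"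
      proof (cases "g1 \<le> ereal \<gamma>")
        case False
        moreover have "g1 \<le> ereal \<gamma>1" "g1 \<le> g" by (auto simp: g1_def)
        ultimately have "ereal \<gamma> < ereal \<gamma>1" "\<not> g \<le> ereal \<gamma>"
          by (metis not_le order_less_le_trans)+
        then have "\<gamma> < \<gamma>1" and pot: "real (K - Suc t) * ((\<gamma> - 2 * \<tau>) / \<mu>) \<le> potential l f A"
          using Suc.prems(6) by auto
        have "potential l f A + (\<gamma> - 2 * \<tau>) / \<mu> \<le> potential l f A1"
          using st(4)[OF R] \<open>\<gamma> < \<gamma>1\<close> pos mean unfolding \<gamma>1_def by simp
        moreover have "real (K - t) = real (K - Suc t) + 1" using Suc.prems(1) by linarith
        then have "real (K - t) * ((\<gamma> - 2 * \<tau>) / \<mu>) = real (K - Suc t) * ((\<gamma> - 2 * \<tau>) / \<mu>) + (\<gamma> - 2 * \<tau>) / \<mu>"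
          by (simp only: distrib_right mult_1)
        ultimately show ?thesis using pot by linarith
      qed simp
    qed
    ultimately show ?thesis by simp
  qed
  define G where "G = {R. accurate A \<tau> (w R)}"
  have "- G = {R. \<not> accurate A \<tau> (estimate N m val R)}" by (auto simp: G_def w_def)
  then have G: "1 - q \<le> measure_pmf.prob ?p G"
    using acc[OF Suc.prems(2,3)] measure_pmf.prob_compl[of G ?p] by (simp add: Compl_eq_Diff_UNIV)
  have q: "0 \<le> q" using acc[OF Suc.prems(2,3)] measure_nonneg order_trans by blast
  have PG: "measure_pmf.prob ?p G = (\<Sum>R\<in>set_pmf ?p. pmf ?p R * indicator G R)"
  proof -
    have "measure_pmf.prob ?p G = measure_pmf.expectation ?p (indicator G)" by simp
    also have "\<dots> = (\<Sum>R\<in>set_pmf ?p. indicator G R * pmf ?p R)"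
      using fin by (intro integral_measure_pmf_real) auto
    finally show ?thesis by (simp add: mult.commute)
  qed
  \<comment> \<open>The cross term t q s is nonnegative, so the losses of the rounds simply add
    up.\<close>
  have "1 - real (Suc t) * q \<le> (1 - real t * q) * measure_pmf.prob ?p G"
  proof -
    define s where "s = 1 - measure_pmf.prob ?p G"
    have "0 \<le> s" "s \<le> q" using G by (auto simp: s_def)
    then have "0 \<le> real t * q * s" using q by simp
    moreover have "(1 - real t * q) * (1 - s) = 1 - real t * q - s + real t * q * s" by (simp add: algebra_simps)
    ultimately show ?thesis using \<open>s \<le> q\<close> by (simp add: s_def algebra_simps)
  qed
  also have "\<dots> = (\<Sum>R\<in>set_pmf ?p. pmf ?p R * (indicator G R * (1 - real t * q)))"
    unfolding PG by (simp add: sum_distrib_left mult_ac)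
  also have "\<dots> \<le> (\<Sum>R\<in>set_pmf ?p. pmf ?p R * measure_pmf.prob (F R) ?E)"
    using good by (intro sum_mono mult_left_mono) (auto simp: G_def indicator_def)
  also have "\<dots> = measure_pmf.prob (run (local_search N l m \<I> (Suc t) A A' g) val mem) ?E"
    unfolding run_local_search_Suc[OF finite_N] Let_def measure_bind_pmf_finite[OF fin] F_def w_def ..
  finally show ?case .
qed

end

section \<open>Guarantee of the complete algorithm\<close>

lemma nat_ceiling_inverse_bounds:
  assumes "0 < (\<epsilon>::real)" "\<epsilon> < 1"
  shows "1 / \<epsilon> \<le> real (nat \<lceil>1 / \<epsilon>\<rceil>)" "real (nat \<lceil>1 / \<epsilon>\<rceil>) \<le> 2 / \<epsilon>"
proof -
  show "1 / \<epsilon> \<le> real (nat \<lceil>1 / \<epsilon>\<rceil>)" by (rule real_nat_ceiling_ge)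
  have "1 \<le> 1 / \<epsilon>" using assms by simp
  then have "real (nat \<lceil>1 / \<epsilon>\<rceil>) = of_int \<lceil>1 / \<epsilon>\<rceil>" by (intro of_nat_nat) linarith
  also have "\<dots> \<le> 1 / \<epsilon> + 1" by (rule of_int_ceiling_le_add_one)
  also have "\<dots> \<le> 1 / \<epsilon> + 1 / \<epsilon>" using \<open>1 \<le> 1 / \<epsilon>\<close> by simp
  finally show "real (nat \<lceil>1 / \<epsilon>\<rceil>) \<le> 2 / \<epsilon>" by simp
qed

text \<open>A maximiser is extended to a base, where monotonicity keeps it optimal. Applied to the
  zero function it yields the start base of the search.\<close>

lemma matroid_maximum_basis:
  assumes mat: "matroid N \<I>" and mono: "mono_on (Pow N) f"
  obtains C where "C \<in> \<I>" "card C = matroid_rank \<I>" "f C = Max (f ` \<I>)"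
proof -
  have ne: "\<I> \<noteq> {}" and fin: "finite \<I>" using matroidD(3,7)[OF mat] by auto
  obtain C0 where C0: "C0 \<in> \<I>" "f C0 = Max (f ` \<I>)"
    using Max_in[of "f ` \<I>"] fin ne by (metis (no_types, lifting) finite_imageI image_iff image_is_empty)
  obtain B where B: "B \<in> \<I>" "card B = matroid_rank \<I>"
    using Max_in[of "card ` \<I>"] fin ne unfolding matroid_rank_def
    by (metis (no_types, lifting) finite_imageI image_iff image_is_empty)
  obtain C where C: "C0 \<subseteq> C" "C \<in> \<I>" "card C = card B"
    using matroid_augment[OF mat C0(1) B(1)] matroid_card_le_rank[OF mat C0(1)] B(2) by metis
  have "f C0 \<le> f C" using C matroidD(2)[OF mat C(2)] mono by (auto simp: mono_on_def)
  moreover have "f C \<le> Max (f ` \<I>)" using C fin by (intro Max_ge) auto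
  ultimately show ?thesis using that C C0 B by auto
qed

lemma run_noisy_local_search:
  assumes mat: "matroid N \<I>" and "\<epsilon> < 1"
  obtains A where "A \<in> \<I>" "card A = matroid_rank \<I>"
    "\<And>val. run (noisy_local_search N \<epsilon>) val (\<lambda>S. S \<in> \<I>) = run (local_search N (nat \<lceil>1 / \<epsilon>\<rceil>) (card N ^ 3) \<I>
        (card N ^ 2 * nat \<lceil>1 / \<epsilon>\<rceil>) A A \<infinity>) val (\<lambda>S. S \<in> \<I>)"
proof -
  have "{S \<in> set (elements (Pow N)). S \<in> \<I>} = \<I>"
    using elements[of "Pow N"] matroidD(1,2)[OF mat] by auto
  moreover define A where "A = (SOME A. A \<in> \<I> \<and> card A = matroid_rank \<I>)"
  have "\<exists>A. A \<in> \<I> \<and> card A = matroid_rank \<I>"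
    using matroid_maximum_basis[OF mat, of "\<lambda>_. 0"] by (auto simp: mono_on_def)
  then have "A \<in> \<I> \<and> card A = matroid_rank \<I>" unfolding A_def by (rule someI_ex)
  ultimately show ?thesis
    using that[of A] assms(2) by (simp add: noisy_local_search_def run_learn_members Let_def A_def)
qed

lemma queries_noisy_local_search:
  assumes "matroid N \<I>" "0 < \<epsilon>"
  shows "uses_at_most_queries (noisy_local_search N \<epsilon>) N \<I> f D (4 * real (card N) ^ 6 / \<epsilon>)"
proof (cases "1 \<le> \<epsilon>")
  case True
  then show ?thesis by (simp add: uses_at_most_queries_def noisy_local_search_def)
next
  case False
  obtain A where run: "\<And>val. run (noisy_local_search N \<epsilon>) val (\<lambda>S. S \<in> \<I>) = run (local_search N (nat \<lceil>1 / \<epsilon>\<rceil>) (card N ^ 3) \<I>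
        (card N ^ 2 * nat \<lceil>1 / \<epsilon>\<rceil>) A A \<infinity>) val (\<lambda>S. S \<in> \<I>)"
    using run_noisy_local_search[OF assms(1), of \<epsilon>] False by auto
  have c: "real (nat \<lceil>1 / \<epsilon>\<rceil>) \<le> 2 / \<epsilon>" using nat_ceiling_inverse_bounds(2)[of \<epsilon>] False assms(2) by simp
  have "real q \<le> 4 * real (card N) ^ 6 / \<epsilon>"
    if "(S, q) \<in> set_pmf (run (noisy_local_search N \<epsilon>) (noisy_oracle N f \<xi>) (\<lambda>S. S \<in> \<I>))" for S q \<xi>
  proof -
    have "q = 2 * card N * card N ^ 3 * (card N ^ 2 * nat \<lceil>1 / \<epsilon>\<rceil>)"
      using query_count_local_search[OF matroidD(1)[OF assms(1)] that[unfolded run]] .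
    then have "real q = 2 * real (card N) ^ 6 * real (nat \<lceil>1 / \<epsilon>\<rceil>)"
      by (simp add: power_numeral_reduce)
    also have "\<dots> \<le> 2 * real (card N) ^ 6 * (2 / \<epsilon>)" using c by (intro mult_left_mono) auto
    finally show ?thesis by simp
  qed
  then show ?thesis unfolding uses_at_most_queries_def by blast
qed

context noisy_instance
begin

text \<open>The noise is atypical with probability at most p2; for each typical noise sample the
  draws fail with probability at most p1. All numerical requirements are left as hypotheses, so that
  the choice of parameters is separate.\<close>

lemma success_prob_ge:
  assumes mat: "matroid N \<I>" and sing: "\<And>e. e \<in> N \<Longrightarrow> {e} \<in> \<I>" and rank: "0 < matroid_rank \<I>"
    and k: "k = matroid_rank \<I> - 1" and \<epsilon>: "\<epsilon> < 1" "l = nat \<lceil>1 / \<epsilon>\<rceil>"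
    and M_ge: "Max (f ` \<I>) \<le> M"
    and pos: "0 < \<delta>" "0 < \<theta>" "0 < t" "2 * (t + 2 * \<delta>) \<le> \<gamma>"
    and mean: "1 / 2 \<le> noise_mean" "noise_mean \<le> \<mu>"
    and iters: "M / step_size l < real (card N ^ 2 * l) * ((\<gamma> - 2 * (t + 2 * \<delta>)) / \<mu>)"
    and fail: "real (card N ^ 2 * l) * (real (card N) * (2 * real (card N ^ 3) * (measure D {T<..} + \<theta>)
        + 2 * exp (- real (card N ^ 3) * t\<^sup>2 / (8 * T\<^sup>2 * M\<^sup>2)))) \<le> p1" "p1 \<le> 1"
    and bad: "2 ^ card N * card N * (4 * exp (- \<delta>\<^sup>2 / (2 * T\<^sup>2 * M\<^sup>2 * (1 - step_size l) ^ k))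
        + 4 * exp (- 2 * \<theta>\<^sup>2 / (1 - step_size l) ^ k)) \<le> p2"
    and \<beta>: "\<And>S. S \<in> \<I> \<Longrightarrow> local_ratio l * (Max (f ` \<I>) - 2 * real (matroid_rank \<I>) * (\<gamma> + 2 * (t + 2 * \<delta>))) \<le> f S
        \<Longrightarrow> \<beta> * Max (f ` \<I>) \<le> f S"
  shows "1 - p1 - p2 \<le> success_prob (noisy_local_search N \<epsilon>) N \<I> f D \<beta>"
proof -
  let ?P = "noise_space N D"
  interpret P: prob_space ?P by (rule prob_space_noise)
  define m where "m = card N ^ 3"
  define K where "K = card N ^ 2 * l"
  define \<tau> where "\<tau> = t + 2 * \<delta>"
  define q where "q = real (card N) * (2 * real m * (measure D {T<..} + \<theta>) + 2 * exp (- real m * t\<^sup>2 / (8 * T\<^sup>2 * M\<^sup>2)))"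
  have q: "0 \<le> q" unfolding q_def using pos by (intro mult_nonneg_nonneg add_nonneg_nonneg) auto
  obtain C where C: "C \<in> \<I>" "card C = matroid_rank \<I>" "f C = Max (f ` \<I>)"
    by (rule matroid_maximum_basis[OF mat f_mono])
  define b where "b = local_ratio l * (f C - 2 * real (matroid_rank \<I>) * (\<gamma> + 2 * \<tau>))"
  have opt: "f A \<le> M" if "A \<in> \<I>" for A
    by (rule order_trans[OF Max_ge[OF finite_imageI[OF matroidD(7)[OF mat]] imageI[OF that]] M_ge])
  have IN: "S \<subseteq> N" if "S \<in> \<I>" for S using matroidD(2)[OF mat that] .
  have "C \<noteq> {}" using C rank by auto
  then have "0 < card N" using IN[OF C(1)] finite_N by (auto simp: card_gt_0_iff)
  then have m: "0 < m" by (simp add: m_def)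
  obtain A where A: "A \<in> \<I>" "card A = matroid_rank \<I>"
    "\<And>val. run (noisy_local_search N \<epsilon>) val (\<lambda>S. S \<in> \<I>) = run (local_search N l m \<I> K A A \<infinity>) val (\<lambda>S. S \<in> \<I>)"
    by (rule run_noisy_local_search[OF mat \<epsilon>(1), folded \<epsilon>(2), folded m_def K_def], rule that)
  have "A \<noteq> {}" using A rank by auto
  define \<phi> where "\<phi> = (\<lambda>\<xi>. measure_pmf.prob (run (local_search N l m \<I> K A A \<infinity>) (noisy_oracle N f \<xi>) (\<lambda>S. S \<in> \<I>))
      {(S, q). S \<in> approx_solutions \<I> f \<beta>})"
  have \<phi>_meas: "\<phi> \<in> borel_measurable ?P"
    unfolding \<phi>_def using IN A(1) \<open>A \<noteq> {}\<close> by (intro local_search_measurable) auto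
  have \<phi>_int: "integrable ?P \<phi>"
    using \<phi>_meas by (intro P.integrable_const_bound[of _ 1]) (auto simp: \<phi>_def)
  define G where "G = {\<xi> \<in> space ?P. typical_noise \<delta> \<theta> \<xi>}"
  have G: "G \<in> sets ?P" "1 - p2 \<le> measure ?P G"
    using typical_noise_sets[of \<delta> \<theta>] prob_typical_noise[OF pos(1,2)] bad by (auto simp: G_def)
  have site: "sample_site (B - {e}) e" if B: "B \<in> \<I>" "card B = matroid_rank \<I>" and e: "e \<in> N" for B e
  proof -
    have "f (insert e B) - f B \<le> f (insert e {}) - f {}"
      using IN[OF B(1)] e by (intro marginal_antimono) auto
    then have "f (insert e B) \<le> 2 * M" using opt[OF B(1)] opt[OF sing[OF e]] f_empty by simp
    moreover have "f (insert e (B - {e})) \<le> f (insert e B)" using IN[OF B(1)] e by (intro f_monoD) auto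
    moreover have "k \<le> card (B - {e})" using B(2) k card_Diff1_le[of B e] diff_card_le_card_Diff[of "{e}" B] by simp
    ultimately show ?thesis using IN[OF B(1)] e unfolding sample_site_def by auto
  qed
  have typ_success: "1 - p1 \<le> \<phi> \<xi>" if \<xi>: "\<xi> \<in> G" for \<xi>
  proof -
    have "1 - real K * q \<le> measure_pmf.prob (run (local_search N l m \<I> K A A \<infinity>) (noisy_oracle N f \<xi>) (\<lambda>S. S \<in> \<I>))
       {(S, n). S \<in> \<I> \<and> b \<le> f S}"
    proof (rule local_search_success[where \<tau> = \<tau> and \<gamma> = \<gamma> and K = K and \<mu> = \<mu> and C = C])
      fix B assume B: "B \<in> \<I>" "card B = matroid_rank \<I>"
      have "{R. \<not> accurate B \<tau> (estimate N m (noisy_oracle N f \<xi>) R)}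
        = {R. \<exists>e\<in>N. t + 2 * \<delta> < \<bar>estimate N m (noisy_oracle N f \<xi>) R e - noise_mean * swap_weight l f B e\<bar>}"
        by (auto simp: accurate_def \<tau>_def not_le)
      then show "measure_pmf.prob (samples l m N B) {R. \<not> accurate B \<tau> (estimate N m (noisy_oracle N f \<xi>) R)} \<le> q"
        unfolding q_def using estimates_accurate[OF IN[OF B(1)] site[OF B] m _ pos(3)] \<xi> by (simp add: G_def)
    next
      show "\<infinity> \<le> ereal \<gamma> \<or> real (K - K) * ((\<gamma> - 2 * \<tau>) / \<mu>) \<le> potential l f A"
        using potential_bounds(1)[OF IN[OF A(1)] l] by simp
    qed (use mat rank C opt pos mean iters A b_def in \<open>auto simp: \<tau>_def K_def\<close>)
    also have "\<dots> \<le> \<phi> \<xi>"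
      unfolding \<phi>_def
    proof (rule measure_pmf.finite_measure_mono)
      show "{(S, n). S \<in> \<I> \<and> b \<le> f S} \<subseteq> {(S, q). S \<in> approx_solutions \<I> f \<beta>}"
        using \<beta> unfolding b_def C(3) \<tau>_def by (auto simp: approx_solutions_def)
    qed simp
    finally show ?thesis using fail(1) unfolding K_def[symmetric] m_def[symmetric] q_def[symmetric] by linarith
  qed
  have "1 - p1 - p2 \<le> (1 - p1) * measure ?P G"
  \<comment> \<open>A negative p2 would make the probability of \<open>G\<close> exceed 1.\<close>
  proof (cases "0 \<le> p2")
    case True
    have "0 \<le> p1" using fail(1) q unfolding K_def[symmetric] m_def[symmetric] q_def[symmetric]
      by (meson mult_nonneg_nonneg of_nat_0_le_iff order_trans)
    have "(1 - p1) * (1 - p2) \<le> (1 - p1) * measure ?P G" using G fail(2) by (intro mult_left_mono) auto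
    moreover have "1 - p1 - p2 \<le> (1 - p1) * (1 - p2)" using \<open>0 \<le> p1\<close> True by (simp add: algebra_simps)
    ultimately show ?thesis by simp
  next
    case False
    then have False using G(2) P.prob_le_1[of G] by linarith
    then show ?thesis ..
  qed
  also have "\<dots> = (\<integral>\<xi>. (1 - p1) * indicator G \<xi> \<partial>?P)"
    using G by simp
  also have "\<dots> \<le> (\<integral>\<xi>. \<phi> \<xi> \<partial>?P)"
  proof (rule integral_mono)
    show "integrable ?P (\<lambda>\<xi>. (1 - p1) * indicator G \<xi>)" using G by (auto intro!: integrable_real_indicator P.emeasure_finite simp: less_top[symmetric])
    show "(1 - p1) * indicator G \<xi> \<le> \<phi> \<xi>" for \<xi>
      using typ_success[of \<xi>] by (cases "\<xi> \<in> G") (auto simp: \<phi>_def)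
  qed (rule \<phi>_int)
  finally show ?thesis unfolding success_prob_def A(3) \<phi>_def .
qed

end

text \<open>With T = n^(1/8) one has n = T^8, \<epsilon> >= T^(-2) and n^3 = T^24, so every
  requirement compares functions of T or n. The last four conjuncts provide enough rounds, small
  sampling weights, the union bound over sites, and the one over draws. The exponent 200 must beat
  \<theta>^2 = T^(-160) and still leave n^2 = T^16. The number 2048 is both 8 * 16^2 and 2 * 32^2,
  from the divisors in t and \<delta>.\<close>

definition parameters_large :: "real measure \<Rightarrow> real \<Rightarrow> nat \<Rightarrow> bool" where
  "parameters_large D \<kappa> n \<longleftrightarrow> (let T = real n powr (1 / 8) in
     1 \<le> n \<and>
     1 / 2 \<le> (\<integral>x. clip T x \<partial>D) \<and>
     measure D {T<..} \<le> 1 / T ^ 80 \<and>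
     4 * (\<integral>x. \<bar>x\<bar> \<partial>D) < T ^ 6 \<and>
     2048 * T ^ 200 \<le> exp ((\<kappa> * real n powr (1 / 3) - 1) / (3 * T ^ 2)) \<and>
     8 * 2 ^ n * real n * exp (- (real n ^ 2)) \<le> 1 / real n ^ 2 \<and>
     2 * T ^ 18 * (T ^ 8 * (2 * T ^ 24 * (2 / T ^ 80) + 2 * exp (- (T ^ 2 / 2048)))) \<le> 1 / T ^ 16)"

lemma eventually_parameters_large:
  assumes "noise_distribution D" "0 < \<kappa>"
  shows "eventually (parameters_large D \<kappa>) sequentially"
proof -
  have lim: "filterlim (\<lambda>n. real n powr (1 / 8)) at_top sequentially" by real_asymp
  have 1: "eventually (\<lambda>n. 1 / 2 \<le> (\<integral>x. clip (real n powr (1 / 8)) x \<partial>D)) sequentially"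
    by (rule eventually_compose_filterlim[OF clip_mean_bounds(1)[OF assms(1)] lim])
  have 2: "eventually (\<lambda>n. measure D {real n powr (1 / 8)<..} \<le> 1 / (real n powr (1 / 8)) ^ 80) sequentially"
    by (rule eventually_compose_filterlim[OF noise_tail_decay[OF assms(1)] lim])
  have 3: "eventually (\<lambda>n. 4 * \<mu> < (real n powr (1 / 8)) ^ 6) sequentially" for \<mu> :: real
    by real_asymp
  have 4: "eventually (\<lambda>n. 2048 * (real n powr (1 / 8)) ^ 200
      \<le> exp ((\<kappa> * real n powr (1 / 3) - 1) / (3 * (real n powr (1 / 8)) ^ 2))) sequentially"
    using assms(2) by real_asymp
  have 5: "eventually (\<lambda>n. 8 * 2 ^ n * real n * exp (- (real n ^ 2)) \<le> 1 / real n ^ 2) sequentially"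
    by real_asymp
  have 6: "eventually (\<lambda>n. 2 * (real n powr (1 / 8)) ^ 18 * ((real n powr (1 / 8)) ^ 8 *
      (2 * (real n powr (1 / 8)) ^ 24 * (2 / (real n powr (1 / 8)) ^ 80)
       + 2 * exp (- ((real n powr (1 / 8)) ^ 2 / 2048)))) \<le> 1 / (real n powr (1 / 8)) ^ 16) sequentially"
    by real_asymp
  show ?thesis
    using 1 2 3[of "\<integral>x. \<bar>x\<bar> \<partial>D"] 4 5 6 eventually_ge_at_top[of 1]
    unfolding parameters_large_def Let_def by eventually_elim blast
qed

text \<open>Of the allowed loss 5 \<epsilon>, at most 2 \<epsilon> is spent on discretisation,
  because h <= \<epsilon>, and 5/2 \<epsilon> on undetected gains.\<close>

lemma noisy_local_search_correct:
  assumes noise: "noise_distribution D" and \<kappa>: "0 < \<kappa>" and large: "parameters_large D \<kappa> (card N)"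
    and \<epsilon>: "0 < \<epsilon>" "1 / \<epsilon> ^ 4 \<le> real (card N)"
    and mat: "matroid N \<I>" and sing: "\<forall>e\<in>N. {e} \<in> \<I>"
    and r: "\<kappa> * real (card N) powr (1 / 3) \<le> real (matroid_rank \<I>)"
    and f: "\<forall>S\<subseteq>N. 0 \<le> f S" "f {} = 0" "mono_on (Pow N) f" "submodular_on N f"
    and \<beta>: "\<beta> \<le> 1 - 1 / exp 1 - 5 * \<epsilon>"
  shows "1 - 2 / real (card N) ^ 2 \<le> success_prob (noisy_local_search N \<epsilon>) N \<I> f D \<beta>"
proof -
  define OPT where "OPT = Max (f ` \<I>)"
  have finI: "finite \<I>" "{} \<in> \<I>" using matroidD(3,7)[OF mat] by auto
  have "f {} \<in> f ` \<I>" using finI(2) by (rule imageI)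
  then have "f {} \<le> OPT" unfolding OPT_def using finI(1) by (intro Max_ge) auto
  then have OPT: "0 \<le> OPT" using f(2) by simp
  show ?thesis
  proof (cases "1 \<le> \<epsilon>")
    case True
    have "\<beta> \<le> 0"
    proof -
      have "0 \<le> 1 / exp (1::real)" by simp
      then show ?thesis using True \<beta> by linarith
    qed
    then have "{} \<in> approx_solutions \<I> f \<beta>"
      using OPT f(2) finI(2) unfolding approx_solutions_def OPT_def[symmetric] by (simp add: mult_nonpos_nonneg)
    moreover have "prob_space (noise_space N D)"
      unfolding noise_space_def using noise by (intro prob_space_PiM) (auto simp: noise_distribution_def)
    ultimately have "success_prob (noisy_local_search N \<epsilon>) N \<I> f D \<beta> = 1"
      using True by (simp add: success_prob_def noisy_local_search_def prob_space.prob_space)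
    then show ?thesis by simp
  next
    case False
    define n where "n = card N"
    define T where "T = real n powr (1 / 8)"
    \<comment> \<open>The scale must be positive. If the optimum is 0, every independent set meets
      the target and any positive scale will do.\<close>
    define M where "M = (if OPT = 0 then 1 else OPT)"
    define l where "l = nat \<lceil>1 / \<epsilon>\<rceil>"
    define k where "k = matroid_rank \<I> - 1"
    define h where "h = step_size l"
    define \<theta> where "\<theta> = 1 / T ^ 80"
    define \<mu> where "\<mu> = (\<integral>x. \<bar>x\<bar> \<partial>D)"
    note lg = large[unfolded parameters_large_def Let_def, folded n_def, folded T_def, folded \<mu>_def]
    have n: "1 \<le> n" and mean: "1 / 2 \<le> (\<integral>x. clip T x \<partial>D)" and tail: "measure D {T<..} \<le> \<theta>"
      and L3: "4 * \<mu> < T ^ 6" and L4: "2048 * T ^ 200 \<le> exp ((\<kappa> * real n powr (1 / 3) - 1) / (3 * T ^ 2))"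
      and L5: "8 * 2 ^ n * real n * exp (- (real n ^ 2)) \<le> 1 / real n ^ 2"
      and L6: "2 * T ^ 18 * (T ^ 8 * (2 * T ^ 24 * (2 * \<theta>) + 2 * exp (- (T ^ 2 / 2048)))) \<le> 1 / T ^ 16"
      using lg by (simp_all add: \<theta>_def)
    have T1: "1 \<le> T" using n by (simp add: T_def ge_one_powr_ge_zero)
    have nT: "real n = T ^ 8" using n by (simp add: T_def powr_power)
    have \<theta>: "0 < \<theta>" using T1 by (simp add: \<theta>_def)
    have M: "0 < M" and OPT_M: "OPT \<le> M" using OPT by (auto simp: M_def)
    have l_bounds: "1 / \<epsilon> \<le> real l" "real l \<le> 2 / \<epsilon>"
      using nat_ceiling_inverse_bounds[of \<epsilon>] \<epsilon> False by (auto simp: l_def)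
    have \<epsilon>1: "\<epsilon> < 1" using False by simp
    have l0: "0 < l" using l_bounds(1) \<epsilon>(1) by (cases l) auto
    have \<epsilon>T: "1 / T ^ 2 \<le> \<epsilon>" "1 / T ^ 4 \<le> \<epsilon> ^ 2"
    proof -
      have "1 / T ^ 8 \<le> \<epsilon> ^ 4" using \<epsilon> nT T1 by (simp add: n_def field_simps)
      then have "(1 / T ^ 2) ^ 4 \<le> \<epsilon> ^ 4" by (simp add: power_divide flip: power_mult)
      then show 1: "1 / T ^ 2 \<le> \<epsilon>" using \<epsilon>(1) by (simp add: power_mono_iff T1)
      have "(1 / T ^ 2) ^ 2 \<le> \<epsilon> ^ 2" using 1 T1 by (intro power_mono) auto
      then show "1 / T ^ 4 \<le> \<epsilon> ^ 2" by (simp add: power_divide flip: power_mult)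
    qed
    have h: "0 < h" "\<epsilon> / 3 \<le> h" "h \<le> \<epsilon>" "h < 1"
    proof -
      show "0 < h" by (simp add: h_def step_size_pos)
      have "real l + 1 \<le> 3 / \<epsilon>" using l_bounds(2) \<epsilon> \<epsilon>1 by (simp add: field_simps)
      then have "1 / (3 / \<epsilon>) \<le> 1 / (real l + 1)" by (intro divide_left_mono) (use \<epsilon> in auto)
      then show "\<epsilon> / 3 \<le> h" by (simp add: h_def step_size_def)
      have "1 / (real l + 1) \<le> 1 / (1 / \<epsilon>)" using l_bounds(1) \<epsilon> by (intro divide_left_mono) auto
      then show "h \<le> \<epsilon>" by (simp add: h_def step_size_def)
      then show "h < 1" using \<epsilon>1 by simp
    qed
    interpret noisy_instance N f D T M l k
      using matroidD(1)[OF mat] f noise T1 M l0 by unfold_locales auto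
    have nm: "noise_mean = (\<integral>x. clip T x \<partial>D)" by (simp add: noise_mean_def)
    have \<mu>: "noise_mean \<le> \<mu>" "0 < \<mu>"
      using clip_mean_bounds(2)[OF noise, of T] T1 mean unfolding nm \<mu>_def by auto
    have "0 < \<kappa> * real n powr (1 / 3)" using \<kappa> n by simp
    then have rank: "0 < matroid_rank \<I>" using r unfolding n_def by linarith
    have "matroid_rank \<I> \<le> n"
    proof -
      obtain C where C: "C \<in> \<I>" "card C = matroid_rank \<I>" by (rule matroid_maximum_basis[OF mat f(3)])
      then show ?thesis unfolding n_def using matroidD(1,2)[OF mat] card_mono by metis
    qed
    then have rn: "real (matroid_rank \<I>) \<le> real n" by simp
    define \<sigma> where "\<sigma> = (1 - step_size l) ^ k"
    have \<sigma>: "0 < \<sigma>" "2048 * T ^ 200 \<le> 1 / \<sigma>"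
    proof -
      show "0 < \<sigma>" using h by (simp add: \<sigma>_def h_def)
      have "1 - h \<le> exp (- h)" using exp_ge_add_one_self[of "- h"] by simp
      then have "\<sigma> \<le> exp (- h) ^ k" unfolding \<sigma>_def h_def[symmetric] using h by (intro power_mono) auto
      also have "\<dots> = exp (- (real k * h))" by (simp flip: exp_of_nat_mult)
      finally have "exp (real k * h) \<le> 1 / \<sigma>" using \<open>0 < \<sigma>\<close> by (simp add: exp_minus field_simps)
      moreover have "(\<kappa> * real n powr (1 / 3) - 1) / (3 * T ^ 2) \<le> real k * h"
      proof -
        have "\<kappa> * real n powr (1 / 3) - 1 \<le> real k" using r rank unfolding n_def k_def by linarith
        then have "(\<kappa> * real n powr (1 / 3) - 1) / (3 * T ^ 2) \<le> real k / (3 * T ^ 2)"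
          using T1 by (intro divide_right_mono) auto
        also have "\<dots> = real k * (1 / T ^ 2 / 3)" by simp
        also have "\<dots> \<le> real k * h" using h \<epsilon>T by (intro mult_left_mono) auto
        finally show ?thesis .
      qed
      ultimately show "2048 * T ^ 200 \<le> 1 / \<sigma>" using L4 by (smt (verit) exp_le_cancel_iff)
    qed
    \<comment> \<open>\<gamma> = \<epsilon> M / n is affordable since at most n pairs are summed.
      With t = \<gamma>/16 and \<delta> = \<gamma>/32 the accuracy t + 2 \<delta> is \<gamma>/8, so
      3/4 of \<gamma> survives in every improving step.\<close>
    define t where "t = \<epsilon> * M / (16 * real n)"
    define \<delta> where "\<delta> = \<epsilon> * M / (32 * real n)"
    define \<gamma> where "\<gamma> = \<epsilon> * M / real n"
    have n0: "0 < real n" using n by simp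
    have \<tau>: "t + 2 * \<delta> = \<gamma> / 8" unfolding t_def \<delta>_def \<gamma>_def using n0 by (simp add: field_simps)
    have pos: "0 < t" "0 < \<delta>" "0 < \<gamma>" unfolding t_def \<delta>_def \<gamma>_def using \<epsilon> M n0 by auto
    have "1 - 1 / real n ^ 2 - 1 / real n ^ 2 \<le> success_prob (noisy_local_search N \<epsilon>) N \<I> f D \<beta>"
    proof (rule success_prob_ge[where \<delta> = \<delta> and \<theta> = \<theta> and t = t and \<gamma> = \<gamma> and \<mu> = \<mu>])
      \<comment> \<open>The potential is at most 3 M / \<epsilon> and a step gains 3/4 \<gamma> /
        \<mu>. What has to hold is n \<epsilon> > 4 \<mu>, and n \<epsilon> is at least T^6.\<close>
      show "M / step_size l < real (card N ^ 2 * l) * ((\<gamma> - 2 * (t + 2 * \<delta>)) / \<mu>)"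
      proof -
        have "M / step_size l \<le> M / (\<epsilon> / 3)" using h M \<epsilon> unfolding h_def[symmetric] by (intro divide_left_mono) auto
        also have "\<dots> = 3 * M * (1 / \<epsilon>)" by simp
        also have "\<dots> \<le> 3 * M * T ^ 2"
        proof -
          have "1 / \<epsilon> \<le> T ^ 2" using \<epsilon>T(1) \<epsilon> T1 by (simp add: field_simps)
          then show ?thesis using M by (intro mult_left_mono) auto
        qed
        also have "\<dots> < 3 / 4 * M * T ^ 2 * (T ^ 6 / \<mu>)"
        proof -
          have "4 < T ^ 6 / \<mu>" using L3 \<mu> by (simp add: field_simps)
          then have "3 / 4 * M * T ^ 2 * 4 < 3 / 4 * M * T ^ 2 * (T ^ 6 / \<mu>)"
            using M T1 by (intro mult_strict_left_mono) auto
          then show ?thesis by simp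
        qed
        also have "\<dots> = real n ^ 2 * (1 / \<epsilon>) * ((\<gamma> - 2 * (t + 2 * \<delta>)) / \<mu>)"
        proof -
          have "T ^ 2 * (T ^ 6 / \<mu>) = real n / \<mu>" by (simp add: nT flip: power_add)
          then have "3 / 4 * M * T ^ 2 * (T ^ 6 / \<mu>) = 3 / 4 * M * (real n / \<mu>)" by (simp only: mult.assoc)
          also have "\<dots> = real n ^ 2 * (1 / \<epsilon>) * (3 / 4 * (\<epsilon> * M / real n) / \<mu>)"
            using n0 \<epsilon>(1) by (simp add: power2_eq_square)
          also have "3 / 4 * (\<epsilon> * M / real n) = \<gamma> - 2 * (t + 2 * \<delta>)" unfolding \<tau> by (simp add: \<gamma>_def)
          finally show ?thesis .
        qed
        also have "\<dots> \<le> real n ^ 2 * real l * ((\<gamma> - 2 * (t + 2 * \<delta>)) / \<mu>)"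
          using l_bounds \<mu> pos unfolding \<tau> by (intro mult_right_mono mult_left_mono) auto
        finally show ?thesis by (simp add: n_def)
      qed
      show "real (card N ^ 2 * l) * (real (card N) * (2 * real (card N ^ 3) * (measure D {T<..} + \<theta>)
        + 2 * exp (- real (card N ^ 3) * t\<^sup>2 / (8 * T\<^sup>2 * M\<^sup>2)))) \<le> 1 / real n ^ 2"
      proof -
        have "T ^ 2 / 2048 \<le> real (n ^ 3) * t\<^sup>2 / (8 * T\<^sup>2 * M\<^sup>2)"
        proof -
          have "T ^ 2 / 2048 = T ^ 8 * (1 / T ^ 4) / (2048 * T\<^sup>2)"
            using T1 by (simp add: divide_simps flip: power_add)
          also have "\<dots> \<le> T ^ 8 * \<epsilon>\<^sup>2 / (2048 * T\<^sup>2)"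
            using \<epsilon>T T1 by (intro divide_right_mono mult_left_mono) auto
          also have "\<dots> = real (n ^ 3) * t\<^sup>2 / (8 * T\<^sup>2 * M\<^sup>2)"
            using n0 M unfolding t_def nT[symmetric]
            by (simp add: power_divide power_mult_distrib power2_eq_square power3_eq_cube field_simps)
          finally show ?thesis .
        qed
        then have e: "exp (- real (n ^ 3) * t\<^sup>2 / (8 * T\<^sup>2 * M\<^sup>2)) \<le> exp (- (T ^ 2 / 2048))" by simp
        have l2: "real (n ^ 2 * l) \<le> 2 * T ^ 18"
        proof -
          have "real l \<le> 2 * T ^ 2"
          proof -
            have "1 / \<epsilon> \<le> T ^ 2" using \<epsilon>T(1) \<epsilon> T1 by (simp add: field_simps)
            then show ?thesis using l_bounds(2) by simp
          qed
          then have "real n ^ 2 * real l \<le> real n ^ 2 * (2 * T ^ 2)" by (intro mult_left_mono) auto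
          also have "\<dots> = 2 * T ^ 18" unfolding nT by (simp flip: power_mult power_add)
          finally show ?thesis by simp
        qed
        have n3: "real (n ^ 3) = T ^ 24" by (simp add: nT flip: power_mult)
        have "real (n ^ 2 * l) * (real n * (2 * real (n ^ 3) * (measure D {T<..} + \<theta>)
            + 2 * exp (- real (n ^ 3) * t\<^sup>2 / (8 * T\<^sup>2 * M\<^sup>2))))
          \<le> 2 * T ^ 18 * (T ^ 8 * (2 * T ^ 24 * (2 * \<theta>) + 2 * exp (- (T ^ 2 / 2048))))"
        proof (rule mult_mono[OF l2])
          show "real n * (2 * real (n ^ 3) * (measure D {T<..} + \<theta>) + 2 * exp (- real (n ^ 3) * t\<^sup>2 / (8 * T\<^sup>2 * M\<^sup>2)))
             \<le> T ^ 8 * (2 * T ^ 24 * (2 * \<theta>) + 2 * exp (- (T ^ 2 / 2048)))"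
            unfolding nT[symmetric] n3[symmetric] using e tail
            by (intro mult_left_mono add_mono) auto
          show "0 \<le> real n * (2 * real (n ^ 3) * (measure D {T<..} + \<theta>) + 2 * exp (- real (n ^ 3) * t\<^sup>2 / (8 * T\<^sup>2 * M\<^sup>2)))"
            using \<theta> by (intro mult_nonneg_nonneg add_nonneg_nonneg) auto
        qed (use T1 in auto)
        also have "\<dots> \<le> 1 / T ^ 16" by (rule L6)
        also have "\<dots> = 1 / real n ^ 2" by (simp add: nT flip: power_mult)
        finally show ?thesis by (simp add: n_def)
      qed
      show "2 ^ card N * card N * (4 * exp (- \<delta>\<^sup>2 / (2 * T\<^sup>2 * M\<^sup>2 * (1 - step_size l) ^ k))
        + 4 * exp (- 2 * \<theta>\<^sup>2 / (1 - step_size l) ^ k)) \<le> 1 / real n ^ 2"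
      proof -
        have TT: "T ^ 16 \<le> T ^ a" if "16 \<le> a" for a using T1 that by (intro power_increasing) auto
        have e1: "real n ^ 2 \<le> \<delta>\<^sup>2 / (2 * T\<^sup>2 * M\<^sup>2 * \<sigma>)"
        proof -
          have "real n ^ 2 = T ^ 16" by (simp add: nT flip: power_mult)
          also have "\<dots> \<le> T ^ 178" by (rule TT) simp
          also have "\<dots> = 1 / T ^ 4 / (2048 * T ^ 16 * T\<^sup>2) * (2048 * T ^ 200)"
            using T1 by (simp add: divide_simps flip: power_add)
          also have "\<dots> \<le> \<epsilon>\<^sup>2 / (2048 * T ^ 16 * T\<^sup>2) * (1 / \<sigma>)"
            using \<epsilon>T \<sigma> T1 by (intro mult_mono divide_right_mono) auto
          also have "\<dots> = \<delta>\<^sup>2 / (2 * T\<^sup>2 * M\<^sup>2 * \<sigma>)"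
          proof -
            have "T ^ 16 = real n ^ 2" by (simp add: nT flip: power_mult)
            then show ?thesis using n0 M unfolding \<delta>_def by (simp add: power_divide power_mult_distrib)
          qed
          finally show ?thesis .
        qed
        have e2: "real n ^ 2 \<le> 2 * \<theta>\<^sup>2 / \<sigma>"
        proof -
          have "real n ^ 2 = T ^ 16" by (simp add: nT flip: power_mult)
          also have "\<dots> \<le> T ^ 40" by (rule TT) simp
          also have "\<dots> = \<theta>\<^sup>2 * T ^ 200"
            using T1 by (simp add: \<theta>_def power_divide divide_simps flip: power_add power_mult)
          also have "\<dots> \<le> \<theta>\<^sup>2 * (1 / \<sigma>)"
          proof (rule mult_left_mono)
            have "T ^ 200 \<le> 2048 * T ^ 200" using T1 by simp
            then show "T ^ 200 \<le> 1 / \<sigma>" using \<sigma>(2) by linarith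
          qed simp
          also have "\<dots> \<le> 2 * \<theta>\<^sup>2 / \<sigma>" using \<sigma> by (simp add: divide_right_mono)
          finally show ?thesis .
        qed
        have "2 ^ n * real n * (4 * exp (- \<delta>\<^sup>2 / (2 * T\<^sup>2 * M\<^sup>2 * \<sigma>)) + 4 * exp (- 2 * \<theta>\<^sup>2 / \<sigma>))
          \<le> 2 ^ n * real n * (4 * exp (- (real n ^ 2)) + 4 * exp (- (real n ^ 2)))"
          using e1 e2 by (intro mult_left_mono add_mono) auto
        also have "\<dots> = 8 * 2 ^ n * real n * exp (- (real n ^ 2))" by simp
        also have "\<dots> \<le> 1 / real n ^ 2" by (rule L5)
        finally show ?thesis by (simp add: n_def \<sigma>_def)
      qed
      show "\<beta> * Max (f ` \<I>) \<le> f S"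
        if S: "S \<in> \<I>" and
          val: "local_ratio l * (Max (f ` \<I>) - 2 * real (matroid_rank \<I>) * (\<gamma> + 2 * (t + 2 * \<delta>))) \<le> f S" for S
      proof (cases "OPT = 0")
        case True
        then show ?thesis using f(1) matroidD(2)[OF mat S] unfolding OPT_def by simp
      next
        case False
        then have MO: "M = OPT" by (simp add: M_def)
        have "2 * real (matroid_rank \<I>) * (\<gamma> + 2 * (t + 2 * \<delta>)) \<le> 2 * real n * (\<gamma> + 2 * (t + 2 * \<delta>))"
          unfolding \<tau> using rn pos by (intro mult_right_mono) auto
        also have "\<dots> = 5 / 2 * \<epsilon> * M" unfolding \<tau> \<gamma>_def using n0 by (simp add: field_simps)
        finally have loss: "2 * real (matroid_rank \<I>) * (\<gamma> + 2 * (t + 2 * \<delta>)) \<le> 5 / 2 * \<epsilon> * M" .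
        have "\<beta> * M \<le> (local_ratio l - 5 / 2 * \<epsilon>) * M"
        proof (rule mult_right_mono)
          have "1 - 1 / exp 1 - 2 * h \<le> local_ratio l" unfolding h_def by (rule local_ratio_ge[OF l0])
          then show "\<beta> \<le> local_ratio l - 5 / 2 * \<epsilon>" using \<beta> h \<epsilon>(1) by linarith
        qed (use M in simp)
        also have "\<dots> = local_ratio l * M - 5 / 2 * \<epsilon> * M" by (simp add: left_diff_distrib)
        also have "\<dots> \<le> local_ratio l * M - local_ratio l * (5 / 2 * \<epsilon> * M)"
          using local_ratio_le_1[of l] local_ratio_pos[OF l0] \<epsilon> M by (simp add: mult_left_le_one_le)
        also have "\<dots> = local_ratio l * (M - 5 / 2 * \<epsilon> * M)" by (simp add: right_diff_distrib)
        also have "\<dots> \<le> local_ratio l * (M - 2 * real (matroid_rank \<I>) * (\<gamma> + 2 * (t + 2 * \<delta>)))"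
          using loss local_ratio_pos[OF l0] by (intro mult_left_mono) auto
        also have "\<dots> \<le> f S" using val unfolding MO OPT_def .
        finally show ?thesis unfolding MO OPT_def .
      qed
      show "1 / real n ^ 2 \<le> 1" using n by simp
      show "Max (f ` \<I>) \<le> M" using OPT_M unfolding OPT_def .
      show "2 * (t + 2 * \<delta>) \<le> \<gamma>" unfolding \<tau> using pos by simp
    qed (use mat sing rank k_def \<epsilon>1 l_def M pos \<theta> mean \<mu> nm in simp_all)
    then show ?thesis by (simp add: n_def)
  qed
qed

theorem theorem5p7:
  "\<exists>alg :: 'a set \<Rightarrow> real \<Rightarrow> 'a oracle_alg.
     \<forall>D. noise_distribution D \<longrightarrow>
     (\<forall>\<kappa>>0. \<exists>(c\<^sub>0::real) (n\<^sub>0::nat) (C\<^sub>1::real) (C\<^sub>2::real) (C\<^sub>3::real).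
        c\<^sub>0 > 0 \<and> C\<^sub>1 > 0 \<and> C\<^sub>2 > 0 \<and> C\<^sub>3 > 0 \<and>
        (\<forall>(\<epsilon>::real) (N::'a set) (\<I>::'a set set) (f::'a set \<Rightarrow> real) (n::nat) (r::nat).
           \<epsilon> > 0 \<longrightarrow>
           finite N \<longrightarrow> card N = n \<longrightarrow>
           n \<ge> n\<^sub>0 \<longrightarrow> real n \<ge> c\<^sub>0 / \<epsilon> ^ 4 \<longrightarrow>
           matroid N \<I> \<longrightarrow> (\<forall>e\<in>N. {e} \<in> \<I>) \<longrightarrow>
           matroid_rank \<I> = r \<longrightarrow> real r \<ge> \<kappa> * real n powr (1/3) \<longrightarrow>
           (\<forall>S\<subseteq>N. 0 \<le> f S) \<longrightarrow> f {} = 0 \<longrightarrow> mono_on (Pow N) f \<longrightarrow> submodular_on N f \<longrightarrow>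
           uses_at_most_queries (alg N \<epsilon>) N \<I> f D (C\<^sub>3 * real n ^ 6 / \<epsilon>) \<and>
           success_prob (alg N \<epsilon>) N \<I> f D (1/2 * (1 - 1 / exp 1) - C\<^sub>1 * \<epsilon>)
             \<ge> 1 - C\<^sub>2 / real n ^ 2 \<and>
           (strongly_base_orderable \<I> \<longrightarrow>
              success_prob (alg N \<epsilon>) N \<I> f D (1 - 1 / exp 1 - C\<^sub>1 * \<epsilon>)
                \<ge> 1 - C\<^sub>2 / real n ^ 2)))"
proof (intro exI[of _ noisy_local_search] allI impI, goal_cases)
  case (1 D \<kappa>)
  then obtain n0 where n0: "\<And>n. n0 \<le> n \<Longrightarrow> parameters_large D \<kappa> n"
    using eventually_parameters_large[of D \<kappa>] by (auto simp: eventually_sequentially)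
  have half: "1 / 2 * (1 - 1 / exp 1) - 5 * \<epsilon> \<le> 1 - 1 / exp 1 - 5 * \<epsilon>" for \<epsilon> :: real
    by (simp add: field_simps)
  show ?case
  \<comment> \<open>The noise distribution and \<kappa> affect only n0. The loss constant is 5; the
    2 adds the failures of noise and draws; the 4 comes from 2 n^6 l queries with l <= 2 /
    \<epsilon>.\<close>
  proof (rule exI[of _ 1], rule exI[of _ n0], rule exI[of _ 5], rule exI[of _ 2], rule exI[of _ 4],
      intro conjI allI impI, goal_cases)
    case (5 \<epsilon> N \<I> f n r)
    then show ?case using queries_noisy_local_search[of N \<I> \<epsilon> f D] by simp
  next
    case (6 \<epsilon> N \<I> f n r)
    then show ?case using noisy_local_search_correct[OF 1, of N \<epsilon> \<I> f] n0[of n] half by simp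
  next
    case (7 \<epsilon> N \<I> f n r)
    then show ?case using noisy_local_search_correct[OF 1, of N \<epsilon> \<I> f] n0[of n] by simp
  qed simp_all
qed

end
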